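(* Let $f\ge1$ be an integer and let $\bar\rho:W_t\to\hat G(\mathbb{F})$ be inertially unipotent (i.e. $\bar\rho(\sigma)$ unipotent) and $f$-distinguished, with $\hat M$ an allowable Levi subgroup for $\bar\rho$. Then the map \[\operatorname{char}_I: X^{\hat M}_{\bar\rho}\to S^{\hat M}_{\bar e}\] is formally smooth, where $\bar e$ is the point of $\mathcal{S}^{\hat M}(q)(\mathbb{F})$ given by the trivial homomorphism $I_t\to\hat T(\mathbb{F})$.
   Context: $p\ne l$ primes, $F/\mathbb{Q}_p$ finite with residue field of order $q$; $I_t\subset W_t$ tame inertia and tame Weil group, fixed standard generators $\sigma\in I_t$ (topological generator), $\phi\in W_t$ (Frobenius lift) with $\phi\sigma\phi^{-1}=\sigma^q$. $(E,\mathcal{O},\mathbb{F})$ an $l$-adic coefficient system; $\hat G$ an $\mathcal{O}$-group isomorphic to a finite product of general linear groups; $\hat M$ a Levi subgroup containing a split maximal torus $\hat T$, Weyl group $W_{\hat M}$. $\mathfrak{X}^{\hat M}(q)$ represents continuous homomorphisms $W_t\to\hat M(A)$ and $X^{\hat M}_{\bar\rho}$ is its completion at $\bar\rho$. $\mathcal{S}^{\hat M}(q)$ has $A$-points the $W_{\hat M}$-classes of homomorphisms $s:I_t\to\hat T(A)$ with $s(x^q)=ws(x)w^{-1}$ for some $w\in W_{\hat M}$; via $\sigma$ it is the fixed scheme of the $q$-power map on $\hat T/W_{\hat M}$. $\operatorname{char}_I$ is restriction to inertia (under this identification $\rho\mapsto$ class of $\rho(\sigma)$ in $\hat T/W_{\hat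 M}$), and $S^{\hat M}_{\bar e}$ is the completion of $\mathcal{S}^{\hat M}(q)$ at $\bar e$. Extendable: extends to $W_t$; discrete: no proper Levi through which (a conjugate of) the homomorphism factors extendably. $\bar\rho$ is $f$-distinguished with allowable Levi $\hat M$ if it factors through $\rho_{\hat M}:W_t\to\hat M(\mathbb{F})$ with $\rho_{\hat M}|_{I_t}$ discrete for $\hat M$ and the centraliser in $\hat G_{\mathbb{F}}$ of the semisimple part of $\bar\rho(\phi^f)$ contained in $\hat M_{\mathbb{F}}$. *)

theory Defs
  imports
    "HOL-Analysis.Analysis"
    "HOL-Library.Poly_Mapping"
    "HOL-Computational_Algebra.Polynomial"
    "HOL-Number_Theory.Modular_Inverse"
    "HOL-Algebra.Algebraic_Closure_Type"
begin

hide_const (open) Divisibility.prime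

section \<open>The tame Weil group\<close>

text \<open>
  Let \<open>F\<close> be a finite extension of the \<open>p\<close>-adic numbers whose residue field has order \<open>q\<close>.
  The choice of the standard generators identifies the tame inertia group with
  the projective limit of the groups \<open>\<int>/n\<close> over all \<open>n\<close> prime to \<open>p\<close>, and the tame Weil group
  with its semidirect product with \<open>\<int>\<close>, a Frobenius lift acting as multiplication by \<open>q\<close>.
  An element of the limit is given by its residues \<open>x n \<in> {0..<n}\<close> (and \<open>x n = 0\<close> for the
  irrelevant \<open>n\<close>); the pair \<open>(x, a)\<close> stands for \<open>\<sigma>\<^sup>x \<phi>\<^sup>a\<close>.
\<close>

type_synonym tame = "(nat \<Rightarrow> int) \<times> int"

definition levels :: "nat \<Rightarrow> nat set" where
  "levels p = {n. n > 0 \<and> coprime n p}"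

definition Zhat_prime_to :: "nat \<Rightarrow> (nat \<Rightarrow> int) set" where
  "Zhat_prime_to p =
    {x. (\<forall>n. n \<notin> levels p \<longrightarrow> x n = 0)
      \<and> (\<forall>n\<in>levels p. 0 \<le> x n \<and> x n < int n)
      \<and> (\<forall>n\<in>levels p. \<forall>m. m dvd n \<longrightarrow> x n mod int m = x m)}"

text \<open>A representative modulo \<open>n\<close> of \<open>q\<^sup>a\<close>, for \<open>q\<close> prime to \<open>n\<close> and \<open>a\<close> of either sign.\<close>

definition qpow :: "nat \<Rightarrow> nat \<Rightarrow> int \<Rightarrow> int" where
  "qpow q n a = (if 0 \<le> a then int q ^ nat a else modular_inverse (int n) (int q) ^ nat (- a))"

definition tame_mult :: "nat \<Rightarrow> nat \<Rightarrow> tame \<Rightarrow> tame \<Rightarrow> tame" where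
  "tame_mult p q v w =
    ((\<lambda>n. if n \<in> levels p then (fst v n + qpow q n (snd v) * fst w n) mod int n else 0),
     snd v + snd w)"

definition tame_weil :: "nat \<Rightarrow> nat \<Rightarrow> tame monoid" where
  "tame_weil p q =
    \<lparr>carrier = Zhat_prime_to p \<times> UNIV, mult = tame_mult p q, one = (\<lambda>_. 0, 0)\<rparr>"

definition tame_inertia :: "nat \<Rightarrow> tame set" where
  "tame_inertia p = Zhat_prime_to p \<times> {0}"

definition tame_sigma :: "nat \<Rightarrow> tame" where
  "tame_sigma p = (\<lambda>n. if n \<in> levels p then 1 mod int n else 0, 0)"

definition tame_phi :: tame where
  "tame_phi = (\<lambda>_. 0, 1)"

lemma qpow_add:
  assumes "n \<in> levels p" "coprime n q"
  shows "[qpow q n (a + b) = qpow q n a * qpow q n b] (mod int n)"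
proof -
  let ?u = "modular_inverse (int n) (int q)" let ?Q = "int q"
  have inv: "[?u * ?Q = 1] (mod int n)"
    using assms by (intro cong_modular_inverse2) (simp add: coprime_commute)
  have key: "[?Q ^ i * ?u ^ j = qpow q n (int i - int j)] (mod int n)" for i j
  proof (cases "j \<le> i")
    case True
    then obtain k where k: "i = j + k" using le_Suc_ex by blast
    have "[?Q ^ k * (?u * ?Q) ^ j = ?Q ^ k * 1 ^ j] (mod int n)"
      using inv by (intro cong_mult cong_pow) auto
    then show ?thesis by (simp add: k qpow_def power_add power_mult_distrib ac_simps)
  next
    case False
    then obtain k where k: "j = i + k" "k > 0" using less_imp_add_positive by (metis not_le)
    have "[?u ^ k * (?u * ?Q) ^ i = ?u ^ k * 1 ^ i] (mod int n)"
      using inv by (intro cong_mult cong_pow) auto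
    then show ?thesis using k by (simp add: qpow_def power_add power_mult_distrib ac_simps)
  qed
  have rep: "\<exists>i j. c = int i - int j \<and> qpow q n c = ?Q ^ i * ?u ^ j" for c
  proof (cases "c \<ge> 0")
    case True then show ?thesis
      by (intro exI[of _ "nat c"] exI[of _ 0]) (simp add: qpow_def)
  next
    case False then show ?thesis
      by (intro exI[of _ 0] exI[of _ "nat (-c)"]) (simp add: qpow_def)
  qed
  obtain i j i' j' where a: "a = int i - int j" "qpow q n a = ?Q ^ i * ?u ^ j"
    and b: "b = int i' - int j'" "qpow q n b = ?Q ^ i' * ?u ^ j'"
    using rep by metis
  have "qpow q n a * qpow q n b = ?Q ^ (i + i') * ?u ^ (j + j')"
    unfolding a(2) b(2) by (simp add: power_add ac_simps)
  moreover have "a + b = int (i + i') - int (j + j')" unfolding a(1) b(1) by simp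
  ultimately show ?thesis using cong_sym[OF key[of "i + i'" "j + j'"]] by argo
qed

lemma levels_dvd: "n \<in> levels p \<Longrightarrow> m dvd n \<Longrightarrow> m \<in> levels p"
  by (auto simp: levels_def intro: Nat.gr0I coprime_divisors[of m n p p])

lemma Zhat_prime_toI:
  assumes "\<And>n m. n \<in> levels p \<Longrightarrow> m dvd n \<Longrightarrow> y n mod int m = y m mod int m"
  shows "(\<lambda>n. if n \<in> levels p then y n mod int n else 0) \<in> Zhat_prime_to p"
  unfolding Zhat_prime_to_def mem_Collect_eq
proof (intro conjI ballI allI impI)
  fix n m assume nm: "n \<in> levels p" "m dvd n"
  have "y n mod int n mod int m = y n mod int m"
    using nm(2) by (simp add: mod_mod_cancel)
  with assms[OF nm] levels_dvd[OF nm] nm(1)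
  show "(if n \<in> levels p then y n mod int n else 0) mod int m =
        (if m \<in> levels p then y m mod int m else 0)"
    by simp
qed (auto simp: levels_def)

lemma qpow_dvd:
  assumes "n \<in> levels p" "coprime n q" "m dvd n"
  shows "[qpow q n a = qpow q m a] (mod int m)"
proof -
  let ?u = "modular_inverse (int n) (int q)" and ?v = "modular_inverse (int m) (int q)"
  have cm: "coprime m q" using assms(2,3) coprime_divisors[of m n q q] by simp
  have "[?u * int q = 1] (mod int n)"
    using assms by (intro cong_modular_inverse2) (simp add: coprime_commute)
  then have 1: "[?u * int q = 1] (mod int m)"
    using assms(3) by (meson cong_dvd_modulus of_nat_dvd_iff)
  have 2: "[?v * int q = 1] (mod int m)"
    using cm by (intro cong_modular_inverse2) (simp add: coprime_commute)
  have "[?u = ?v] (mod int m)"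
    using cong_mult_rcancel[of "int q" "int m"] cm cong_trans[OF 1 cong_sym[OF 2]]
    by (simp add: coprime_commute)
  then show ?thesis by (simp add: qpow_def cong_pow)
qed

text \<open>The semidirect product is indeed a group, with the relation of the standard generators.\<close>

lemma group_tame_weil:
  assumes "prime p" "q = p ^ d"
  shows "group (tame_weil p q)"
proof -
  have cop: "coprime n q" if "n \<in> levels p" for n
    using that assms by (simp add: levels_def)
  have closed: "tame_mult p q v w \<in> Zhat_prime_to p \<times> UNIV"
    if vw: "v \<in> Zhat_prime_to p \<times> UNIV" "w \<in> Zhat_prime_to p \<times> UNIV" for v w
  proof -
    have "(fst v n + qpow q n (snd v) * fst w n) mod int m =
          (fst v m + qpow q m (snd v) * fst w m) mod int m"
      if n: "n \<in> levels p" and m: "m dvd n" for n m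
    proof -
      have "[fst v n = fst v m] (mod int m)" "[fst w n = fst w m] (mod int m)"
      proof -
        have "fst v m = fst v n mod int m" "fst w m = fst w n mod int m"
          using vw n m by (auto simp: Zhat_prime_to_def)
        then show "[fst v n = fst v m] (mod int m)" "[fst w n = fst w m] (mod int m)"
          by (simp_all add: Cong.cong_def)
      qed
      with qpow_dvd[OF n cop[OF n] m]
      have "[fst v n + qpow q n (snd v) * fst w n = fst v m + qpow q m (snd v) * fst w m] (mod int m)"
        by (intro cong_add cong_mult)
      then show ?thesis
        by (simp add: Cong.cong_def)
    qed
    then show ?thesis
      unfolding tame_mult_def by (intro SigmaI UNIV_I Zhat_prime_toI)
  qed
  have red: "x n mod int n = x n" if "x \<in> Zhat_prime_to p" "n \<in> levels p" for x n
    using that by (auto simp: Zhat_prime_to_def)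
  have zero: "x n = 0" if "x \<in> Zhat_prime_to p" "n \<notin> levels p" for x n
    using that by (auto simp: Zhat_prime_to_def)
  have one: "qpow q n 0 = 1" for n by (simp add: qpow_def)
  have assoc: "tame_mult p q (tame_mult p q u v) w = tame_mult p q u (tame_mult p q v w)" for u v w
  proof -
    have "((fst u n + qpow q n (snd u) * fst v n) mod int n
             + qpow q n (snd u + snd v) * fst w n) mod int n =
          (fst u n + qpow q n (snd u) * ((fst v n + qpow q n (snd v) * fst w n) mod int n)) mod int n"
      if n: "n \<in> levels p" for n
    proof -
      have "[(fst u n + qpow q n (snd u) * fst v n) mod int n + qpow q n (snd u + snd v) * fst w n
           = (fst u n + qpow q n (snd u) * fst v n) + (qpow q n (snd u) * qpow q n (snd v)) * fst w n]
            (mod int n)"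
        using qpow_add[OF n cop[OF n]] by (intro cong_add cong_mult) auto
      also have "(fst u n + qpow q n (snd u) * fst v n) + (qpow q n (snd u) * qpow q n (snd v)) * fst w n
           = fst u n + qpow q n (snd u) * (fst v n + qpow q n (snd v) * fst w n)"
        by (simp add: algebra_simps)
      also have "[\<dots> = fst u n + qpow q n (snd u) * ((fst v n + qpow q n (snd v) * fst w n) mod int n)]
            (mod int n)"
        by (intro cong_add cong_mult) (auto simp: Cong.cong_def)
      finally show ?thesis by (simp add: Cong.cong_def)
    qed
    then show ?thesis by (auto simp: tame_mult_def)
  qed
  show ?thesis
  proof (rule groupI)
    fix v assume "v \<in> carrier (tame_weil p q)"
    then obtain x a where v: "v = (x, a)" and x: "x \<in> Zhat_prime_to p"
      by (auto simp: tame_weil_def)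
    have z: "(\<lambda>_. 0) \<in> Zhat_prime_to p" by (auto simp: Zhat_prime_to_def levels_def)
    show "\<one>\<^bsub>tame_weil p q\<^esub> \<otimes>\<^bsub>tame_weil p q\<^esub> v = v"
      using red[OF x] zero[OF x] one by (auto simp: tame_weil_def tame_mult_def v)
    let ?y = "\<lambda>n. if n \<in> levels p then (- (qpow q n (- a) * x n)) mod int n else 0"
    have y: "(?y, - a) = tame_mult p q (\<lambda>_. 0, - a) (\<lambda>n. if n \<in> levels p then (- x n) mod int n else 0, 0)"
      by (auto simp: tame_mult_def mod_mult_right_eq)
    have "(\<lambda>n. if n \<in> levels p then (- x n) mod int n else 0) \<in> Zhat_prime_to p"
    proof (rule Zhat_prime_toI)
      fix n m assume "n \<in> levels p" "m dvd n"
      then have "x m = x n mod int m" using x by (auto simp: Zhat_prime_to_def)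
      then show "(- x n) mod int m = (- x m) mod int m" by (simp add: mod_minus_eq)
    qed
    then have "(?y, - a) \<in> carrier (tame_weil p q)"
      unfolding y tame_weil_def using closed z by auto
    moreover have "(?y, - a) \<otimes>\<^bsub>tame_weil p q\<^esub> v = \<one>\<^bsub>tame_weil p q\<^esub>"
      by (auto simp: tame_weil_def tame_mult_def v mod_add_left_eq)
    ultimately show "\<exists>w\<in>carrier (tame_weil p q). w \<otimes>\<^bsub>tame_weil p q\<^esub> v = \<one>\<^bsub>tame_weil p q\<^esub>"
      by blast
  next
    show "\<one>\<^bsub>tame_weil p q\<^esub> \<in> carrier (tame_weil p q)"
      by (auto simp: tame_weil_def Zhat_prime_to_def levels_def)
  qed (use closed assoc in \<open>auto simp: tame_weil_def\<close>)
qed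

lemma sigma_in_carrier: "tame_sigma p \<in> carrier (tame_weil p q)"
  unfolding tame_sigma_def tame_weil_def by (auto intro: Zhat_prime_toI)

lemma phi_in_carrier: "tame_phi \<in> carrier (tame_weil p q)"
  by (auto simp: tame_phi_def tame_weil_def Zhat_prime_to_def levels_def)

lemma sigma_pow:
  "tame_sigma p [^]\<^bsub>tame_weil p q\<^esub> k = (\<lambda>n. if n \<in> levels p then int k mod int n else 0, 0)"
proof (induction k)
  case 0
  then show ?case by (auto simp: tame_weil_def)
next
  case (Suc k)
  have "(int k mod int n + 1 mod int n) mod int n = int (Suc k) mod int n" for n
    by (simp add: mod_add_eq add.commute)
  with Suc show ?case
    by (auto simp: tame_weil_def tame_mult_def tame_sigma_def qpow_def)
qed

lemma tame_relation:
  "tame_phi \<otimes>\<^bsub>tame_weil p q\<^esub> tame_sigma p =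
   (tame_sigma p [^]\<^bsub>tame_weil p q\<^esub> q) \<otimes>\<^bsub>tame_weil p q\<^esub> tame_phi"
  unfolding sigma_pow
  by (auto simp: tame_weil_def tame_mult_def tame_sigma_def tame_phi_def qpow_def mod_simps)

text \<open>The profinite topology on inertia, which is an open subgroup.\<close>

definition tame_topology :: "nat \<Rightarrow> nat \<Rightarrow> tame topology" where
  "tame_topology p q =
    subtopology
      (prod_topology (product_topology (\<lambda>_. discrete_topology UNIV) UNIV) (discrete_topology UNIV))
      (carrier (tame_weil p q))"

text \<open>Continuous homomorphisms to a discrete group.\<close>

definition cont_homs :: "nat \<Rightarrow> nat \<Rightarrow> 'g monoid \<Rightarrow> (tame \<Rightarrow> 'g) set" where
  "cont_homs p q H =
    {\<rho> \<in> hom (tame_weil p q) H.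
      continuous_map (tame_topology p q) (discrete_topology (carrier H)) \<rho>}"

section \<open>Coefficients\<close>

definition ring_map :: "('a::comm_ring_1 \<Rightarrow> 'b::comm_ring_1) \<Rightarrow> bool" where
  "ring_map f \<longleftrightarrow>
    f 1 = 1 \<and> (\<forall>x y. f (x + y) = f x + f y) \<and> (\<forall>x y. f (x * y) = f x * f y)"

text \<open>
  The rings of integers of the finite extensions of the \<open>l\<close>-adic numbers are exactly the complete
  discrete valuation rings of characteristic zero with finite residue field of characteristic \<open>l\<close>.
  Characteristic zero and finiteness are in the type classes; \<open>red\<close> is the
  reduction map to the residue field and \<open>w\<close> a uniformiser.
\<close>

definition coefficient_system ::
    "nat \<Rightarrow> ('o::{idom,ring_char_0} \<Rightarrow> 'k::{field,finite}) \<Rightarrow> bool" where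
  "coefficient_system l red \<longleftrightarrow>
    ring_map red \<and> surj red \<and> of_nat l = (0::'k) \<and>
    (\<exists>w. w \<noteq> 0
       \<and> (\<forall>x. red x = 0 \<longleftrightarrow> w dvd x)
       \<and> (\<forall>x. red x \<noteq> 0 \<longrightarrow> x dvd 1)
       \<and> (\<forall>x. x \<noteq> 0 \<longrightarrow> (\<exists>n. \<not> w ^ n dvd x))
       \<and> (\<forall>s :: nat \<Rightarrow> 'o. (\<forall>n. w ^ n dvd s (Suc n) - s n) \<longrightarrow>
             (\<exists>x. \<forall>n. w ^ n dvd x - s n)))"

definition is_ideal :: "'a::comm_ring_1 set \<Rightarrow> bool" where
  "is_ideal N \<longleftrightarrow>
    0 \<in> N \<and> (\<forall>x\<in>N. \<forall>y\<in>N. x + y \<in> N) \<and> (\<forall>a. \<forall>x\<in>N. a * x \<in> N)"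

definition nilpotent_ideal :: "'a::comm_ring_1 set \<Rightarrow> bool" where
  "nilpotent_ideal N \<longleftrightarrow>
    is_ideal N \<and> (\<exists>n. \<forall>x :: nat \<Rightarrow> 'a. (\<forall>k<n. x k \<in> N) \<longrightarrow> (\<Prod>k<n. x k) = 0)"

section \<open>Products of general linear groups and their Levi subgroups\<close>

text \<open>
  A finite product of general linear groups is realised as the group of invertible matrices,
  with rows and columns indexed by \<open>'n\<close>, that are block diagonal for an equivalence relation \<open>P\<close>
  on \<open>'n\<close>: one factor for each class, of rank the size of the class.
  All of these groups contain the diagonal torus.  If \<open>P\<close> is finer than \<open>Q\<close>, then the group of \<open>P\<close>
  is a Levi subgroup of the group of \<open>Q\<close>, and every Levi subgroup containing the diagonal torus
  is of this form.  Over a local ring any split maximal torus is conjugate to the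
  diagonal one, so this covers all Levi subgroups containing a split maximal torus, after a
  suitable choice of the isomorphism with a product of general linear groups.
\<close>

definition levi :: "('n::finite \<Rightarrow> 'n \<Rightarrow> bool) \<Rightarrow> ('a::comm_ring_1^'n^'n) monoid" where
  "levi P =
    \<lparr>carrier = {g. invertible g \<and> (\<forall>i j. \<not> P i j \<longrightarrow> g $ i $ j = 0)},
     mult = (**), one = mat 1\<rparr>"

definition weyl :: "('n::finite \<Rightarrow> 'n \<Rightarrow> bool) \<Rightarrow> ('n \<Rightarrow> 'n) set" where
  "weyl P = {w. bij w \<and> (\<forall>i. P i (w i))}"

definition mat_power :: "'a::comm_ring_1^'n^'n \<Rightarrow> nat \<Rightarrow> 'a^'n^'n::finite" where
  "mat_power g k = (((**) g) ^^ k) (mat 1)"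

definition unipotent :: "'a::comm_ring_1^'n^'n::finite \<Rightarrow> bool" where
  "unipotent g \<longleftrightarrow> (\<exists>k. mat_power (g - mat 1) k = 0)"

definition semisimple :: "'k::field^'n^'n::finite \<Rightarrow> bool" where
  "semisimple g \<longleftrightarrow>
    (\<exists>h d :: 'k alg_closure^'n^'n. invertible h \<and> (\<forall>i j. i \<noteq> j \<longrightarrow> d $ i $ j = 0)
       \<and> map_matrix to_ac g ** h = h ** d)"

text \<open>The multiplicative Jordan decomposition, over a perfect field.\<close>

definition semisimple_part :: "'k::field^'n^'n::finite \<Rightarrow> 'k^'n^'n" where
  "semisimple_part g =
    (THE s. semisimple s \<and> (\<exists>u. unipotent u \<and> g = s ** u \<and> s ** u = u ** s))"

text \<open>
  The centraliser in the group of \<open>Q\<close> of a rational point is a smooth group scheme, so its inclusion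
  in the group of \<open>P\<close> may be tested on points over the algebraic closure.
\<close>

definition centraliser_le ::
    "('n \<Rightarrow> 'n \<Rightarrow> bool) \<Rightarrow> 'k::field^'n^'n::finite \<Rightarrow> ('n \<Rightarrow> 'n \<Rightarrow> bool) \<Rightarrow> bool" where
  "centraliser_le Q s P \<longleftrightarrow>
    (\<forall>h :: 'k alg_closure^'n^'n. h \<in> carrier (levi Q) \<longrightarrow>
       h ** map_matrix to_ac s = map_matrix to_ac s ** h \<longrightarrow> h \<in> carrier (levi P))"

section \<open>Discrete inertial homomorphisms and distinguished representations\<close>

text \<open>In the next two definitions only the values of \<open>s\<close> on inertia matter.\<close>

definition extendable ::
    "nat \<Rightarrow> nat \<Rightarrow> ('n \<Rightarrow> 'n \<Rightarrow> bool) \<Rightarrow> (tame \<Rightarrow> 'k::field^'n^'n::finite) \<Rightarrow> bool" where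
  "extendable p q P s \<longleftrightarrow> (\<exists>\<rho>\<in>cont_homs p q (levi P). \<forall>x\<in>tame_inertia p. \<rho> x = s x)"

definition inertially_discrete ::
    "nat \<Rightarrow> nat \<Rightarrow> ('n \<Rightarrow> 'n \<Rightarrow> bool) \<Rightarrow> (tame \<Rightarrow> 'k::field^'n^'n::finite) \<Rightarrow> bool" where
  "inertially_discrete p q P s \<longleftrightarrow>
    \<not> (\<exists>Q. equivp Q \<and> Q < P \<and>
         (\<exists>h\<in>carrier (levi P). extendable p q Q (\<lambda>x. h ** s x ** matrix_inv h)))"

definition f_distinguished ::
    "nat \<Rightarrow> nat \<Rightarrow> nat \<Rightarrow> ('n \<Rightarrow> 'n \<Rightarrow> bool) \<Rightarrow> ('n \<Rightarrow> 'n \<Rightarrow> bool)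
      \<Rightarrow> (tame \<Rightarrow> 'k::field^'n^'n::finite) \<Rightarrow> bool" where
  "f_distinguished f p q G M \<rho> \<longleftrightarrow>
    \<rho> \<in> cont_homs p q (levi M)
    \<and> inertially_discrete p q M \<rho>
    \<and> centraliser_le G (semisimple_part (\<rho> (tame_phi [^]\<^bsub>tame_weil p q\<^esub> f))) M"

section \<open>The quotient of the torus by the Weyl group\<close>

text \<open>
  The coordinate ring of the diagonal torus is the group algebra of its character lattice
  \<open>int^'n\<close>.  The quotient by the Weyl group is the spectrum of the ring of invariants, so its
  points in an algebra are the algebra homomorphisms on the invariants; these are represented by
  functions whose values outside the invariants are irrelevant.
\<close>

type_synonym ('n, 'o) torus_ring = "(int^'n) \<Rightarrow>\<^sub>0 'o"

definition invariants :: "('n::finite \<Rightarrow> 'n \<Rightarrow> bool) \<Rightarrow> ('n, 'o::comm_ring_1) torus_ring set" where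
  "invariants P = {u. \<forall>w\<in>weyl P. \<forall>e. Poly_Mapping.lookup u (\<chi> i. e $ w i) = Poly_Mapping.lookup u e}"

definition quotient_points ::
    "('n::finite \<Rightarrow> 'n \<Rightarrow> bool) \<Rightarrow> ('o::comm_ring_1 \<Rightarrow> 'c::comm_ring_1)
      \<Rightarrow> (('n, 'o) torus_ring \<Rightarrow> 'c) set" where
  "quotient_points P \<alpha> =
    {c. (\<forall>a. c (Poly_Mapping.single 0 a) = \<alpha> a)
      \<and> (\<forall>u\<in>invariants P. \<forall>v\<in>invariants P. c (u + v) = c u + c v \<and> c (u * v) = c u * c v)}"

text \<open>Pullback of functions along the \<open>q\<close>-power map of the torus.\<close>

definition power_pullback ::
    "nat \<Rightarrow> ('n::finite, 'o::comm_ring_1) torus_ring \<Rightarrow> ('n, 'o) torus_ring" where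
  "power_pullback q u =
    (\<Sum>e\<in>Poly_Mapping.keys u. Poly_Mapping.single (\<chi> i. int q * e $ i) (Poly_Mapping.lookup u e))"

definition S_points ::
    "nat \<Rightarrow> ('n::finite \<Rightarrow> 'n \<Rightarrow> bool) \<Rightarrow> ('o::comm_ring_1 \<Rightarrow> 'c::comm_ring_1)
      \<Rightarrow> (('n, 'o) torus_ring \<Rightarrow> 'c) set" where
  "S_points q P \<alpha> =
    {c \<in> quotient_points P \<alpha>. \<forall>u\<in>invariants P. c (power_pullback q u) = c u}"

text \<open>Evaluation of a function at the identity of the torus.\<close>

definition value_at_one :: "('n::finite, 'o::comm_ring_1) torus_ring \<Rightarrow> 'o" where
  "value_at_one u = (\<Sum>e\<in>Poly_Mapping.keys u. Poly_Mapping.lookup u e)"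

text \<open>
  The Chevalley morphism from the group of \<open>P\<close> to the quotient: \<open>c\<close> is the class of \<open>g\<close> if, for every
  block, \<open>c\<close> maps the polynomial with roots the torus coordinates of the block to the
  characteristic polynomial of the block of \<open>g\<close>.  Since the elementary symmetric functions of the
  blocks and the inverses of the top ones generate the invariants, the class
  is unique; on a diagonal matrix it is evaluation at that point of the torus.
\<close>

definition torus_coord :: "'n::finite \<Rightarrow> ('n, 'o::comm_ring_1) torus_ring" where
  "torus_coord i = Poly_Mapping.single (axis i 1) 1"

definition generic_charpoly ::
    "('n::finite \<Rightarrow> 'n \<Rightarrow> bool) \<Rightarrow> 'n \<Rightarrow> ('n, 'o::comm_ring_1) torus_ring poly" where
  "generic_charpoly P i = (\<Prod>j\<in>{j. P i j}. [:- torus_coord j, 1:])"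

definition block_charpoly ::
    "('n::finite \<Rightarrow> 'n \<Rightarrow> bool) \<Rightarrow> 'n \<Rightarrow> 'c::comm_ring_1^'n^'n \<Rightarrow> 'c poly" where
  "block_charpoly P i g =
    det ((\<chi> j k. if P i j \<and> P i k then (if j = k then [:0, 1:] else 0) - [:g $ j $ k:]
                 else if j = k then 1 else 0) :: 'c poly^'n^'n)"

definition is_class_of ::
    "('n::finite \<Rightarrow> 'n \<Rightarrow> bool) \<Rightarrow> (('n, 'o::comm_ring_1) torus_ring \<Rightarrow> 'c::comm_ring_1)
      \<Rightarrow> 'c^'n^'n \<Rightarrow> bool" where
  "is_class_of P c g \<longleftrightarrow>
    (\<forall>i m. c (Polynomial.coeff (generic_charpoly P i) m) = Polynomial.coeff (block_charpoly P i g) m)"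

lemma ring_map_0: "ring_map f \<Longrightarrow> f 0 = 0"
  unfolding ring_map_def by (metis add_cancel_right_right)

lemma ring_map_minus: "ring_map f \<Longrightarrow> f (- x) = - f x"
  by (metis add_eq_0_iff ring_map_0 ring_map_def)

lemma ring_map_sum: "ring_map f \<Longrightarrow> f (sum g A) = (\<Sum>x\<in>A. f (g x))"
  by (induction A rule: infinite_finite_induct) (auto simp: ring_map_0, auto simp: ring_map_def)

lemma coeff_ring_map_prod:
  assumes "ring_map f" and "\<And>j k. f (Polynomial.coeff (a j) k) = Polynomial.coeff (b j) k"
  shows "f (Polynomial.coeff (prod a A) k) = Polynomial.coeff (prod b A) k"
proof (induction A arbitrary: k rule: infinite_finite_induct)
  case (insert x F)
  have mult: "f (u * v) = f u * f v" for u v using assms(1) by (simp add: ring_map_def)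
  show ?case
    using insert by (simp add: coeff_mult ring_map_sum[OF assms(1)] mult assms(2))
qed (use assms(1) in \<open>auto simp: ring_map_def ring_map_0[OF assms(1)] coeff_1 if_distrib\<close>)

text \<open>
  A point of the torus is a homomorphism \<open>c\<close> on its coordinate ring; its image in the quotient is the
  class of the corresponding diagonal matrix.
\<close>

lemma class_of_torus_point:
  assumes "ring_map c"
  shows "is_class_of P c (\<chi> i j. if i = j then c (torus_coord i) else 0)"
proof -
  have "block_charpoly P i (\<chi> i j. if i = j then c (torus_coord i) else 0)
      = (\<Prod>j\<in>{j. P i j}. [:- c (torus_coord j), 1:])" for i
    unfolding block_charpoly_def
    by (subst det_diagonal)
       (auto simp: prod.If_cases intro!: prod.cong)
  moreover have "c (Polynomial.coeff [:- torus_coord j, 1:] k) = Polynomial.coeff [:- c (torus_coord j), 1:] k"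
    for j k
    using assms by (auto simp: coeff_pCons ring_map_minus ring_map_0 ring_map_def split: nat.split)
  ultimately show ?thesis
    by (auto simp: is_class_of_def generic_charpoly_def intro: coeff_ring_map_prod[OF assms])
qed

section \<open>Completions and formal smoothness\<close>

text \<open>
  The completion of a scheme at a closed point with maximal ideal \<open>m\<close> has as points in a (discrete)
  algebra \<open>C\<close> those points of the scheme for which \<open>m\<close> generates a nilpotent
  ideal of \<open>C\<close>, i.e. which agree with the given closed point modulo some nilpotent ideal \<open>N\<close>.
\<close>

definition X_completion ::
    "nat \<Rightarrow> nat \<Rightarrow> ('o::comm_ring_1 \<Rightarrow> 'k::field) \<Rightarrow> ('n \<Rightarrow> 'n \<Rightarrow> bool)
      \<Rightarrow> (tame \<Rightarrow> 'k^'n^'n::finite) \<Rightarrow> ('o \<Rightarrow> 'c::comm_ring_1) \<Rightarrow> (tame \<Rightarrow> 'c^'n^'n) set" where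
  "X_completion p q red P \<rho>bar \<alpha> =
    {\<rho> \<in> cont_homs p q (levi P). \<exists>N. nilpotent_ideal N \<and> (\<forall>a. red a = 0 \<longrightarrow> \<alpha> a \<in> N) \<and>
       (\<forall>x\<in>carrier (tame_weil p q). \<forall>i j a. red a = \<rho>bar x $ i $ j \<longrightarrow> \<rho> x $ i $ j - \<alpha> a \<in> N)}"

definition S_completion ::
    "nat \<Rightarrow> ('o::comm_ring_1 \<Rightarrow> 'k::field) \<Rightarrow> ('n::finite \<Rightarrow> 'n \<Rightarrow> bool)
      \<Rightarrow> ('o \<Rightarrow> 'c::comm_ring_1) \<Rightarrow> (('n, 'o) torus_ring \<Rightarrow> 'c) set" where
  "S_completion q red P \<alpha> =
    {c \<in> S_points q P \<alpha>. \<exists>N. nilpotent_ideal N \<and> (\<forall>a. red a = 0 \<longrightarrow> \<alpha> a \<in> N) \<and>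
       (\<forall>u\<in>invariants P. \<forall>a. red a = red (value_at_one u) \<longrightarrow> c u - \<alpha> a \<in> N)}"

text \<open>
  The infinitesimal lifting property: for every \<open>\<O>\<close>-algebra \<open>C\<close> and every quotient \<open>\<pi> : C \<rightarrow> B\<close> with
  nilpotent kernel, the map from \<open>X(C)\<close> to the fibre product of \<open>X(B)\<close> and \<open>S(C)\<close> over \<open>S(B)\<close> is
  surjective.  The underlying types of the test algebras are parameters, so that formal
  smoothness is the statement for all types.
\<close>

definition char_I_formally_smooth ::
    "nat \<Rightarrow> nat \<Rightarrow> ('o::comm_ring_1 \<Rightarrow> 'k::field) \<Rightarrow> ('n \<Rightarrow> 'n \<Rightarrow> bool)
      \<Rightarrow> (tame \<Rightarrow> 'k^'n^'n::finite) \<Rightarrow> 'c::comm_ring_1 itself \<Rightarrow> 'b::comm_ring_1 itself \<Rightarrow> bool" where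
  "char_I_formally_smooth p q red P \<rho>bar TYPE('c) TYPE('b) \<longleftrightarrow>
    (\<forall>(\<alpha> :: 'o \<Rightarrow> 'c) (\<pi> :: 'c \<Rightarrow> 'b).
       ring_map \<alpha> \<longrightarrow> ring_map \<pi> \<longrightarrow> surj \<pi> \<longrightarrow> nilpotent_ideal {x. \<pi> x = 0} \<longrightarrow>
       (\<forall>\<rho>\<^sub>B \<in> X_completion p q red P \<rho>bar (\<pi> \<circ> \<alpha>). \<forall>c \<in> S_completion q red P \<alpha>.
          is_class_of P (\<pi> \<circ> c) (\<rho>\<^sub>B (tame_sigma p)) \<longrightarrow>
          (\<exists>\<rho> \<in> X_completion p q red P \<rho>bar \<alpha>.
             (\<forall>x\<in>carrier (tame_weil p q). map_matrix \<pi> (\<rho> x) = \<rho>\<^sub>B x)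
             \<and> is_class_of P c (\<rho> (tame_sigma p)))))"

end

theory Submission
  imports Defs
begin

text \<open>
  If the unipotent matrix \<open>\<rho>bar(\<sigma>)\<close> had a block with more than one Jordan block, its Jordan
  decomposition would give a conjugate in a proper Levi subgroup, and there it would be conjugate to
  its \<open>q\<close>-th power, as \<open>q\<close> is invertible in the residue field; so discreteness forces \<open>\<rho>bar(\<sigma>)\<close> to
  be regular, i.e. to have a cyclic vector in every block.
  Cyclic vectors lift along nilpotent ideals.  Hence \<open>\<Sigma>\<^sub>B = \<rho>\<^sub>B(\<sigma>)\<close> is conjugate to the companion matrix of
  its characteristic polynomial, and lifting the conjugating matrix arbitrarily and the polynomial
  as prescribed by \<open>c\<close> gives a lift \<open>\<Sigma>\<close>.  Since \<open>c\<close> is fixed by the \<open>q\<close>-power map, \<open>\<Sigma>\<close> and \<open>\<Sigma>\<^sup>q\<close>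
  have the same characteristic polynomial.  A matrix \<open>\<Phi>\<close> with \<open>\<Phi> \<Sigma> = \<Sigma>\<^sup>q \<Phi>\<close> is then determined by the image
  of the cyclic vector, which may be prescribed freely, so \<open>\<rho>\<^sub>B(\<phi>)\<close> lifts too.  Finally \<open>\<Sigma>\<close> has
  finite order prime to \<open>p\<close>, because \<open>l\<close> is nilpotent in the test ring.
\<close>

section \<open>Relational ring homomorphisms and block matrices\<close>

no_notation Formal_Power_Series.fps_nth (infixl \<open>$\<close> 75)

text \<open>A cyclic vector means that the Krylov matrix \<open>krylov P g v\<close> is invertible,
  and Cayley-Hamilton says that this matrix intertwines \<open>g\<close> with its companion matrix.
  If \<open>g\<close> and \<open>g'\<close> have the same characteristic polynomial and Krylov
  matrices \<open>L\<close> and \<open>L2\<close>, then \<open>L2\<close> times the inverse of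
  \<open>L\<close> intertwines them; this is the origin of \<open>\<Phi>\<close>. The delicate point
  is the characteristic polynomial of the \<open>q\<close>-th power: \<open>c\<close> is a
  homomorphism on the invariants only, so the roots have no image in \<open>'c\<close>. The
  computation is made with the universal companion matrix over the coordinate ring of the torus,
  where the roots are the coordinates, and only its coefficients are transported by
  \<open>c\<close>. Products of general linear groups need no separate treatment: all factors sit in
  one block-diagonal matrix, and one vector restricts to a cyclic vector in each block.\<close>

text \<open>
  Homomorphisms are treated as relations, to cover at once a homomorphism defined on the invariants
  only and the reduction modulo an ideal, whose quotient ring is not a type.
\<close>

definition ring_rel :: "('a::comm_ring_1 \<Rightarrow> 'b::comm_ring_1 \<Rightarrow> bool) \<Rightarrow> bool" where
  "ring_rel R \<longleftrightarrow> R 0 0 \<and> R 1 1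
    \<and> (\<forall>x y x' y'. R x y \<longrightarrow> R x' y' \<longrightarrow> R (x + x') (y + y') \<and> R (x * x') (y * y'))
    \<and> (\<forall>x y. R x y \<longrightarrow> R (- x) (- y))"

definition mat_rel :: "('a \<Rightarrow> 'b \<Rightarrow> bool) \<Rightarrow> 'a^'n^'m \<Rightarrow> 'b^'n^'m \<Rightarrow> bool" where
  "mat_rel R A B \<longleftrightarrow> (\<forall>i j. R (A $ i $ j) (B $ i $ j))"

definition vec_rel :: "('a \<Rightarrow> 'b \<Rightarrow> bool) \<Rightarrow> 'a^'n \<Rightarrow> 'b^'n \<Rightarrow> bool" where
  "vec_rel R v w \<longleftrightarrow> (\<forall>i. R (v $ i) (w $ i))"

definition poly_rel :: "('a::zero \<Rightarrow> 'b::zero \<Rightarrow> bool) \<Rightarrow> 'a poly \<Rightarrow> 'b poly \<Rightarrow> bool" where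
  "poly_rel R f g \<longleftrightarrow> (\<forall>m. R (Polynomial.coeff f m) (Polynomial.coeff g m))"

context
  fixes R :: "'a::comm_ring_1 \<Rightarrow> 'b::comm_ring_1 \<Rightarrow> bool"
  assumes R: "ring_rel R"
begin

lemma ring_rel_0: "R 0 0" and ring_rel_1: "R 1 1"
  and ring_rel_add: "R x y \<Longrightarrow> R x' y' \<Longrightarrow> R (x + x') (y + y')"
  and ring_rel_mult: "R x y \<Longrightarrow> R x' y' \<Longrightarrow> R (x * x') (y * y')"
  and ring_rel_minus: "R x y \<Longrightarrow> R (- x) (- y)"
  using R by (auto simp: ring_rel_def)

lemma ring_rel_sum: "(\<And>i. i \<in> I \<Longrightarrow> R (f i) (g i)) \<Longrightarrow> R (sum f I) (sum g I)"
  by (induction I rule: infinite_finite_induct) (auto intro: ring_rel_0 ring_rel_add)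

lemma ring_rel_prod: "(\<And>i. i \<in> I \<Longrightarrow> R (f i) (g i)) \<Longrightarrow> R (prod f I) (prod g I)"
  by (induction I rule: infinite_finite_induct) (auto intro: ring_rel_1 ring_rel_mult)

lemma ring_rel_sign: "R (of_int (sign p)) (of_int (sign p'))" if "sign p = sign p'"
  using that by (cases p' rule: sign_cases) (auto intro: ring_rel_1 ring_rel_minus)

lemma ring_rel_det: "mat_rel R A B \<Longrightarrow> R (det A) (det B)"
  unfolding det_def mat_rel_def
  by (intro ring_rel_sum ring_rel_mult ring_rel_prod ring_rel_sign) auto

lemma mat_rel_mult: "mat_rel R A B \<Longrightarrow> mat_rel R A' B' \<Longrightarrow> mat_rel R (A ** A') (B ** B')"
  by (auto simp: mat_rel_def matrix_matrix_mult_def intro!: ring_rel_sum ring_rel_mult)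

lemma mat_rel_one: "mat_rel R (mat 1) (mat 1)"
  by (auto simp: mat_rel_def mat_def ring_rel_0 ring_rel_1)

lemma vec_rel_mult: "mat_rel R A B \<Longrightarrow> vec_rel R v w \<Longrightarrow> vec_rel R (A *v v) (B *v w)"
  by (auto simp: mat_rel_def vec_rel_def matrix_vector_mult_def intro!: ring_rel_sum ring_rel_mult)

lemma mat_rel_power: "mat_rel R A B \<Longrightarrow> mat_rel R (mat_power A k) (mat_power B k)"
  unfolding mat_power_def by (induction k) (auto intro: mat_rel_mult mat_rel_one)

text \<open>Makes \<open>ring_rel_det\<close> applicable to matrices with polynomial entries, so
  that characteristic polynomials are transported coefficient by coefficient.\<close>

lemma ring_rel_poly: "ring_rel (poly_rel R)"
proof -
  have "poly_rel R (f * f') (g * g')" if "poly_rel R f g" "poly_rel R f' g'" for f g f' g'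
    using that by (auto simp: poly_rel_def coeff_mult intro!: ring_rel_sum ring_rel_mult)
  then show ?thesis
    unfolding ring_rel_def
    by (auto simp: poly_rel_def coeff_1 intro: ring_rel_0 ring_rel_1 ring_rel_add ring_rel_minus)
qed

end

lemma poly_rel_block_charpoly:
  assumes R: "ring_rel R" and A: "mat_rel R A B"
  shows "poly_rel R (block_charpoly P i A) (block_charpoly P i B)"
proof -
  note R' = ring_rel_poly[OF R]
  have const: "poly_rel R [:- (A $ j $ k):] [:- (B $ j $ k):]" for j k
    using A by (auto simp: poly_rel_def mat_rel_def coeff_pCons
        intro!: ring_rel_0[OF R] ring_rel_minus[OF R] split: nat.split)
  have X: "poly_rel R [:0, 1:] [:0, 1:]"
    by (auto simp: poly_rel_def coeff_pCons intro!: ring_rel_0[OF R] ring_rel_1[OF R] split: nat.split)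
  have "poly_rel R ((if j = k then [:0, 1:] else 0) - [:A $ j $ k:])
      ((if j = k then [:0, 1:] else 0) - [:B $ j $ k:])" for j k
    using ring_rel_add[OF R' X const[of j k]] const[of j k] by (cases "j = k") auto
  then show ?thesis
    unfolding block_charpoly_def
    by (intro ring_rel_det[OF R']) (auto simp: mat_rel_def ring_rel_0[OF R'] ring_rel_1[OF R'])
qed

lemma ring_rel_graph: "ring_map f \<Longrightarrow> ring_rel (\<lambda>x y. f x = y)"
  by (auto simp: ring_rel_def ring_map_def ring_map_0 ring_map_minus)

lemma mat_rel_graph: "mat_rel (\<lambda>x y. f x = y) A B \<longleftrightarrow> map_matrix f A = B"
  by (auto simp: mat_rel_def map_matrix_def vec_eq_iff)

lemma mat_power_0 [simp]: "mat_power A 0 = mat 1"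
  and mat_power_Suc: "mat_power A (Suc k) = A ** mat_power A k"
  by (simp_all add: mat_power_def)

lemma mat_power_add: "mat_power A (k + l) = mat_power A k ** mat_power A l"
  by (induction k) (auto simp: mat_power_Suc matrix_mul_assoc)

lemma mat_power_1 [simp]: "mat_power A (Suc 0) = A"
  by (simp add: mat_power_Suc)

lemma mat_power_Suc2: "mat_power A (Suc k) = mat_power A k ** A"
  using mat_power_add[of A k 1] by simp

lemma mat_power_mult: "mat_power A (k * l) = mat_power (mat_power A k) l"
  by (induction l) (auto simp: mat_power_Suc mat_power_add)

lemma mat_power_one [simp]: "mat_power (mat 1) k = mat 1"
  by (induction k) (auto simp: mat_power_Suc)

lemma mat_power_intertwine: "A ** h = h ** B \<Longrightarrow> mat_power A k ** h = h ** mat_power B k"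
  by (induction k) (auto simp: mat_power_Suc, metis matrix_mul_assoc)

lemma mat_power_vec_Suc: "mat_power A (Suc k) *v v = A *v (mat_power A k *v v)"
  by (simp add: mat_power_Suc matrix_vector_mul_assoc)

section \<open>Block-diagonal matrices and the groups \<open>levi P\<close>\<close>

definition block :: "('n::finite \<Rightarrow> 'n \<Rightarrow> bool) \<Rightarrow> 'a::comm_ring_1^'n^'n \<Rightarrow> bool" where
  "block P A \<longleftrightarrow> (\<forall>i j. \<not> P i j \<longrightarrow> A $ i $ j = 0)"

lemma carrier_levi: "g \<in> carrier (levi P) \<longleftrightarrow> invertible g \<and> block P g"
  by (auto simp: levi_def block_def)

lemma mult_levi: "g \<otimes>\<^bsub>levi P\<^esub> h = g ** h" and one_levi: "\<one>\<^bsub>levi P\<^esub> = mat 1"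
  by (simp_all add: levi_def)

lemma block_mono: "block Q A \<Longrightarrow> Q \<le> P \<Longrightarrow> block P A"
  by (auto simp: block_def le_fun_def)

lemma block_add: "block P A \<Longrightarrow> block P B \<Longrightarrow> block P (A + B)"
  and block_diff: "block P A \<Longrightarrow> block P B \<Longrightarrow> block P (A - B)"
  by (auto simp: block_def)

lemma block_sum: "(\<And>i. i \<in> I \<Longrightarrow> block P (f i)) \<Longrightarrow> block P (sum f I)"
  by (induction I rule: infinite_finite_induct) (auto intro: block_add, auto simp: block_def)

lemma block_mat: "equivp P \<Longrightarrow> block P (mat x)"
  by (auto simp: block_def mat_def equivp_reflp)

lemma block_mult:
  assumes "equivp P" "block P A" "block P B" shows "block P (A ** B)"
  unfolding block_def matrix_matrix_mult_def
proof (intro allI impI)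
  fix i j assume "\<not> P i j"
  then have "A $ i $ k * B $ k $ j = 0" for k
    using assms equivp_transp[OF assms(1), of i k j] unfolding block_def by (metis mult_zero_left mult_zero_right)
  then show "(\<chi> i j. \<Sum>k\<in>UNIV. A $ i $ k * B $ k $ j) $ i $ j = 0" by simp
qed

lemma block_power: "equivp P \<Longrightarrow> block P A \<Longrightarrow> block P (mat_power A k)"
  by (induction k) (auto simp: mat_power_Suc block_mat block_mult)

lemma block_map: "ring_map f \<Longrightarrow> block P A \<Longrightarrow> block P (map_matrix f A)"
  by (auto simp: block_def map_matrix_def ring_map_0)

definition restr :: "('n::finite \<Rightarrow> 'n \<Rightarrow> bool) \<Rightarrow> 'n \<Rightarrow> 'a::comm_ring_1^'n^'n" where
  "restr P i = (\<chi> j k. if j = k \<and> P i j then 1 else 0)"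

lemma restr_mult:
  "(restr P i ** A) $ j $ k = (if P i j then A $ j $ k else 0)"
  "(A ** restr P i) $ j $ k = (if P i k then A $ j $ k else 0)"
proof -
  have "(restr P i ** A) $ j $ k = (\<Sum>m\<in>UNIV. if j = m then (if P i j then A $ m $ k else 0) else 0)"
    unfolding matrix_matrix_mult_def restr_def vec_lambda_beta by (rule sum.cong) auto
  then show "(restr P i ** A) $ j $ k = (if P i j then A $ j $ k else 0)" by simp
  have "(A ** restr P i) $ j $ k = (\<Sum>m\<in>UNIV. if m = k then (if P i k then A $ j $ k else 0) else 0)"
    unfolding matrix_matrix_mult_def restr_def vec_lambda_beta by (rule sum.cong) auto
  then show "(A ** restr P i) $ j $ k = (if P i k then A $ j $ k else 0)" by simp
qed

text \<open>The matrices \<open>restr P i\<close> are the diagonal idempotents of the classes.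
  Describing block-diagonal matrices as their commutant turns questions about index pairs into
  matrix identities.\<close>

lemma block_iff_restr:
  assumes P: "equivp P"
  shows "block P A \<longleftrightarrow> (\<forall>i. restr P i ** A = A ** restr P i)"
proof
  assume "block P A"
  then show "\<forall>i. restr P i ** A = A ** restr P i"
    by (simp add: vec_eq_iff restr_mult block_def) (metis P equivp_def)
next
  assume *: "\<forall>i. restr P i ** A = A ** restr P i"
  show "block P A" unfolding block_def
  proof (intro allI impI)
    fix i j assume "\<not> P i j"
    moreover have "(restr P i ** A) $ i $ j = (A ** restr P i) $ i $ j" using * by simp
    ultimately show "A $ i $ j = 0"
      using P by (simp add: restr_mult equivp_reflp)
  qed
qed

text \<open>A commutant is closed under inverses: multiply \<open>e A = A e\<close> by
  \<open>B\<close> on both sides.\<close>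

lemma block_inverse:
  assumes P: "equivp P" and "block P A" and AB: "A ** B = mat 1" and BA: "B ** A = mat 1"
  shows "block P B"
  unfolding block_iff_restr[OF P]
proof
  fix i
  have "restr P i ** B = B ** (A ** restr P i) ** B" by (simp add: matrix_mul_assoc BA)
  also have "\<dots> = B ** restr P i ** (A ** B)"
    using assms(2) unfolding block_iff_restr[OF P] by (metis matrix_mul_assoc)
  finally show "restr P i ** B = B ** restr P i" by (simp add: AB)
qed

lemma invertible_mat_one: "invertible (mat 1 :: 'a::comm_ring_1^'n^'n)"
  unfolding invertible_def by (rule exI[of _ "mat 1"]) simp

lemma matrix_inv:
  assumes "invertible (A :: 'a::comm_ring_1^'n^'n)"
  shows "A ** matrix_inv A = mat 1" "matrix_inv A ** A = mat 1"
  using someI_ex[OF assms[unfolded invertible_def]] unfolding matrix_inv_def by auto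

lemma group_levi:
  assumes P: "equivp P"
  shows "group (levi P :: ('a::comm_ring_1^'n^'n::finite) monoid)"
proof (rule groupI)
  fix g :: "'a^'n^'n" assume "g \<in> carrier (levi P)"
  then have g: "invertible g" "block P g" by (auto simp: carrier_levi)
  have "matrix_inv g \<in> carrier (levi P)"
    using block_inverse[OF P g(2) matrix_inv[OF g(1)]] matrix_inv[OF g(1)]
    by (auto simp: carrier_levi invertible_def)
  then show "\<exists>h\<in>carrier (levi P). h \<otimes>\<^bsub>levi P\<^esub> g = \<one>\<^bsub>levi P\<^esub>"
    using matrix_inv[OF g(1)] by (auto simp: mult_levi one_levi)
qed (auto simp: carrier_levi mult_levi one_levi invertible_mat_one matrix_mul_assoc block_mat[OF P]
    intro: invertible_mult block_mult[OF P])

lemma pow_levi: "g [^]\<^bsub>levi P\<^esub> (k :: nat) = mat_power g k"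
proof (induction k)
  case 0 then show ?case by (simp add: nat_pow_def levi_def)
next
  case (Suc k)
  have "g [^]\<^bsub>levi P\<^esub> Suc k = g [^]\<^bsub>levi P\<^esub> k \<otimes>\<^bsub>levi P\<^esub> g" by (simp add: nat_pow_def)
  with Suc show ?case by (simp add: mult_levi mat_power_Suc2)
qed

section \<open>Characteristic polynomials of blocks\<close>

lemma mat_nth: "mat x $ i $ j = (if i = j then x else 0)"
  by (simp add: mat_def)

lemma map_matrix_nth: "map_matrix f A $ i $ j = f (A $ i $ j)"
  by (simp add: map_matrix_def)

lemma restr_nth: "restr P i $ j $ k = (if j = k \<and> P i j then 1 else 0)"
  by (simp add: restr_def)

lemma mat_scalar_mult: "(mat x ** A) $ i $ j = x * A $ i $ j" for A :: "'a::comm_ring_1^'n^'n"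
proof -
  have "(mat x ** A) $ i $ j = (\<Sum>k\<in>UNIV. if i = k then x * A $ k $ j else 0)"
    unfolding matrix_matrix_mult_def mat_def vec_lambda_beta by (rule sum.cong) auto
  then show ?thesis by simp
qed

lemma mat_scalar_commute: "mat x ** A = A ** mat x" for A :: "'a::comm_ring_1^'n^'n"
proof -
  have "(A ** mat x) $ i $ j = (\<Sum>k\<in>UNIV. if k = j then x * A $ i $ k else 0)" for i j
    unfolding matrix_matrix_mult_def mat_def vec_lambda_beta by (rule sum.cong) (auto simp: mult.commute)
  then show ?thesis by (simp add: vec_eq_iff mat_scalar_mult)
qed

lemma matrix_diff_ldistrib: "A ** (B - C) = A ** B - A ** C" for A :: "'a::comm_ring_1^'n^'n"
  by (simp add: vec_eq_iff matrix_matrix_mult_def right_diff_distrib sum_subtractf)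

lemma matrix_diff_rdistrib: "(A - B) ** C = A ** C - B ** C" for A :: "'a::comm_ring_1^'n^'n"
  by (simp add: vec_eq_iff matrix_matrix_mult_def left_diff_distrib sum_subtractf)

lemma matrix_add_rdistrib: "(A + B) ** C = A ** C + B ** C" for A :: "'a::comm_ring_1^'n^'n"
  by (simp add: vec_eq_iff matrix_matrix_mult_def distrib_right sum.distrib)

lemma matrix_mult_zero: "0 ** A = 0" "A ** 0 = 0" for A :: "'a::comm_ring_1^'n^'n"
  by (simp_all add: vec_eq_iff matrix_matrix_mult_def)

text \<open>Entry \<open>(i, k)\<close> of the witness is the determinant of \<open>A\<close> with
  row \<open>k\<close> replaced by the \<open>i\<close>-th basis vector. Combining these with the
  entries of row \<open>j\<close> replaces row \<open>k\<close> by row \<open>j\<close>, which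
  produces two equal rows unless \<open>j = k\<close>.\<close>

lemma adjugate_exists:
  fixes A :: "'a::comm_ring_1^'n^'n::finite"
  obtains B where "A ** B = mat (det A)"
proof
  let ?B = "(\<chi> i k. det (\<chi> a. if a = k then axis i 1 else row a A)) :: 'a^'n^'n"
  have "(A ** ?B) $ j $ k = (mat (det A) :: 'a^'n^'n) $ j $ k" for j k
  proof -
    have "(A ** ?B) $ j $ k = (\<Sum>i\<in>UNIV. A $ j $ i * det (\<chi> a. if a = k then axis i 1 else row a A))"
      by (simp add: matrix_matrix_mult_def)
    also have "\<dots> = (\<Sum>i\<in>UNIV. det (\<chi> a. if a = k then A $ j $ i *s axis i 1 else row a A))"
      by (simp add: det_row_mul)
    also have "\<dots> = det (\<chi> a. if a = k then (\<Sum>i\<in>UNIV. A $ j $ i *s axis i 1) else row a A)"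
      by (rule det_linear_row_sum[symmetric]) simp
    also have "(\<Sum>i\<in>UNIV. A $ j $ i *s axis i 1) = row j A"
      by (simp add: row_def basis_expansion)
    also have "det (\<chi> a. if a = k then row j A else row a A) = (if j = k then det A else 0)"
    proof (cases "j = k")
      case True
      then have "(\<chi> a. if a = k then row j A else row a A) = A" by (auto simp: row_def vec_eq_iff)
      with True show ?thesis by simp
    next
      case False
      then show ?thesis by (simp, intro det_identical_rows[OF False]) (simp add: row_def vec_eq_iff)
    qed
    finally show ?thesis by (simp add: mat_def)
  qed
  then show "A ** ?B = mat (det A)" by (simp add: vec_eq_iff)
qed

text \<open>A permutation that never raises a weight must preserve all weights, since the sum is preserved.\<close>

lemma det_triangular:
  fixes A :: "'a::comm_ring_1^'n^'n::finite" and r :: "'n \<Rightarrow> int"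
  assumes "\<And>i j. A $ i $ j \<noteq> 0 \<Longrightarrow> i = j \<or> r j < r i"
  shows "det A = (\<Prod>i\<in>UNIV. A $ i $ i)"
proof -
  have "(\<Prod>i\<in>UNIV. A $ i $ p i) = 0" if p: "p permutes UNIV" "p \<noteq> id" for p
  proof (rule ccontr)
    assume "(\<Prod>i\<in>UNIV. A $ i $ p i) \<noteq> 0"
    then have nz: "A $ i $ p i \<noteq> 0" for i by (metis UNIV_I finite prod_zero)
    have le: "r (p i) \<le> r i" for i using assms[OF nz[of i]] by force
    obtain i where "p i \<noteq> i" using p(2) by (metis eq_id_iff)
    then have "r (p i) < r i" using assms[OF nz[of i]] by auto
    then have "(\<Sum>i\<in>UNIV. r (p i)) < (\<Sum>i\<in>UNIV. r i)"
      using le by (intro sum_strict_mono_ex1) auto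
    moreover have "(\<Sum>i\<in>UNIV. r (p i)) = (\<Sum>i\<in>UNIV. r i)"
      using sum.reindex_bij_betw[OF permutes_imp_bij[OF p(1)]] by blast
    ultimately show False by simp
  qed
  then have "det A = (\<Sum>p\<in>{id}. of_int (sign p) * (\<Prod>i\<in>UNIV. A $ i $ p i))"
    unfolding det_def by (intro sum.mono_neutral_right) (auto simp: permutes_id)
  then show ?thesis by simp
qed

definition csize :: "('n::finite \<Rightarrow> 'n \<Rightarrow> bool) \<Rightarrow> 'n \<Rightarrow> nat" where
  "csize P i = card {j. P i j}"

text \<open>Filled up with the identity outside the class of \<open>i\<close>, so that a determinant
  over the whole index type computes the characteristic polynomial of a single block.\<close>

definition char_matrix :: "('n::finite \<Rightarrow> 'n \<Rightarrow> bool) \<Rightarrow> 'n \<Rightarrow> 'a::comm_ring_1^'n^'n \<Rightarrow> 'a poly^'n^'n" where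
  "char_matrix P i g = (\<chi> j k. if P i j \<and> P i k then (if j = k then [:0, 1:] else 0) - [:g $ j $ k:]
                 else if j = k then 1 else 0)"

lemma block_charpoly_det: "block_charpoly P i g = det (char_matrix P i g)"
  by (simp add: block_charpoly_def char_matrix_def)

lemma monic_prod_linear:
  fixes a :: "'i \<Rightarrow> 'a::comm_ring_1"
  assumes "finite I"
  shows "Polynomial.degree (\<Prod>i\<in>I. [:- a i, 1:]) = card I \<and> Polynomial.coeff (\<Prod>i\<in>I. [:- a i, 1:]) (card I) = 1"
  using assms
proof (induction I)
  case (insert x F)
  let ?f = "\<Prod>i\<in>F. [:- a i, 1:]"
  have 1: "Polynomial.coeff (\<Prod>i\<in>insert x F. [:- a i, 1:]) (card (insert x F)) = 1"
    using insert by (simp add: coeff_eq_0)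
  have "Polynomial.degree (\<Prod>i\<in>insert x F. [:- a i, 1:]) \<le> Polynomial.degree [:- a x, 1:] + Polynomial.degree ?f"
    using insert degree_mult_le[of "[:- a x, 1:]" ?f] by (simp del: mult_pCons_left)
  then have "Polynomial.degree (\<Prod>i\<in>insert x F. [:- a i, 1:]) \<le> card (insert x F)" using insert by simp
  with 1 show ?case by (metis le_antisym le_degree zero_neq_one)
qed simp

text \<open>In the Leibniz expansion only the identity permutation contributes to the top degree.\<close>

lemma block_charpoly_monic:
  fixes g :: "'a::comm_ring_1^'n^'n::finite"
  shows "Polynomial.degree (block_charpoly P i g) = csize P i"
    and "Polynomial.coeff (block_charpoly P i g) (csize P i) = 1"
proof -
  let ?n = "csize P i" and ?T = "char_matrix P i g" and ?S = "{p. p permutes (UNIV :: 'n set)}"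
  let ?t = "\<lambda>p. of_int (sign p) * (\<Prod>j\<in>UNIV. ?T $ j $ p j)"
  have id: "?t id = (\<Prod>j\<in>{j. P i j}. [:- g $ j $ j, 1:])"
  proof -
    have "(\<Prod>j\<in>UNIV. ?T $ j $ id j) = (\<Prod>j\<in>UNIV. if P i j then [:- g $ j $ j, 1:] else 1)"
      by (intro prod.cong) (auto simp: char_matrix_def)
    then show ?thesis by (simp add: prod.If_cases)
  qed
  have deg: "Polynomial.coeff (?t p) m = 0" if "p \<in> ?S - {id}" "?n \<le> m" for p m
  proof (cases "\<forall>j. p j \<noteq> j \<longrightarrow> P i j")
    case False
    then obtain j where "p j \<noteq> j" "\<not> P i j" by auto
    then have "?T $ j $ p j = 0" by (simp add: char_matrix_def)
    then have "(\<Prod>j\<in>UNIV. ?T $ j $ p j) = 0" by (intro prod_zero) auto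
    then show ?thesis by simp
  next
    case True
    from that obtain j where j: "p j \<noteq> j" by (auto simp: fun_eq_iff)
    with True have Pj: "P i j" by auto
    have "Polynomial.degree (\<Prod>j\<in>UNIV. ?T $ j $ p j) \<le> (\<Sum>j\<in>UNIV. Polynomial.degree (?T $ j $ p j))"
      using degree_prod_sum_le[of UNIV "\<lambda>j. ?T $ j $ p j"] by (simp add: o_def)
    \<comment> \<open>Only diagonal entries in the class have degree one, and \<open>p\<close>
      misses the one at \<open>j\<close>; this lost degree keeps the term below
      \<open>csize P i\<close>.\<close>
    also have "\<dots> \<le> (\<Sum>k\<in>UNIV. if k \<in> {k. P i k} - {j} then 1 else 0)"
      using j by (intro sum_mono) (auto simp: char_matrix_def)
    also have "\<dots> = card ({k. P i k} - {j})" by (subst sum.If_cases) (simp_all add: set_diff_eq)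
    also have "\<dots> < ?n" unfolding csize_def using Pj by (intro psubset_card_mono) auto
    finally have "Polynomial.degree (\<Prod>j\<in>UNIV. ?T $ j $ p j) < m" using that by linarith
    then have "Polynomial.coeff (\<Prod>j\<in>UNIV. ?T $ j $ p j) m = 0" by (rule coeff_eq_0)
    then show ?thesis by (cases p rule: sign_cases) simp_all
  qed
  have "block_charpoly P i g = ?t id + sum ?t (?S - {id})"
    unfolding block_charpoly_det det_def
    by (rule sum.remove) (auto simp: permutes_id finite_permutations)
  then have co: "Polynomial.coeff (block_charpoly P i g) m = Polynomial.coeff (?t id) m" if "?n \<le> m" for m
    using that deg by (simp add: Polynomial.coeff_sum)
  show 1: "Polynomial.coeff (block_charpoly P i g) ?n = 1"
    using co[of ?n] monic_prod_linear[of "{j. P i j}" "\<lambda>j. g $ j $ j"] unfolding id by (simp add: csize_def)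
  have "Polynomial.coeff (block_charpoly P i g) m = 0" if "?n < m" for m
    using co[of m] monic_prod_linear[of "{j. P i j}" "\<lambda>j. g $ j $ j"] that
    unfolding id by (simp add: csize_def coeff_eq_0)
  then have "Polynomial.degree (block_charpoly P i g) \<le> ?n" by (intro degree_le) auto
  with 1 show "Polynomial.degree (block_charpoly P i g) = ?n" by (metis le_antisym le_degree zero_neq_one)
qed

lemma block_charpoly_triangular:
  fixes g :: "'a::comm_ring_1^'n^'n::finite" and r :: "'n \<Rightarrow> int"
  assumes "\<And>i j. g $ i $ j \<noteq> 0 \<Longrightarrow> i = j \<or> r j < r i"
  shows "block_charpoly P i g = (\<Prod>j\<in>{j. P i j}. [:- g $ j $ j, 1:])"
proof -
  have "block_charpoly P i g = (\<Prod>j\<in>UNIV. char_matrix P i g $ j $ j)"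
    unfolding block_charpoly_det
  proof (rule det_triangular)
    fix j k assume "char_matrix P i g $ j $ k \<noteq> 0"
    then show "j = k \<or> r k < r j"
      using assms[of j k] by (auto simp: char_matrix_def split: if_splits)
  qed
  also have "\<dots> = (\<Prod>j\<in>UNIV. if P i j then [:- g $ j $ j, 1:] else 1)"
    by (intro prod.cong) (auto simp: char_matrix_def)
  finally show ?thesis by (simp add: prod.If_cases)
qed

text \<open>With \<open>e = restr P i\<close> the characteristic matrix of a block-diagonal
  \<open>g\<close> is \<open>e (X - g) + (1 - e)\<close>. Since \<open>h\<close> commutes with
  \<open>e\<close>, it intertwines the two characteristic matrices; its determinant is a unit and
  can be cancelled even in the presence of zero divisors.\<close>

lemma block_charpoly_conj:
  fixes g g' h :: "'a::comm_ring_1^'n^'n::finite"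
  assumes P: "equivp P" and g: "block P g" and g': "block P g'" and h: "block P h"
    and gh: "g ** h = h ** g'" and inv: "invertible h"
  shows "block_charpoly P i g = block_charpoly P i g'"
proof -
  let ?c = "map_matrix (\<lambda>a. [:a:]) :: 'a^'n^'n \<Rightarrow> 'a poly^'n^'n"
  have cm: "?c A ** ?c B = ?c (A ** B)" for A B
    by (simp add: map_matrix_def vec_eq_iff matrix_matrix_mult_def sum_to_poly mult.commute)
  have cr: "?c (restr P i) = restr P i" by (simp add: map_matrix_def vec_eq_iff restr_def one_pCons)
  have T: "char_matrix P i f = restr P i ** (mat [:0, 1:] - ?c f) + (mat 1 - restr P i)"
    if f: "block P f" for f
  proof -
    have "P i j \<Longrightarrow> \<not> P i k \<Longrightarrow> f $ j $ k = 0" for j k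
      using f P by (auto simp: block_def dest: equivp_transp)
    then show ?thesis
      by (auto simp: vec_eq_iff restr_mult char_matrix_def map_matrix_nth mat_nth restr_nth)
  qed
  obtain h' where h': "h ** h' = mat 1" using inv by (auto simp: invertible_def)
  have hr: "restr P i ** ?c h = ?c h ** restr P i"
    using h unfolding block_iff_restr[OF P] by (metis cm cr)
  have "char_matrix P i g ** ?c h = restr P i ** (mat [:0, 1:] ** ?c h - ?c g ** ?c h) + (?c h - restr P i ** ?c h)"
    unfolding T[OF g] by (simp add: matrix_add_rdistrib matrix_diff_rdistrib matrix_mul_assoc[symmetric])
  also have "\<dots> = restr P i ** (?c h ** (mat [:0, 1:] - ?c g')) + (?c h - ?c h ** restr P i)"
    by (simp add: cm gh mat_scalar_commute matrix_diff_ldistrib hr)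
  also have "\<dots> = ?c h ** char_matrix P i g'"
    unfolding T[OF g'] by (simp add: matrix_mul_assoc hr matrix_add_ldistrib matrix_diff_ldistrib)
  finally have "char_matrix P i g ** ?c h = ?c h ** char_matrix P i g'" .
  from arg_cong[OF this, of det]
  have "det (char_matrix P i g) * det (?c h) = det (char_matrix P i g') * det (?c h)"
    by (simp add: det_mul mult.commute)
  from arg_cong[OF this, of "\<lambda>x. x * det (?c h')"]
  have "det (char_matrix P i g) * (det (?c h) * det (?c h')) = det (char_matrix P i g') * (det (?c h) * det (?c h'))"
    by (simp add: mult.assoc)
  moreover have "?c (mat 1) = mat 1" by (auto simp: map_matrix_def vec_eq_iff mat_def one_pCons)
  then have "det (?c h) * det (?c h') = 1" using det_mul[of "?c h" "?c h'"] by (simp add: cm h')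
  ultimately show ?thesis by (simp add: block_charpoly_det)
qed

text \<open>The classical argument with the adjugate: \<open>(X - g) B = f(X)\<close> is compared
  coefficientwise in \<open>X\<close>, the coefficient of \<open>X^m\<close> is multiplied by
  \<open>g^m\<close>, and the sum telescopes. The statement is local to a coordinate because every
  class has its own polynomial, and it is solved for the top power, as the last column of a
  companion matrix requires.\<close>

lemma cayley_hamilton_block:
  fixes g :: "'a::comm_ring_1^'n^'n::finite"
  assumes P: "equivp P" and g: "block P g" and j: "P i j"
  shows "(mat_power g (csize P i) *v v) $ j =
    - (\<Sum>k<csize P i. Polynomial.coeff (block_charpoly P i g) k * (mat_power g k *v v) $ j)"
proof -
  let ?f = "block_charpoly P i g" and ?n = "csize P i"
  obtain B where B: "char_matrix P i g ** B = mat ?f"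
    using adjugate_exists unfolding block_charpoly_det by blast
  \<comment> \<open>\<open>C m\<close> is the coefficient of \<open>X^m\<close> in \<open>B\<close>,
    cut down to the block of \<open>i\<close>, because \<open>char_matrix\<close> looks like
    \<open>X - g\<close> only there.\<close>
  define C where "C m = (\<chi> j k. if P i j \<and> P i k then Polynomial.coeff (B $ j $ k) m else 0)" for m
  have C: "C m $ j $ k = (if P i j \<and> P i k then Polynomial.coeff (B $ j $ k) m else 0)" for m j k
    by (simp add: C_def)
  have rec: "(case m of 0 \<Rightarrow> 0 | Suc m' \<Rightarrow> C m') - g ** C m = mat (Polynomial.coeff ?f m) ** restr P i" for m
  proof -
    have "((case m of 0 \<Rightarrow> 0 | Suc m' \<Rightarrow> C m') - g ** C m) $ j $ k =
      (mat (Polynomial.coeff ?f m) ** restr P i) $ j $ k" (is "?L = ?R") for j k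
    proof (cases "P i j \<and> P i k")
      case True
      have "(char_matrix P i g ** B) $ j $ k = (\<Sum>l\<in>UNIV. if P i l then
          (if j = l then [:0, 1:] * B $ l $ k else 0) - [:g $ j $ l:] * B $ l $ k else 0)"
        unfolding matrix_matrix_mult_def vec_lambda_beta using True
        by (intro sum.cong) (auto simp: char_matrix_def left_diff_distrib simp del: mult_pCons_left)
      also have "\<dots> = (\<Sum>l\<in>UNIV. (if j = l then [:0, 1:] * B $ l $ k else 0)
          - (if P i l then [:g $ j $ l:] * B $ l $ k else 0))"
        using True by (intro sum.cong) auto
      also have "\<dots> = [:0, 1:] * B $ j $ k - (\<Sum>l\<in>UNIV. if P i l then [:g $ j $ l:] * B $ l $ k else 0)"
        by (simp add: sum_subtractf del: mult_pCons_left)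
      finally have "Polynomial.coeff ((mat ?f :: 'a poly^'n^'n) $ j $ k) m
          = Polynomial.coeff (pCons 0 (B $ j $ k)) m
          - (\<Sum>l\<in>UNIV. if P i l then g $ j $ l * Polynomial.coeff (B $ l $ k) m else 0)"
        unfolding B by (simp add: Polynomial.coeff_sum if_distrib[of "\<lambda>f. Polynomial.coeff f m"] cong: if_cong)
      moreover have "(g ** C m) $ j $ k = (\<Sum>l\<in>UNIV. if P i l then g $ j $ l * Polynomial.coeff (B $ l $ k) m else 0)"
        unfolding matrix_matrix_mult_def vec_lambda_beta using True
        by (intro sum.cong) (auto simp: C)
      ultimately show ?thesis
        using True by (auto simp: C mat_nth restr_nth mat_scalar_mult coeff_pCons split: nat.split)
    next
      case False
      have "(g ** C m) $ j $ k = 0"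
      proof (cases "P i k")
        case True
        with False have "\<not> P i j" by simp
        then have "\<not> P j l" if "P i l" for l
          using that equivp_transp[OF P, of i l j] equivp_symp[OF P, of j l] by blast
        then have "g $ j $ l * C m $ l $ k = 0" for l
          using g by (cases "P i l") (auto simp: C block_def)
        then show ?thesis by (simp add: matrix_matrix_mult_def)
      qed (simp add: C matrix_matrix_mult_def)
      with False show ?thesis by (auto simp: C mat_scalar_mult restr_nth split: nat.split)
    qed
    then show ?thesis by (simp add: vec_eq_iff)
  qed
  have tele: "(\<Sum>m\<le>D. mat_power g m ** (mat (Polynomial.coeff ?f m) ** restr P i)) = 0 - mat_power g (Suc D) ** C D" for D
  proof (induction D)
    case 0
    show ?case using rec[of 0] by simp
  next
    case (Suc D)
    have "mat_power g (Suc D) ** (mat (Polynomial.coeff ?f (Suc D)) ** restr P i) =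
       mat_power g (Suc D) ** C D - mat_power g (Suc (Suc D)) ** C (Suc D)"
      unfolding rec[of "Suc D", symmetric]
      by (simp add: matrix_diff_ldistrib matrix_mul_assoc mat_power_Suc2)
    then show ?case using Suc by simp
  qed
  \<comment> \<open>Chosen above the degrees of all entries of \<open>B\<close> and above the degree
    of the polynomial: the boundary term \<open>C D\<close> vanishes and the sum can be cut at
    \<open>csize P i\<close>.\<close>
  define D where "D = Suc (\<Sum>j\<in>UNIV. \<Sum>k\<in>UNIV. Polynomial.degree (B $ j $ k)) + ?n"
  have "Polynomial.degree (B $ j $ k) < D" for j k
  proof -
    have "Polynomial.degree (B $ j $ k) \<le> (\<Sum>k\<in>UNIV. Polynomial.degree (B $ j $ k))" by (rule member_le_sum) auto
    also have "\<dots> \<le> (\<Sum>j\<in>UNIV. \<Sum>k\<in>UNIV. Polynomial.degree (B $ j $ k))"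
      by (rule member_le_sum[of j UNIV "\<lambda>j. \<Sum>k\<in>UNIV. Polynomial.degree (B $ j $ k)"]) auto
    finally show ?thesis by (simp add: D_def)
  qed
  then have "C D = 0" by (simp add: C_def vec_eq_iff coeff_eq_0)
  with tele[of D] have "(\<Sum>m\<le>D. mat_power g m ** (mat (Polynomial.coeff ?f m) ** restr P i)) = 0"
    by (simp add: matrix_mult_zero)
  moreover have "(\<Sum>m\<le>D. mat_power g m ** (mat (Polynomial.coeff ?f m) ** restr P i)) =
      (\<Sum>m\<le>?n. mat_power g m ** (mat (Polynomial.coeff ?f m) ** restr P i))"
    by (rule sum.mono_neutral_right)
      (auto simp: D_def coeff_eq_0 block_charpoly_monic(1) matrix_mult_zero)
  ultimately have "(\<Sum>m\<le>?n. mat_power g m ** (mat (Polynomial.coeff ?f m) ** restr P i)) $ j $ k = 0" for k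
    by simp
  moreover have "(mat_power g m ** (mat x ** restr P i)) $ j $ k = x * mat_power g m $ j $ k" for m x k
  proof -
    have "mat_power g m ** (mat x ** restr P i) = mat x ** (mat_power g m ** restr P i)"
      by (metis mat_scalar_commute matrix_mul_assoc)
    moreover have "mat_power g m $ j $ k = 0" if "\<not> P i k"
      using block_power[OF P g, of m] that j P by (auto simp: block_def dest: equivp_transp)
    ultimately show ?thesis by (simp add: mat_scalar_mult restr_mult)
  qed
  ultimately have "(\<Sum>m\<le>?n. Polynomial.coeff ?f m * mat_power g m $ j $ k) = 0" for k
    by (simp)
  then have "(\<Sum>k\<in>UNIV. (\<Sum>m\<le>?n. Polynomial.coeff ?f m * mat_power g m $ j $ k) * v $ k) = 0" by simp
  then have "(\<Sum>m\<le>?n. Polynomial.coeff ?f m * (mat_power g m *v v) $ j) = 0"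
    unfolding matrix_vector_mult_def vec_lambda_beta sum_distrib_right sum_distrib_left
    by (subst sum.swap) (simp add: mult.assoc)
  then show ?thesis
    by (simp add: lessThan_Suc_atMost[symmetric] block_charpoly_monic(2) eq_neg_iff_add_eq_0 add.commute)
qed

section \<open>Krylov and companion matrices\<close>

text \<open>The choice only depends on the class of \<open>i\<close>, so it enumerates every class.\<close>

definition pos :: "('n::finite \<Rightarrow> 'n \<Rightarrow> bool) \<Rightarrow> 'n \<Rightarrow> nat" where
  "pos P i = (SOME h. bij_betw h {j. P i j} {..<card {j. P i j}}) i"

lemma equivp_class: "equivp P \<Longrightarrow> P i j \<Longrightarrow> P i = P j"
  by (simp add: equivp_def)

lemma csize_class: "equivp P \<Longrightarrow> P i j \<Longrightarrow> csize P i = csize P j"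
  unfolding csize_def by (drule (1) equivp_class) simp

lemma bij_pos:
  assumes P: "equivp P"
  shows "bij_betw (pos P) {j. P i j} {..<csize P i}"
proof -
  let ?h = "SOME h. bij_betw h {j. P i j} {..<card {j. P i j}}"
  have "\<exists>h. bij_betw h {j. P i j} {..<card {j. P i j}}"
    using ex_bij_betw_finite_nat[of "{j. P i j}"] by (auto simp: atLeast0LessThan)
  then have "bij_betw ?h {j. P i j} {..<card {j. P i j}}" by (rule someI_ex)
  moreover have "pos P j = ?h j" if "P i j" for j
    using equivp_class[OF P that] by (simp add: pos_def)
  ultimately show ?thesis by (subst bij_betw_cong[of _ "pos P" ?h]) (auto simp: csize_def)
qed

lemma pos_less: "equivp P \<Longrightarrow> P i j \<Longrightarrow> pos P j < csize P i"
  using bij_betwE[OF bij_pos[of P i]] by blast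

lemma pos_inj: "equivp P \<Longrightarrow> P i j \<Longrightarrow> pos P i = pos P j \<longleftrightarrow> i = j"
  using bij_betw_imp_inj_on[OF bij_pos[of P i]] equivp_reflp[of P i] by (auto dest: inj_onD)

lemma pos_obtain:
  assumes "equivp P" "k < csize P i" obtains j where "P i j" "pos P j = k"
  using bij_betw_imp_surj_on[OF bij_pos[OF assms(1), of i]] assms(2)
  by (metis (no_types, lifting) imageE lessThan_iff mem_Collect_eq)

lemma sum_class_pos:
  fixes f :: "nat \<Rightarrow> 'b::comm_monoid_add"
  assumes "equivp P"
  shows "(\<Sum>j\<in>{j. P i j}. f (pos P j)) = (\<Sum>k<csize P i. f k)"
  by (rule sum.reindex_bij_betw[OF bij_pos[OF assms]])

definition krylov :: "('n::finite \<Rightarrow> 'n \<Rightarrow> bool) \<Rightarrow> 'a::comm_ring_1^'n^'n \<Rightarrow> 'a^'n \<Rightarrow> 'a^'n^'n" where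
  "krylov P g v = (\<chi> i j. if P i j then (mat_power g (pos P j) *v v) $ i else 0)"

definition companion :: "('n::finite \<Rightarrow> 'n \<Rightarrow> bool) \<Rightarrow> ('n \<Rightarrow> nat \<Rightarrow> 'a::comm_ring_1) \<Rightarrow> 'a^'n^'n" where
  "companion P \<chi>' = (\<chi> i j. if P i j then
      if Suc (pos P j) = csize P j then - \<chi>' j (pos P i)
      else if pos P i = Suc (pos P j) then 1 else 0
    else 0)"

text \<open>In the quotient of the polynomial ring by the polynomial of a class, with its monomial
  basis, \<open>companion\<close> is multiplication by \<open>X\<close> and this vector is the
  element 1.\<close>

definition first_vec :: "('n::finite \<Rightarrow> 'n \<Rightarrow> bool) \<Rightarrow> 'a::comm_ring_1^'n" where
  "first_vec P = (\<chi> i. if pos P i = 0 then 1 else 0)"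

lemma block_krylov: "block P (krylov P g v)"
  by (simp add: block_def krylov_def)

lemma block_companion: "block P (companion P x)"
  by (simp add: block_def companion_def)

text \<open>Multiplication by \<open>g\<close> shifts the columns of the Krylov matrix by one, and
  \<open>top\<close> rewrites the column that falls out. The coefficients \<open>x\<close> are
  arbitrary, so that this covers both Cayley-Hamilton over a ring and nilpotent matrices over a
  field, where \<open>x\<close> is zero.\<close>

lemma krylov_companion:
  fixes g :: "'a::comm_ring_1^'n^'n::finite"
  assumes P: "equivp P" and g: "block P g"
    and top: "\<And>i j. P i j \<Longrightarrow>
      (mat_power g (csize P j) *v v) $ i = - (\<Sum>k<csize P j. x j k * (mat_power g k *v v) $ i)"
  shows "g ** krylov P g v = krylov P g v ** companion P x"
proof -
  let ?K = "krylov P g v"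
  have "(g ** ?K) $ i $ j = (?K ** companion P x) $ i $ j" if ij: "P i j" for i j
  proof -
    have "g $ i $ k * ?K $ k $ j = g $ i $ k * (mat_power g (pos P j) *v v) $ k" for k
    proof (cases "P i k")
      case True
      then have "P k j" using ij equivp_class[OF P] by metis
      then show ?thesis by (simp add: krylov_def)
    qed (use g in \<open>simp add: block_def\<close>)
    then have lhs: "(g ** ?K) $ i $ j = (mat_power g (Suc (pos P j)) *v v) $ i"
      unfolding mat_power_vec_Suc by (simp add: matrix_matrix_mult_def matrix_vector_mult_def[of g])
    have cls: "{k. P j k} = {k. P i k}" using ij equivp_class[OF P] by metis
    have "(?K ** companion P x) $ i $ j = (\<Sum>k\<in>{k. P i k}. ?K $ i $ k * companion P x $ k $ j)"
      unfolding matrix_matrix_mult_def vec_lambda_beta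
      by (rule sum.mono_neutral_right) (auto simp: krylov_def)
    also have "\<dots> = (\<Sum>k\<in>{k. P j k}. (mat_power g (pos P k) *v v) $ i *
        (if Suc (pos P j) = csize P j then - x j (pos P k) else if pos P k = Suc (pos P j) then 1 else 0))"
      unfolding cls
    proof (rule sum.cong)
      fix k assume "k \<in> {k. P i k}"
      then have "P i k" "P k j" using ij equivp_class[OF P] by (simp, metis mem_Collect_eq)
      then show "?K $ i $ k * companion P x $ k $ j = (mat_power g (pos P k) *v v) $ i *
        (if Suc (pos P j) = csize P j then - x j (pos P k) else if pos P k = Suc (pos P j) then 1 else 0)"
        by (simp add: krylov_def companion_def)
    qed simp
    also have "\<dots> = (\<Sum>m<csize P j. (mat_power g m *v v) $ i *
        (if Suc (pos P j) = csize P j then - x j m else if m = Suc (pos P j) then 1 else 0))"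
      by (rule sum_class_pos[OF P])
    also have "\<dots> = (mat_power g (Suc (pos P j)) *v v) $ i"
    proof (cases "Suc (pos P j) = csize P j")
      case True
      then show ?thesis by (simp add: top[OF ij] sum_negf mult.commute)
    next
      case False
      then have "Suc (pos P j) < csize P j"
        using pos_less[OF P equivp_reflp[OF P], of j] by simp
      with False show ?thesis by (simp add: if_distrib cong: if_cong)
    qed
    finally show ?thesis using lhs by simp
  qed
  moreover have "(g ** ?K) $ i $ j = (?K ** companion P x) $ i $ j" if "\<not> P i j" for i j
    using that block_mult[OF P g block_krylov[of P g v]]
      block_mult[OF P block_krylov[of P g v] block_companion[of P x]]
    by (simp add: block_def)
  ultimately show ?thesis unfolding vec_eq_iff by blast
qed

definition cp :: "('n::finite \<Rightarrow> 'n \<Rightarrow> bool) \<Rightarrow> 'a::comm_ring_1^'n^'n \<Rightarrow> 'n \<Rightarrow> nat \<Rightarrow> 'a" where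
  "cp P g i k = Polynomial.coeff (block_charpoly P i g) k"

lemma krylov_charpoly:
  assumes "equivp P" "block P g"
  shows "g ** krylov P g v = krylov P g v ** companion P (cp P g)"
  using assms by (intro krylov_companion) (auto simp: cp_def intro!: cayley_hamilton_block dest: equivp_symp)

text \<open>An intertwiner carries the orbit of \<open>v\<close> under \<open>g\<close> to the orbit
  of \<open>h v\<close> under \<open>g'\<close>. This moves cyclic vectors along conjugations, and
  it shows that \<open>h\<close> is determined by \<open>h v\<close> once the Krylov matrix of
  \<open>g\<close> is invertible.\<close>

lemma krylov_intertwine:
  assumes P: "equivp P" and h: "block P h" and gh: "h ** g = g' ** h"
  shows "h ** krylov P g v = krylov P g' (h *v v)"
proof -
  have pw: "h ** mat_power g k = mat_power g' k ** h" for k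
    using mat_power_intertwine[OF gh[symmetric], of k] by simp
  have "(h ** krylov P g v) $ i $ j = krylov P g' (h *v v) $ i $ j" if ij: "P i j" for i j
  proof -
    have "h $ i $ k * krylov P g v $ k $ j = h $ i $ k * (mat_power g (pos P j) *v v) $ k" for k
    proof (cases "P i k")
      case True
      then have "P k j" using ij equivp_class[OF P] by metis
      then show ?thesis by (simp add: krylov_def)
    qed (use h in \<open>simp add: block_def\<close>)
    then have "(h ** krylov P g v) $ i $ j = (h *v (mat_power g (pos P j) *v v)) $ i"
      by (simp add: matrix_matrix_mult_def matrix_vector_mult_def[of h])
    then show ?thesis using ij by (simp add: krylov_def matrix_vector_mul_assoc pw)
  qed
  moreover have "(h ** krylov P g v) $ i $ j = krylov P g' (h *v v) $ i $ j" if "\<not> P i j" for i j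
    using that block_mult[OF P h block_krylov] block_krylov by (metis block_def)
  ultimately show ?thesis unfolding vec_eq_iff by blast
qed

lemma companion_power_first:
  fixes x :: "'n::finite \<Rightarrow> nat \<Rightarrow> 'a::comm_ring_1"
  assumes P: "equivp P" and k: "k < csize P i"
  shows "(mat_power (companion P x) k *v first_vec P) $ i = (if pos P i = k then 1 else 0)"
  using k
proof (induction k arbitrary: i)
  case 0
  then show ?case by (simp add: first_vec_def)
next
  case (Suc k)
  obtain j where j: "P i j" "pos P j = k" using pos_obtain[OF P, of k i] Suc.prems by auto
  let ?w = "mat_power (companion P x) k *v first_vec P"
  have "companion P x $ i $ l * ?w $ l = (if l = j then (if pos P i = Suc k then 1 else 0) else 0)" for l
  proof (cases "P i l")
    case True
    then have "k < csize P l" using Suc.prems csize_class[OF P True] by simp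
    then have "?w $ l = (if l = j then 1 else 0)"
      using Suc.IH[of l] j pos_inj[OF P, of l j] True equivp_class[OF P] by (metis)
    moreover have "Suc (pos P j) \<noteq> csize P j" using j Suc.prems csize_class[OF P j(1)] by simp
    ultimately show ?thesis using j by (simp add: companion_def)
  next
    case False
    then show ?thesis using j by (auto simp: companion_def)
  qed
  then show ?case by (simp add: mat_power_vec_Suc matrix_vector_mult_def[of "companion P x"])
qed

text \<open>The top power applied to \<open>first_vec\<close> is evaluated twice, by Cayley-Hamilton
  and by the last column of the matrix. The lower powers give the basis vectors themselves, so the
  coefficients can be read off and no determinant is expanded.\<close>

lemma charpoly_companion:
  fixes x :: "'n::finite \<Rightarrow> nat \<Rightarrow> 'a::comm_ring_1"
  assumes P: "equivp P" and x: "\<And>j. P i j \<Longrightarrow> x j = x i" and k: "k < csize P i"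
  shows "cp P (companion P x) i k = x i k"
proof -
  let ?g = "companion P x" and ?n = "csize P i"
  obtain j where j: "P i j" "pos P j = k" using pos_obtain[OF P k] .
  have nj: "csize P j = ?n" using csize_class[OF P j(1)] by simp
  have "(mat_power ?g ?n *v first_vec P) $ j = - (\<Sum>m<?n. cp P ?g i m * (mat_power ?g m *v first_vec P) $ j)"
    unfolding cp_def by (rule cayley_hamilton_block[OF P block_companion j(1)])
  also have "\<dots> = - (\<Sum>m<?n. if m = k then cp P ?g i m else 0)"
  proof -
    have "(mat_power ?g m *v first_vec P) $ j = (if m = k then 1 else 0)" if "m < ?n" for m
      using companion_power_first[OF P, of m j x] that j nj by auto
    then have "(\<Sum>m<?n. cp P ?g i m * (mat_power ?g m *v first_vec P) $ j)
      = (\<Sum>m<?n. if m = k then cp P ?g i m else 0)"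
      by (intro sum.cong) auto
    then show ?thesis by simp
  qed
  finally have 1: "(mat_power ?g ?n *v first_vec P) $ j = - cp P ?g i k" using k by simp
  \<comment> \<open>The index \<open>l\<close> chosen next is the last position of the class: the
    power just below the top one sits there, and its column holds the coefficients.\<close>
  obtain m where m: "?n = Suc m" using k by (cases ?n) auto
  obtain l where l: "P i l" "pos P l = m" using pos_obtain[OF P, of m i] m by auto
  let ?w = "mat_power ?g m *v first_vec P"
  have jl: "P j r \<longleftrightarrow> P i r" for r using equivp_class[OF P j(1)] by simp
  have "?g $ j $ r * ?w $ r = (if r = l then - x i k else 0)" for r
  proof (cases "P i r")
    case True
    then have "m < csize P r" using m csize_class[OF P True] by simp
    then have "?w $ r = (if r = l then 1 else 0)"
      using companion_power_first[OF P, of m r x] l pos_inj[OF P, of r l] True equivp_class[OF P] by metis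
    moreover have "Suc (pos P l) = csize P l" using l m csize_class[OF P l(1)] by simp
    ultimately show ?thesis using l j x[OF l(1)] jl by (simp add: companion_def)
  next
    case False
    then show ?thesis using l jl by (auto simp: companion_def)
  qed
  then have "(mat_power ?g ?n *v first_vec P) $ j = - x i k"
    unfolding m mat_power_vec_Suc by (simp add: matrix_vector_mult_def[of ?g])
  with 1 show ?thesis by simp
qed

lemma cp_top: "cp P g i (csize P i) = 1" and cp_above: "csize P i < k \<Longrightarrow> cp P g i k = 0"
  by (simp_all add: cp_def block_charpoly_monic coeff_eq_0)

section \<open>The torus modulo the Weyl group\<close>

text \<open>\<open>det B\<close> is a unit, so the adjugate yields a right inverse of
  \<open>B\<close>; as \<open>A\<close> is a left inverse of \<open>B\<close>, the two
  coincide.\<close>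

lemma matrix_right_inverse_comm:
  fixes A B :: "'a::comm_ring_1^'n^'n::finite"
  assumes "A ** B = mat 1"
  shows "B ** A = mat 1"
proof -
  have d: "det B * det A = 1" using det_mul[of A B] assms by (simp add: mult.commute)
  obtain C where C: "B ** C = mat (det B)" using adjugate_exists .
  have "(mat (det B * det A) :: 'a^'n^'n) = mat (det A) ** (B ** C)"
    unfolding C by (simp add: vec_eq_iff mat_scalar_mult mat_nth mult.commute)
  then have BC: "B ** (mat (det A) ** C) = mat 1"
    by (simp add: d matrix_mul_assoc mat_scalar_commute[of "det A" B])
  then have "A = mat (det A) ** C"
    using assms by (metis matrix_mul_assoc matrix_mul_lid matrix_mul_rid)
  with BC show ?thesis by simp
qed

lemma invertible_right: "A ** B = mat 1 \<Longrightarrow> invertible A" and invertible_left: "B ** A = mat 1 \<Longrightarrow> invertible A"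
  for A B :: "'a::comm_ring_1^'n^'n::finite"
  unfolding invertible_def using matrix_right_inverse_comm by blast+

lemma invertible_det_one: "det A = 1 \<Longrightarrow> invertible A" for A :: "'a::comm_ring_1^'n^'n::finite"
  using adjugate_exists[of A] by (metis invertible_right)

text \<open>Multiplication by \<open>X\<close> in the Newton basis of a class: each basis element
  times its \<open>X - t j\<close> is the next one. In contrast to the companion matrix it is
  triangular, and its powers have the powers of the \<open>t j\<close> on the diagonal.\<close>

definition bidiagonal :: "('n::finite \<Rightarrow> 'n \<Rightarrow> bool) \<Rightarrow> ('n \<Rightarrow> 'a::comm_ring_1) \<Rightarrow> 'a^'n^'n" where
  "bidiagonal P t =
    (\<chi> i j. if i = j then t i else if P i j \<and> pos P i = Suc (pos P j) then 1 else 0)"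

definition lower :: "('n::finite \<Rightarrow> 'n \<Rightarrow> bool) \<Rightarrow> 'a::comm_ring_1^'n^'n \<Rightarrow> bool" where
  "lower P A \<longleftrightarrow> (\<forall>i j. A $ i $ j \<noteq> 0 \<longrightarrow> i = j \<or> pos P j < pos P i)"

lemma lower_mult:
  assumes "lower P A" "lower P B"
  shows "lower P (A ** B)" and "(A ** B) $ i $ i = A $ i $ i * B $ i $ i"
proof -
  show "lower P (A ** B)" unfolding lower_def
  proof (intro allI impI)
    fix i j assume "(A ** B) $ i $ j \<noteq> 0"
    then obtain k where "A $ i $ k * B $ k $ j \<noteq> 0"
      unfolding matrix_matrix_mult_def vec_lambda_beta by (meson sum.not_neutral_contains_not_neutral)
    then have "A $ i $ k \<noteq> 0" "B $ k $ j \<noteq> 0" by auto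
    then show "i = j \<or> pos P j < pos P i" using assms unfolding lower_def by (metis less_trans)
  qed
  have "A $ i $ k * B $ k $ i = (if k = i then A $ i $ i * B $ i $ i else 0)" for k
  proof (cases "k = i")
    case False
    then have "A $ i $ k = 0 \<or> B $ k $ i = 0"
      using assms less_asym[of "pos P i" "pos P k"] unfolding lower_def by blast
    with False show ?thesis by auto
  qed simp
  then have "(\<Sum>k\<in>UNIV. A $ i $ k * B $ k $ i) = (\<Sum>k\<in>UNIV. if k = i then A $ i $ i * B $ i $ i else 0)"
    by (rule sum.cong[OF refl])
  then show "(A ** B) $ i $ i = A $ i $ i * B $ i $ i" by (simp add: matrix_matrix_mult_def)
qed

lemma lower_power: "lower P A \<Longrightarrow> lower P (mat_power A k) \<and> mat_power A k $ i $ i = (A $ i $ i) ^ k"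
proof (induction k)
  case 0
  then show ?case by (auto simp: lower_def mat_nth)
next
  case (Suc k)
  then show ?case by (simp add: mat_power_Suc lower_mult)
qed

lemma block_charpoly_lower: "lower P g \<Longrightarrow> block_charpoly P i g = (\<Prod>j\<in>{j. P i j}. [:- g $ j $ j, 1:])"
  by (rule block_charpoly_triangular[of _ "\<lambda>i. int (pos P i)"]) (auto simp: lower_def)

text \<open>
  The companion matrix with roots \<open>t\<close> is conjugate over the ring itself to a triangular one,
  through the Newton basis of products of the \<open>X - t j\<close>; this gives the roots of its powers without
  any assumption on the ring.
\<close>

lemma block_charpoly_companion_power:
  fixes t :: "'n::finite \<Rightarrow> 'a::comm_ring_1"
  assumes P: "equivp P"
  shows "block_charpoly P i (mat_power
      (companion P (\<lambda>i. Polynomial.coeff (\<Prod>j\<in>{j. P i j}. [:- t j, 1:]))) k) =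
    (\<Prod>j\<in>{j. P i j}. [:- (t j ^ k), 1:])"
proof -
  let ?L = "bidiagonal P t" and ?K = "krylov P (bidiagonal P t) (first_vec P)"
    and ?C = "companion P (\<lambda>i. Polynomial.coeff (\<Prod>j\<in>{j. P i j}. [:- t j, 1:]))"
  have low: "lower P ?L" by (auto simp: lower_def bidiagonal_def)
  have bl: "block P ?L" using equivp_reflp[OF P] by (auto simp: block_def bidiagonal_def)
  have "block_charpoly P i ?L = (\<Prod>j\<in>{j. P i j}. [:- t j, 1:])" for i
    by (subst block_charpoly_lower[OF low]) (simp add: bidiagonal_def)
  then have cpL: "cp P ?L = (\<lambda>i. Polynomial.coeff (\<Prod>j\<in>{j. P i j}. [:- t j, 1:]))"
    by (simp add: fun_eq_iff cp_def)
  have LK: "?L ** ?K = ?K ** ?C"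
    using krylov_charpoly[OF P bl, of "first_vec P"] unfolding cpL .
  \<comment> \<open>In the Newton basis \<open>X^m\<close> is monic: it has coordinate 1 at position
    \<open>m\<close> and 0 after it. Hence the Krylov matrix, which is the change of basis, is
    unitriangular and invertible over any ring.\<close>
  have vec: "(mat_power ?L m *v first_vec P) $ r = (if pos P r = m then 1 else 0)"
    if "m \<le> pos P r" for m r
    using that
  proof (induction m arbitrary: r)
    case 0
    then show ?case by (simp add: first_vec_def)
  next
    case (Suc m)
    have "pos P r < csize P r" using pos_less[OF P equivp_reflp[OF P]] .
    then have "pos P r - 1 < csize P r" by simp
    then obtain s where s: "P r s" "pos P s = pos P r - 1" using pos_obtain[OF P] by metis
    have sr: "s \<noteq> r" "pos P r = Suc (pos P s)" using s Suc.prems by auto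
    let ?w = "mat_power ?L m *v first_vec P"
    have "?L $ r $ k * ?w $ k = (if k = s then ?w $ s else 0)" for k
    proof -
      consider "k = r" | "k = s" | "k \<noteq> r" "k \<noteq> s" by auto
      then show ?thesis
      proof cases
        case 1
        then show ?thesis using Suc.IH[of r] Suc.prems sr by (simp add: bidiagonal_def)
      next
        case 2
        then show ?thesis using s sr by (auto simp: bidiagonal_def)
      next
        case 3
        then have "\<not> (P r k \<and> pos P r = Suc (pos P k))"
          using sr s pos_inj[OF P, of k s] equivp_class[OF P] by (metis old.nat.inject)
        with 3 have "?L $ r $ k = 0" by (auto simp: bidiagonal_def)
        with 3 show ?thesis by simp
      qed
    qed
    then have "(mat_power ?L (Suc m) *v first_vec P) $ r = ?w $ s"
      by (simp add: mat_power_vec_Suc matrix_vector_mult_def[of ?L])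
    also have "\<dots> = (if pos P r = Suc m then 1 else 0)" using Suc.IH[of s] Suc.prems sr by simp
    finally show ?case .
  qed
  have "det ?K = (\<Prod>r\<in>UNIV. ?K $ r $ r)"
  proof (rule det_triangular[of _ "\<lambda>i. - int (pos P i)"])
    fix r s assume "?K $ r $ s \<noteq> 0"
    then have "P r s" "(mat_power ?L (pos P s) *v first_vec P) $ r \<noteq> 0"
      by (auto simp: krylov_def split: if_splits)
    then show "r = s \<or> - int (pos P s) < - int (pos P r)"
      using vec[of "pos P s" r] pos_inj[OF P, of r s] by (cases "pos P s \<le> pos P r") auto
  qed
  also have "\<dots> = 1" using vec equivp_reflp[OF P] by (simp add: krylov_def)
  finally have inv: "invertible ?K" by (rule invertible_det_one)
  have "block_charpoly P i (mat_power ?C k) = block_charpoly P i (mat_power ?L k)"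
    using mat_power_intertwine[OF LK] inv
    by (intro block_charpoly_conj[symmetric, of P _ _ ?K] P block_power bl block_companion block_krylov)
  also have "\<dots> = (\<Prod>j\<in>{j. P i j}. [:- (t j ^ k), 1:])"
    using lower_power[OF low, of k] by (subst block_charpoly_lower) (auto simp: bidiagonal_def)
  finally show ?thesis .
qed

text \<open>The map of group algebras induced by a map of exponents. The Weyl action and the
  pullback along the \<open>q\<close>-power map are both of this kind, so their multiplicativity is
  proved once, for additive \<open>h\<close>.\<close>

definition push :: "('e \<Rightarrow> 'e) \<Rightarrow> ('e \<Rightarrow>\<^sub>0 'a::comm_ring_1) \<Rightarrow> 'e \<Rightarrow>\<^sub>0 'a" where
  "push h u = (\<Sum>e\<in>Poly_Mapping.keys u. Poly_Mapping.single (h e) (Poly_Mapping.lookup u e))"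

lemma push_superset:
  "finite S \<Longrightarrow> Poly_Mapping.keys u \<subseteq> S \<Longrightarrow>
    push h u = (\<Sum>e\<in>S. Poly_Mapping.single (h e) (Poly_Mapping.lookup u e))"
  unfolding push_def by (rule sum.mono_neutral_left) (auto simp: in_keys_iff)

lemma push_add: "push h (u + v) = push h u + push h v"
proof -
  let ?S = "Poly_Mapping.keys u \<union> Poly_Mapping.keys v"
  have "push h (u + v) = (\<Sum>e\<in>?S. Poly_Mapping.single (h e) (Poly_Mapping.lookup (u + v) e))"
    by (rule push_superset) (auto simp: Poly_Mapping.keys_add)
  also have "\<dots> = push h u + push h v"
    by (subst (1 2) push_superset[of ?S]) (auto simp: lookup_add single_add sum.distrib)
  finally show ?thesis .
qed

lemma push_0: "push h 0 = 0"
  by (simp add: push_def)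

lemma push_sum: "push h (sum f I) = (\<Sum>i\<in>I. push h (f i))"
  by (induction I rule: infinite_finite_induct) (auto simp: push_add push_0)

lemma push_single: "push h (Poly_Mapping.single e a) = Poly_Mapping.single (h e) a"
  by (subst push_superset[of "{e}"]) auto

lemma sum_singles: "(\<Sum>e\<in>Poly_Mapping.keys u. Poly_Mapping.single e (Poly_Mapping.lookup u e)) = u"
  by (rule poly_mapping_eqI) (simp add: lookup_sum lookup_single when_def in_keys_iff)

lemma push_mult:
  fixes u v :: "'e::comm_monoid_add \<Rightarrow>\<^sub>0 'a::comm_ring_1"
  assumes h: "\<And>a b. h (a + b) = h a + h b"
  shows "push h (u * v) = push h u * push h v"
proof -
  let ?s = "\<lambda>u e. Poly_Mapping.single e (Poly_Mapping.lookup u e)"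
  have "push h (u * v) = push h ((\<Sum>e\<in>Poly_Mapping.keys u. ?s u e) * (\<Sum>e\<in>Poly_Mapping.keys v. ?s v e))"
    by (simp add: sum_singles)
  also have "\<dots> = (\<Sum>e\<in>Poly_Mapping.keys u. \<Sum>e'\<in>Poly_Mapping.keys v. push h (?s u e) * push h (?s v e'))"
    unfolding sum_product push_sum by (simp add: mult_single push_single h)
  also have "\<dots> = push h u * push h v"
    unfolding sum_product[symmetric] push_single by (simp add: push_def)
  finally show ?thesis .
qed

lemma ring_map_push:
  assumes "\<And>a b. h (a + b) = h a + h b"
  shows "ring_map (push h :: ('e::ab_group_add \<Rightarrow>\<^sub>0 'a::comm_ring_1) \<Rightarrow> _)"
proof -
  have "h 0 = 0" using assms[of 0 0] by simp
  then show ?thesis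
    using push_single[of h 0 1] by (simp add: ring_map_def push_add push_mult[OF assms])
qed

lemma power_pullback_push: "power_pullback q = push (\<lambda>e. \<chi> i. int q * e $ i)"
  by (simp add: fun_eq_iff power_pullback_def push_def)

text \<open>A bijection \<open>w\<close> permutes the exponents, so comparing coefficients amounts
  to comparing elements. As common fixed points of ring homomorphisms the invariants are visibly a
  subring.\<close>

lemma invariants_push:
  fixes P :: "'n::finite \<Rightarrow> 'n \<Rightarrow> bool"
  shows "invariants P = {u. \<forall>w\<in>weyl P. push (\<lambda>e. \<chi> i. e $ w i) u = u}"
proof -
  have "(\<forall>e. Poly_Mapping.lookup u (\<chi> i. e $ w i) = Poly_Mapping.lookup u e) \<longleftrightarrow> push (\<lambda>e. \<chi> i. e $ w i) u = u"
    if w: "bij w" for u :: "('n, 'b::comm_ring_1) torus_ring" and w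
  proof -
    let ?h = "\<lambda>e :: int^'n. \<chi> i. e $ w i"
    have inj: "(\<lambda>i. e $ w i) = (\<lambda>i. e' $ w i) \<longleftrightarrow> e = e'" for e e' :: "int^'n"
      using bij_is_surj[OF w] unfolding vec_eq_iff fun_eq_iff by (metis surjD)
    have lk: "Poly_Mapping.lookup (push ?h u) (?h e) = Poly_Mapping.lookup u e" for e
      unfolding push_def lookup_sum
      by (simp add: lookup_single inj when_def in_keys_iff)
    have surj: "\<exists>e'. e = ?h e'" for e
      using bij_is_surj[OF w] bij_is_inj[OF w] by (intro exI[of _ "\<chi> i. e $ inv_into UNIV w i"]) (simp add: vec_eq_iff)
    show ?thesis
    proof
      assume *: "\<forall>e. Poly_Mapping.lookup u (?h e) = Poly_Mapping.lookup u e"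
      show "push ?h u = u"
      proof (rule poly_mapping_eqI)
        fix e obtain e' where e': "e = ?h e'" using surj by blast
        show "Poly_Mapping.lookup (push ?h u) e = Poly_Mapping.lookup u e"
          unfolding e' lk using * by simp
      qed
    next
      assume "push ?h u = u"
      then show "\<forall>e. Poly_Mapping.lookup u (?h e) = Poly_Mapping.lookup u e" using lk by metis
    qed
  qed
  then show ?thesis unfolding invariants_def weyl_def by blast
qed

text \<open>A point \<open>c\<close> respects the operations on the invariants only, so its graph is
  restricted to them. Compatibility with negation follows from additivity and
  \<open>c 0 = 0\<close>, which comes from the scalars.\<close>

lemma ring_rel_quotient_point:
  assumes c: "c \<in> quotient_points P \<alpha>" and \<alpha>: "ring_map \<alpha>"
  shows "ring_rel (\<lambda>u y. u \<in> invariants P \<and> c u = y)"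
proof -
  let ?I = "invariants P :: ('a, 'b) torus_ring set"
  have rm: "ring_map (push (\<lambda>e. \<chi> i. e $ w i) :: ('a, 'b) torus_ring \<Rightarrow> _)" for w
    by (rule ring_map_push) (simp add: vec_eq_iff)
  have I: "0 \<in> ?I" "1 \<in> ?I" "u \<in> ?I \<Longrightarrow> v \<in> ?I \<Longrightarrow> u + v \<in> ?I" "u \<in> ?I \<Longrightarrow> v \<in> ?I \<Longrightarrow> u * v \<in> ?I"
    "u \<in> ?I \<Longrightarrow> - u \<in> ?I" for u v
    using ring_map_0[OF rm] ring_map_minus[OF rm] rm unfolding invariants_push ring_map_def by auto
  have s: "c (Poly_Mapping.single 0 a) = \<alpha> a" for a
    using c by (simp add: quotient_points_def)
  have c01: "c 0 = 0" "c 1 = 1"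
    using s[of 0] s[of 1] \<alpha> ring_map_0[OF \<alpha>] by (simp_all add: ring_map_def)
  have cadd: "c (u + v) = c u + c v" "c (u * v) = c u * c v" if "u \<in> ?I" "v \<in> ?I" for u v
    using c that by (auto simp: quotient_points_def)
  have "c (- u) = - c u" if "u \<in> ?I" for u
    using cadd(1)[OF that I(5)[OF that]] c01 by (simp add: eq_neg_iff_add_eq_0 add.commute)
  then show ?thesis unfolding ring_rel_def using I c01 cadd by auto
qed

lemma push_coord:
  fixes w :: "'n::finite \<Rightarrow> 'n"
  assumes "bij w"
  shows "push (\<lambda>e. \<chi> i. e $ w i) (torus_coord j) = torus_coord (inv_into UNIV w j)"
proof -
  have "(axis j 1 :: int^'n) $ w i = (axis (inv_into UNIV w j) 1 :: int^'n) $ i" for i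
    using assms by (auto simp: axis_def bij_def surj_f_inv_f)
  then have "(\<chi> i. (axis j 1 :: int^'n) $ w i) = axis (inv_into UNIV w j) 1" by (simp add: vec_eq_iff)
  then show ?thesis by (simp add: torus_coord_def push_single)
qed

lemma ring_map_coeff_linear:
  assumes "ring_map f"
  shows "f (Polynomial.coeff (\<Prod>j\<in>J. [:- t j, 1:]) m) = Polynomial.coeff (\<Prod>j\<in>J. [:- f (t j), 1:]) m"
  using assms by (intro coeff_ring_map_prod)
    (auto simp: coeff_pCons ring_map_0 ring_map_minus split: nat.split, auto simp: ring_map_def)

text \<open>An element of the Weyl group permutes every class, hence the roots of the polynomial of
  that class.\<close>

lemma generic_charpoly_invariant:
  assumes P: "equivp P"
  shows "Polynomial.coeff (generic_charpoly P i) m \<in> (invariants P :: ('n::finite, 'o::comm_ring_1) torus_ring set)"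
proof -
  have "push (\<lambda>e. \<chi> i. e $ w i) (Polynomial.coeff (generic_charpoly P i) m) =
      (Polynomial.coeff (generic_charpoly P i) m :: ('n, 'o) torus_ring)"
    if w: "w \<in> weyl P" for w
  proof -
    have bw: "bij w" and Pw: "P j (w j)" for j using w by (auto simp: weyl_def)
    have "P i (inv_into UNIV w j) \<longleftrightarrow> P i j" for j
    proof -
      have "P (inv_into UNIV w j) j"
        using Pw[of "inv_into UNIV w j"] bw by (simp add: bij_is_surj surj_f_inv_f)
      then have "P (inv_into UNIV w j) = P j" using equivp_class[OF P] by blast
      moreover have "P i k \<longleftrightarrow> P i = P k" for k using P by (simp add: equivp_def)
      ultimately show ?thesis by simp
    qed
    then have "bij_betw (inv_into UNIV w) {j. P i j} {j. P i j}"
      using bw equivp_transp[OF P _ Pw]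
      by (intro bij_betwI[of _ _ _ w]) (auto simp: bij_is_surj surj_f_inv_f bij_is_inj)
    then show ?thesis
      using prod.reindex_bij_betw[of "inv_into UNIV w" "{j. P i j}" "{j. P i j}" "\<lambda>j. [:- torus_coord j, 1:] :: ('n, 'o) torus_ring poly"]
      unfolding generic_charpoly_def
      by (subst ring_map_coeff_linear[OF ring_map_push]) (auto simp: vec_eq_iff push_coord[OF bw])
  qed
  then show ?thesis unfolding invariants_push by blast
qed

lemma power_pullback_coord:
  fixes j :: "'n::finite"
  shows "power_pullback q (torus_coord j) = (torus_coord j :: ('n, 'a::comm_ring_1) torus_ring) ^ q"
proof -
  have "(torus_coord j :: ('n, 'a) torus_ring) ^ q = Poly_Mapping.single (\<chi> i. int q * axis j 1 $ i) 1"
  proof (induction q)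
    case 0
    have "(\<chi> i. int 0 * axis j 1 $ i) = (0 :: int^'n)" by (simp add: vec_eq_iff)
    then show ?case by (simp only: power_0 single_one)
  next
    case (Suc q)
    have "axis j 1 + (\<chi> i. int q * axis j 1 $ i) = (\<chi> i. int (Suc q) * axis j 1 $ i)"
      by (simp add: vec_eq_iff algebra_simps)
    with Suc show ?case by (simp add: torus_coord_def mult_single)
  qed
  then show ?thesis by (simp add: power_pullback_push torus_coord_def push_single)
qed

text \<open>
  The coefficients of the characteristic polynomial of the \<open>q\<close>-th power of a companion matrix are universal
  polynomials in those of the matrix, so \<open>c\<close> transports the computation on the torus.
\<close>

lemma cp_power_class:
  fixes c :: "('n::finite, 'o::comm_ring_1) torus_ring \<Rightarrow> 'c::comm_ring_1"
  assumes P: "equivp P" and c: "c \<in> S_points q P \<alpha>" and \<alpha>: "ring_map \<alpha>"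
    and g: "block P g" and K: "block P K" "invertible K" and gK: "g ** K = K ** companion P (cp P g)"
    and cg: "is_class_of P c g"
  shows "cp P (mat_power g q) = cp P g"
proof -
  let ?R = "\<lambda>u y. u \<in> invariants P \<and> c u = y"
  let ?gen = "\<lambda>i. Polynomial.coeff (generic_charpoly P i) :: nat \<Rightarrow> ('n, 'o) torus_ring"
  have R: "ring_rel ?R"
    using c \<alpha> by (intro ring_rel_quotient_point) (auto simp: S_points_def)
  have gen: "?R (?gen i m) (cp P g i m)" for i m
    using generic_charpoly_invariant[OF P] cg by (auto simp: is_class_of_def cp_def)
  \<comment> \<open>The universal companion matrix has invariant entries, so \<open>c\<close> may be
    applied to it, although the individual roots are not invariant in general.\<close>
  have "mat_rel ?R (companion P ?gen) (companion P (cp P g))"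
    unfolding mat_rel_def companion_def vec_lambda_beta
    using ring_rel_minus[OF R gen] ring_rel_0[OF R] ring_rel_1[OF R] by auto
  then have *: "poly_rel ?R (block_charpoly P i (mat_power (companion P ?gen) q))
      (block_charpoly P i (mat_power (companion P (cp P g)) q))" for i
    by (intro poly_rel_block_charpoly[OF R] mat_rel_power[OF R])
  have rp: "ring_map (power_pullback q :: ('n, 'o) torus_ring \<Rightarrow> _)"
    unfolding power_pullback_push by (rule ring_map_push) (simp add: vec_eq_iff algebra_simps)
  have "Polynomial.coeff (block_charpoly P i (mat_power (companion P ?gen) q)) m = power_pullback q (?gen i m)" for i m
    unfolding generic_charpoly_def ring_map_coeff_linear[OF rp] power_pullback_coord
    by (rule arg_cong[OF block_charpoly_companion_power[OF P]])
  then have "Polynomial.coeff (block_charpoly P i (mat_power (companion P (cp P g)) q)) m = c (power_pullback q (?gen i m))" for i m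
    using * unfolding poly_rel_def by metis
  moreover have "c (power_pullback q (?gen i m)) = cp P g i m" for i m
    using c gen by (auto simp: S_points_def)
  moreover have "block_charpoly P i (mat_power g q) = block_charpoly P i (mat_power (companion P (cp P g)) q)" for i
    using mat_power_intertwine[OF gK]
    by (intro block_charpoly_conj[of P _ _ K] P block_power g block_companion K)
  ultimately show ?thesis by (simp add: fun_eq_iff cp_def)
qed

section \<open>Nilpotent ideals\<close>

lemma ideal_minus: "is_ideal N \<Longrightarrow> x \<in> N \<Longrightarrow> - x \<in> N"
  unfolding is_ideal_def by (metis mult_minus1)

lemma ideal_sum: "is_ideal N \<Longrightarrow> (\<And>i. i \<in> I \<Longrightarrow> f i \<in> N) \<Longrightarrow> sum f I \<in> N"
  by (induction I rule: infinite_finite_induct) (auto simp: is_ideal_def)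

lemma ring_rel_mod:
  assumes N: "is_ideal N"
  shows "ring_rel (\<lambda>x y. x - y \<in> N)"
proof -
  have N': "x + y \<in> N" "a * x \<in> N" "0 \<in> N" if "x \<in> N" "y \<in> N" for x y a
    using N that by (auto simp: is_ideal_def)
  have "x * x' - y * y' \<in> N" if "x - y \<in> N" "x' - y' \<in> N" for x y x' y'
  proof -
    have "x * x' - y * y' = x' * (x - y) + y * (x' - y')" by (simp add: algebra_simps)
    then show ?thesis using N' that by metis
  qed
  moreover have "x + x' - (y + y') \<in> N" if "x - y \<in> N" "x' - y' \<in> N" for x y x' y'
    using N'(1)[OF that] by (simp add: algebra_simps)
  moreover have "- x - - y \<in> N" if "x - y \<in> N" for x y
    using ideal_minus[OF N that] by (simp add: algebra_simps)
  moreover have "0 \<in> N" using N by (simp add: is_ideal_def)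
  ultimately show ?thesis by (simp add: ring_rel_def)
qed

text \<open>
  The annihilators of the powers of \<open>N\<close> filter the ring and multiplication by \<open>N\<close> moves up one step;
  they replace the powers of \<open>N\<close>, which would need generated ideals.
\<close>

definition nil_filter :: "'a::comm_ring_1 set \<Rightarrow> nat \<Rightarrow> nat \<Rightarrow> 'a set" where
  "nil_filter N n k = {x. \<forall>s. (\<forall>i<n - k. s i \<in> N) \<longrightarrow> x * (\<Prod>i<n - k. s i) = 0}"

lemma nil_filter_add: "x \<in> nil_filter N n k \<Longrightarrow> y \<in> nil_filter N n k \<Longrightarrow> x + y \<in> nil_filter N n k"
  by (simp add: nil_filter_def distrib_right)

lemma nil_filter_sum: "(\<And>i. i \<in> I \<Longrightarrow> f i \<in> nil_filter N n k) \<Longrightarrow> sum f I \<in> nil_filter N n k"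
  by (induction I rule: infinite_finite_induct) (auto intro: nil_filter_add, auto simp: nil_filter_def)

lemma nil_filter_mult:
  assumes x: "x \<in> nil_filter N n k" and y: "y \<in> N" and k: "k < n"
  shows "y * x \<in> nil_filter N n (Suc k)"
  unfolding nil_filter_def
proof (intro CollectI allI impI)
  fix s assume s: "\<forall>i<n - Suc k. s i \<in> N"
  \<comment> \<open>The extra factor \<open>y\<close> goes into the free last slot, which makes a
    product of \<open>n - k\<close> elements of \<open>N\<close>.\<close>
  let ?s = "s(n - Suc k := y)"
  have nk: "n - k = Suc (n - Suc k)" using k by simp
  have "\<forall>i<n - k. ?s i \<in> N" using s y by (auto simp: nk less_Suc_eq)
  then have "x * (\<Prod>i<n - k. ?s i) = 0" using x unfolding nil_filter_def by blast
  then show "y * x * (\<Prod>i<n - Suc k. s i) = 0"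
    unfolding nk by (simp add: ac_simps)
qed

section \<open>Matrices with entries in a nilpotent ideal\<close>

definition mat_in :: "'a set \<Rightarrow> 'a^'n^'m \<Rightarrow> bool" where
  "mat_in S A \<longleftrightarrow> (\<forall>i j. A $ i $ j \<in> S)"

lemma mat_in_add: "is_ideal S \<Longrightarrow> mat_in S A \<Longrightarrow> mat_in S B \<Longrightarrow> mat_in S (A + B)"
  by (simp add: mat_in_def is_ideal_def)

lemma mat_in_filter_mult:
  "mat_in N A \<Longrightarrow> mat_in (nil_filter N n k) B \<Longrightarrow> k < n \<Longrightarrow> mat_in (nil_filter N n (Suc k)) (A ** B)"
  for A :: "'a::comm_ring_1^'n^'n"
  by (auto simp: mat_in_def matrix_matrix_mult_def intro!: nil_filter_sum nil_filter_mult)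

context
  fixes N :: "'a::comm_ring_1 set" and n :: nat
  assumes ideal: "is_ideal N" and nil: "\<forall>x :: nat \<Rightarrow> 'a. (\<forall>k<n. x k \<in> N) \<longrightarrow> (\<Prod>k<n. x k) = 0"
begin

lemma nil_filter_0: "x \<in> nil_filter N n 0" and nil_filter_top: "x \<in> nil_filter N n n \<Longrightarrow> x = 0"
  using nil by (auto simp: nil_filter_def)

lemma mat_in_nilpotent:
  fixes E :: "'a^'n^'n::finite"
  assumes "mat_in N E"
  shows "mat_power E n = 0"
proof -
  have "mat_in (nil_filter N n k) (mat_power E k)" if "k \<le> n" for k
    using that
  proof (induction k)
    case 0
    then show ?case using nil_filter_0 by (auto simp: mat_in_def)
  next
    case (Suc k)
    then show ?case using mat_in_filter_mult[OF assms, of n k "mat_power E k"] by (simp add: mat_power_Suc)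
  qed
  from this[of n] show ?thesis using nil_filter_top by (simp add: mat_in_def vec_eq_iff)
qed

text \<open>\<open>B^l - 1\<close> is \<open>B - 1\<close> times
  \<open>1 + B + ... + B^(l-1)\<close>, and this sum is congruent to \<open>l\<close>, hence to
  zero, modulo \<open>N\<close>. So every \<open>l\<close>-th power moves the difference from the
  identity one step up the filtration, which ends at zero after \<open>n\<close> steps.\<close>

lemma mat_in_unipotent_order:
  fixes A :: "'a^'n^'n::finite"
  assumes E: "mat_in N (A - mat 1)" and l: "of_nat l \<in> N"
  shows "mat_power A (l ^ n) = mat 1"
proof -
  note R = ring_rel_mod[OF ideal]
  have pw: "mat_in N (mat_power A k - mat 1)" for k
    using mat_rel_power[OF R, of A "mat 1" k] E by (auto simp: mat_rel_def mat_in_def)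
  have "mat_in (nil_filter N n t) (mat_power A (l ^ t) - mat 1)" if "t \<le> n" for t
    using that
  proof (induction t)
    case 0
    then show ?case using nil_filter_0 by (auto simp: mat_in_def)
  next
    case (Suc t)
    let ?B = "mat_power A (l ^ t)"
    have tele: "mat_power ?B m - mat 1 = (\<Sum>i<m. mat_power ?B i) ** (?B - mat 1)" for m
      by (induction m) (auto simp: matrix_mult_zero matrix_add_rdistrib matrix_diff_ldistrib mat_power_Suc2,
          simp add: algebra_simps)
    have S: "mat_in N (\<Sum>i<l. mat_power ?B i)"
    proof -
      have eq: "(\<Sum>i<l. mat_power ?B i) = (\<Sum>i<l. mat_power ?B i - mat 1) + (\<Sum>i<l. mat 1)"
        by (simp add: sum_subtractf)
      have 1: "mat_in N (\<Sum>i<l. mat_power ?B i - mat 1)"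
        using pw ideal by (auto simp: mat_in_def mat_power_mult[symmetric] intro!: ideal_sum)
      have 2: "mat_in N (\<Sum>i<l. mat 1 :: 'a^'n^'n)"
      proof -
        have "(\<Sum>i<m. mat 1 :: 'a^'n^'n) $ i $ j = mat 1 $ i $ j * of_nat m" for m i j
          by (induction m) (auto simp: algebra_simps)
        then show ?thesis using l ideal by (auto simp: mat_in_def is_ideal_def)
      qed
      show ?thesis unfolding eq by (rule mat_in_add[OF ideal 1 2])
    qed
    have "mat_in (nil_filter N n (Suc t)) ((\<Sum>i<l. mat_power ?B i) ** (?B - mat 1))"
      using mat_in_filter_mult[OF S Suc.IH] Suc.prems by linarith
    then have "mat_in (nil_filter N n (Suc t)) (mat_power ?B l - mat 1)" unfolding tele .
    then show ?case by (simp only: mat_power_mult[symmetric] power_Suc2)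
  qed
  from this[of n] have "(mat_power A (l ^ n) - mat 1) $ i $ j = 0" for i j
    using nil_filter_top unfolding mat_in_def by blast
  then show ?thesis by (simp add: vec_eq_iff)
qed

text \<open>Geometric series: \<open>A D = 1 - E\<close> with \<open>E\<close> nilpotent, so
  \<open>D\<close> times the sum of the powers of \<open>E\<close> is a right inverse of
  \<open>A\<close>.\<close>

lemma invertible_mod_nil:
  fixes A :: "'a^'n^'n::finite"
  assumes "mat_in N (A ** D - mat 1)"
  shows "invertible A"
proof -
  let ?E = "mat 1 - A ** D"
  have "mat_in N ?E"
    using assms ideal_minus[OF ideal] unfolding mat_in_def by (metis minus_diff_eq vector_uminus_component)
  then have "mat_power ?E n = 0" by (rule mat_in_nilpotent)
  moreover have "(mat 1 - F) ** (\<Sum>i<m. mat_power F i) = mat 1 - mat_power F m" for F :: "'a^'n^'n" and m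
    by (induction m) (simp_all add: matrix_mult_zero matrix_add_ldistrib matrix_diff_rdistrib mat_power_Suc)
  note this[of ?E n]
  ultimately have "A ** (D ** (\<Sum>i<n. mat_power ?E i)) = mat 1"
    by (simp add: matrix_mul_assoc)
  then show ?thesis by (rule invertible_right)
qed

end

lemma nilpotent_idealE:
  assumes "nilpotent_ideal N"
  obtains n where "is_ideal N" "\<forall>x :: nat \<Rightarrow> 'a::comm_ring_1. (\<forall>k<n. x k \<in> N) \<longrightarrow> (\<Prod>k<n. x k) = 0"
  using assms unfolding nilpotent_ideal_def by blast

text \<open>A product of \<open>m * n\<close> factors is grouped into \<open>m\<close> runs of
  length \<open>n\<close>. Each run maps to zero, so it lies in the kernel, and a product of
  \<open>m\<close> elements of the kernel vanishes. This ideal later witnesses that the lift belongs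
  to the completion.\<close>

lemma nilpotent_ideal_preimage:
  fixes \<pi> :: "'c::comm_ring_1 \<Rightarrow> 'b::comm_ring_1"
  assumes \<pi>: "ring_map \<pi>" and ker: "nilpotent_ideal {x. \<pi> x = 0}" and N: "nilpotent_ideal N"
  shows "nilpotent_ideal {x. \<pi> x \<in> N}"
proof -
  obtain m where m: "\<forall>x :: nat \<Rightarrow> 'c. (\<forall>k<m. x k \<in> {x. \<pi> x = 0}) \<longrightarrow> (\<Prod>k<m. x k) = 0"
    using nilpotent_idealE[OF ker] by metis
  obtain n where n: "\<forall>x :: nat \<Rightarrow> 'b. (\<forall>k<n. x k \<in> N) \<longrightarrow> (\<Prod>k<n. x k) = 0" and I: "is_ideal N"
    using nilpotent_idealE[OF N] by metis
  have pi_prod: "\<pi> (prod f A) = (\<Prod>i\<in>A. \<pi> (f i))" for f and A :: "nat set"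
    by (induction A rule: infinite_finite_induct) (use \<pi> in \<open>auto simp: ring_map_def\<close>)
  have "(\<Prod>k<m * n. x k) = 0" if x: "\<forall>k<m * n. \<pi> (x k) \<in> N" for x
  proof -
    have "\<pi> (prod x {i * n..<i * n + n}) = 0" if "i < m" for i
    proof -
      have "i * n + j < m * n" if "j < n" for j
      proof -
        have "i * n + j < Suc i * n" using that by simp
        also have "\<dots> \<le> m * n" using \<open>i < m\<close> by (intro mult_le_mono1) simp
        finally show ?thesis .
      qed
      then have "(\<Prod>j<n. \<pi> (x (i * n + j))) = 0" using x by (intro n[rule_format]) auto
      then show ?thesis
        unfolding pi_prod using prod.shift_bounds_nat_ivl[of "\<lambda>k. \<pi> (x k)" 0 "i * n" n]
        by (simp add: atLeast0LessThan add.commute)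
    qed
    then have "(\<Prod>i<m. prod x {i * n..<i * n + n}) = 0" by (intro m[rule_format]) auto
    then show ?thesis by (simp add: prod.nat_group)
  qed
  moreover have "is_ideal {x. \<pi> x \<in> N}"
    using \<pi> I ring_map_0[OF \<pi>] by (auto simp: is_ideal_def ring_map_def)
  ultimately show ?thesis unfolding nilpotent_ideal_def by blast
qed

text \<open>A test ring need not map to the residue field, since its elements need not be congruent
  to coefficients modulo \<open>N\<close>. The relation is reduction restricted to those elements
  that are.\<close>

definition reduces_to :: "('o \<Rightarrow> 'k) \<Rightarrow> ('o \<Rightarrow> 'c::comm_ring_1) \<Rightarrow> 'c set \<Rightarrow> 'c \<Rightarrow> 'k \<Rightarrow> bool" where
  "reduces_to red \<alpha> N x y \<longleftrightarrow> (\<exists>a. red a = y \<and> x - \<alpha> a \<in> N)"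

lemma ring_rel_reduces_to:
  assumes red: "ring_map red" and \<alpha>: "ring_map \<alpha>" and N: "is_ideal N"
  shows "ring_rel (reduces_to red \<alpha> N)"
proof -
  note R = ring_rel_mod[OF N]
  have "reduces_to red \<alpha> N 0 0" "reduces_to red \<alpha> N 1 1"
    using red \<alpha> N ring_map_0[OF red] ring_map_0[OF \<alpha>] unfolding reduces_to_def ring_map_def is_ideal_def
    by (metis diff_self)+
  moreover have "reduces_to red \<alpha> N (x + x') (y + y') \<and> reduces_to red \<alpha> N (x * x') (y * y')"
    if r: "reduces_to red \<alpha> N x y" "reduces_to red \<alpha> N x' y'" for x x' y y'
  proof -
    obtain a a' where a: "red a = y" "x - \<alpha> a \<in> N" "red a' = y'" "x' - \<alpha> a' \<in> N"
      using r unfolding reduces_to_def by blast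
    have "x + x' - \<alpha> (a + a') \<in> N" "x * x' - \<alpha> (a * a') \<in> N"
      using ring_rel_add[OF R a(2,4)] ring_rel_mult[OF R a(2,4)] \<alpha> by (auto simp: ring_map_def)
    then show ?thesis using red a(1,3) unfolding reduces_to_def ring_map_def by metis
  qed
  moreover have "reduces_to red \<alpha> N (- x) (- y)" if "reduces_to red \<alpha> N x y" for x y
    using that ring_rel_minus[OF R] ring_map_minus[OF red] ring_map_minus[OF \<alpha>]
    unfolding reduces_to_def by metis
  ultimately show ?thesis unfolding ring_rel_def by blast
qed

lemma reduces_to_0:
  assumes "reduces_to red \<alpha> N x (0 :: 'k::zero)" "is_ideal N" "\<And>a. red a = 0 \<Longrightarrow> \<alpha> a \<in> N"
  shows "x \<in> N"
proof -
  obtain a where "red a = 0" "x - \<alpha> a \<in> N" using assms(1) by (auto simp: reduces_to_def)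
  then have "x - \<alpha> a + \<alpha> a \<in> N" using assms(2,3) unfolding is_ideal_def by blast
  then show ?thesis by simp
qed

text \<open>The entries of an inverse over the residue field are lifted arbitrarily; the product is
  then the identity modulo \<open>N\<close>, which suffices by \<open>invertible_mod_nil\<close>.
  Applied to Krylov matrices, this lifts cyclic vectors from the residue field.\<close>

lemma invertible_reduces_to:
  fixes red :: "'o::comm_ring_1 \<Rightarrow> 'k::comm_ring_1" and A :: "'c::comm_ring_1^'n^'n::finite"
  assumes red: "ring_map red" "surj red" and \<alpha>: "ring_map \<alpha>" and N: "nilpotent_ideal N"
    and k: "\<And>a. red a = 0 \<Longrightarrow> \<alpha> a \<in> N"
    and A: "mat_rel (reduces_to red \<alpha> N) A A'" and A': "invertible A'"
  shows "invertible A"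
proof -
  obtain n where I: "is_ideal N" and n: "\<forall>x :: nat \<Rightarrow> 'c. (\<forall>k<n. x k \<in> N) \<longrightarrow> (\<Prod>k<n. x k) = 0"
    using nilpotent_idealE[OF N] by metis
  note R = ring_rel_reduces_to[OF red(1) \<alpha> I]
  obtain D' where D': "A' ** D' = mat 1" using A' by (auto simp: invertible_def)
  let ?D = "map_matrix (\<lambda>y. \<alpha> (inv_into UNIV red y)) D'"
  have "mat_rel (reduces_to red \<alpha> N) ?D D'"
    using I surj_f_inv_f[OF red(2)] unfolding mat_rel_def map_matrix_nth reduces_to_def is_ideal_def
    by (metis diff_self)
  then have "mat_rel (reduces_to red \<alpha> N) (A ** ?D) (mat 1)"
    using mat_rel_mult[OF R A] D' by metis
  moreover have sub: "x - y \<in> N" if "reduces_to red \<alpha> N x z" "reduces_to red \<alpha> N y z" for x y z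
    using reduces_to_0[OF _ I k, where x = "x + - y"] ring_rel_add[OF R that(1) ring_rel_minus[OF R that(2)]] by simp
  ultimately have "mat_in N (A ** ?D - mat 1)"
    using mat_rel_one[OF R] unfolding mat_in_def mat_rel_def vector_minus_component by blast
  then show ?thesis by (rule invertible_mod_nil[OF I n])
qed

lemma invertible_lift:
  fixes \<pi> :: "'c::comm_ring_1 \<Rightarrow> 'b::comm_ring_1" and A :: "'c^'n^'n::finite"
  assumes \<pi>: "ring_map \<pi>" "surj \<pi>" and ker: "nilpotent_ideal {x. \<pi> x = 0}"
    and A: "invertible (map_matrix \<pi> A)"
  shows "invertible A"
proof -
  obtain n where I: "is_ideal {x. \<pi> x = 0}"
    and n: "\<forall>x :: nat \<Rightarrow> 'c. (\<forall>k<n. x k \<in> {x. \<pi> x = 0}) \<longrightarrow> (\<Prod>k<n. x k) = 0"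
    using nilpotent_idealE[OF ker] by metis
  obtain D' where D': "map_matrix \<pi> A ** D' = mat 1" using A by (auto simp: invertible_def)
  let ?D = "map_matrix (inv_into UNIV \<pi>) D'"
  note R = ring_rel_graph[OF \<pi>(1)]
  have "mat_rel (\<lambda>x y. \<pi> x = y) (A ** ?D) (mat 1)"
    unfolding D'[symmetric]
    by (rule mat_rel_mult[OF R]) (auto simp: mat_rel_def map_matrix_nth surj_f_inv_f[OF \<pi>(2)])
  then have "\<pi> ((A ** ?D) $ i $ j + - mat 1 $ i $ j) = mat 1 $ i $ j + - mat 1 $ i $ j" for i j
    using ring_rel_add[OF R _ ring_rel_minus[OF R]] mat_rel_one[OF R] unfolding mat_rel_def by blast
  then have "mat_in {x. \<pi> x = 0} (A ** ?D - mat 1)"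
    by (simp add: mat_in_def)
  then show ?thesis by (rule invertible_mod_nil[OF I n])
qed

section \<open>Nilpotent matrices over a field\<close>

definition class_space :: "('n::finite \<Rightarrow> 'n \<Rightarrow> bool) \<Rightarrow> 'n \<Rightarrow> ('k::field^'n) set" where
  "class_space Q b = {y. \<forall>i. i \<notin> {i. Q b i} \<longrightarrow> y $ i = 0}"

lemma subspace_class: "vec.subspace (class_space Q b)"
  by (auto simp: class_space_def vec.subspace_def)

lemma dim_class: "vec.dim (class_space Q b) = csize Q b"
  unfolding class_space_def csize_def by (rule dim_substandard_cart)

lemma block_local:
  assumes Q: "equivp Q" and A: "block Q A" and vw: "\<And>i. Q b i \<Longrightarrow> v $ i = w $ i" and j: "Q b j"
  shows "(A *v v) $ j = (A *v w) $ j"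
  unfolding matrix_vector_mult_def vec_lambda_beta
proof (rule sum.cong)
  fix i
  show "A $ j $ i * v $ i = A $ j $ i * w $ i"
  proof (cases "Q j i")
    case True
    then show ?thesis using vw equivp_class[OF Q j] by simp
  qed (use A in \<open>simp add: block_def\<close>)
qed simp

lemma block_power_local:
  assumes "equivp Q" "block Q A" "\<And>i. Q b i \<Longrightarrow> v $ i = w $ i" "Q b j"
  shows "(mat_power A k *v v) $ j = (mat_power A k *v w) $ j"
  using block_local[OF assms(1) block_power[OF assms(1,2)] assms(3,4)] .

lemma class_space_invariant:
  assumes Q: "equivp Q" and A: "block Q A" and y: "y \<in> class_space Q b"
  shows "A *v y \<in> class_space Q b"
  unfolding class_space_def
proof (intro CollectI allI impI)
  fix i assume i: "i \<notin> {i. Q b i}"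
  have "y $ j = 0" if "Q i j" for j
  proof -
    have "\<not> Q b j" using i equivp_transp[OF Q, of b j i] equivp_symp[OF Q that] by blast
    then show ?thesis using y by (simp add: class_space_def)
  qed
  then have "(A *v y) $ i = (A *v 0) $ i"
    by (intro block_local[OF Q A, of i]) (auto simp: equivp_reflp[OF Q])
  then show "(A *v y) $ i = 0" by simp
qed

lemma mat_vec_sum: "A *v sum f I = (\<Sum>i\<in>I. A *v f i)" for A :: "'a::comm_ring_1^'n^'n"
  by (induction I rule: infinite_finite_induct) (auto simp: matrix_vector_right_distrib)

lemma mat_vec_scale: "A *v (c *s x) = c *s (A *v x)" for A :: "'a::comm_ring_1^'n^'n"
  by (simp add: vec_eq_iff matrix_vector_mult_def sum_distrib_left ac_simps)

text \<open>
  A vector of maximal nilpotency order spans a direct summand: a complement is the largest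
  invariant subspace in the kernel of a coordinate that does not vanish on the socle.
\<close>

lemma nilpotent_cyclic_or_split:
  fixes A :: "'k::field^'n^'n::finite"
  assumes Q: "equivp Q" and A: "block Q A" and nil: "mat_power A K = 0"
  obtains (cyclic) x where "x \<in> class_space Q b" "mat_power A (csize Q b - 1) *v x \<noteq> 0"
      "mat_power A (csize Q b) *v x = 0"
    | (split) W U where "vec.subspace W" "vec.subspace U" "W \<noteq> {0}" "U \<noteq> {0}" "W \<inter> U = {0}"
      "{w + u |w u. w \<in> W \<and> u \<in> U} = class_space Q b"
      "\<And>y. y \<in> W \<Longrightarrow> A *v y \<in> W" "\<And>y. y \<in> U \<Longrightarrow> A *v y \<in> U"
proof -
  let ?V = "class_space Q b :: ('k^'n) set" and ?p = "\<lambda>k. mat_power A k"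
  \<comment> \<open>\<open>s\<close> is the nilpotency order on the class of \<open>b\<close>;
    below, \<open>x\<close> attains it and \<open>c\<close> is a coordinate in which
    \<open>A^(s-1) x\<close> is nonzero.\<close>
  define s where "s = (LEAST s. \<forall>y\<in>?V. ?p s *v y = 0)"
  have s0: "?p s *v y = 0" if "y \<in> ?V" for y
    using LeastI[of "\<lambda>s. \<forall>y\<in>?V. ?p s *v y = 0" K] that unfolding s_def by (simp add: nil)
  have eb: "axis b 1 \<in> ?V" by (auto simp: class_space_def axis_def equivp_reflp[OF Q])
  have "s \<noteq> 0"
  proof
    assume "s = 0"
    with s0[OF eb] show False by (simp add: axis_eq_0_iff)
  qed
  then obtain r where r: "s = Suc r" by (cases s) auto
  obtain x where x: "x \<in> ?V" "?p r *v x \<noteq> 0"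
    using not_less_Least[of r "\<lambda>s. \<forall>y\<in>?V. ?p s *v y = 0"] unfolding s_def[symmetric] r by auto
  obtain c where c: "(?p r *v x) $ c \<noteq> 0" using x(2) by (auto simp: vec_eq_iff)
  have pV: "?p k *v y \<in> ?V" if "y \<in> ?V" for y k
    by (rule class_space_invariant[OF Q block_power[OF Q A] that])
  have big: "?p k *v y = 0" if k: "s \<le> k" and y: "y \<in> ?V" for k y
  proof -
    obtain d where "k = s + d" using le_Suc_ex[OF k] by blast
    then have "?p k *v y = ?p d *v (?p s *v y)"
      by (simp add: matrix_vector_mul_assoc add.commute mat_power_add[symmetric])
    then show ?thesis using s0[OF y] by simp
  qed
  let ?comb = "\<lambda>a. \<Sum>i<s. a i *s (?p i *v x)"
  have pcomb: "?p t *v ?comb a = (\<Sum>i<s. a i *s (?p (t + i) *v x))" for t a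
    by (simp add: mat_vec_sum mat_vec_scale matrix_vector_mul_assoc mat_power_add)
  \<comment> \<open>If \<open>j\<close> is the least index with a nonzero coefficient,
    \<open>A^(r-j)\<close> kills all later terms of the combination and leaves a multiple of
    \<open>A^r x\<close>, which coordinate \<open>c\<close> detects. This gives both the
    independence of the orbit and \<open>W \<inter> U = {0}\<close>.\<close>
  have key: "a i = 0" if z: "\<And>t. t < s \<Longrightarrow> (?p t *v ?comb a) $ c = 0" and i: "i < s" for a i
  proof (rule ccontr)
    assume "a i \<noteq> 0"
    define j where "j = (LEAST i. a i \<noteq> 0)"
    have j: "a j \<noteq> 0" "j \<le> i" "\<And>k. k < j \<Longrightarrow> a k = 0"
      unfolding j_def using \<open>a i \<noteq> 0\<close> LeastI[of "\<lambda>i. a i \<noteq> 0"] Least_le[of "\<lambda>i. a i \<noteq> 0"] not_less_Least by blast+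
    have "?p (r - j) *v ?comb a = (\<Sum>k<s. if k = j then a j *s (?p r *v x) else 0)"
      unfolding pcomb
    proof (rule sum.cong)
      fix k
      consider "k < j" | "k = j" | "k > j" by linarith
      then show "a k *s (?p (r - j + k) *v x) = (if k = j then a j *s (?p r *v x) else 0)"
      proof cases
        case 3
        then have "s \<le> r - j + k" using j(2) i r by linarith
        then show ?thesis using 3 big x(1) by simp
      qed (use j i r in auto)
    qed simp
    then have "?p (r - j) *v ?comb a = a j *s (?p r *v x)" using j(2) i by simp
    then have "a j * (?p r *v x) $ c = 0" using z[of "r - j"] r by simp
    then show False using c j(1) by simp
  qed
  have key0: "a i = 0" if z: "?comb a = 0" and i: "i < s" for a i
  proof (rule key[where a = a, OF _ i])
    fix t show "(?p t *v ?comb a) $ c = 0" unfolding z by simp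
  qed
  define W where "W = vec.span ((\<lambda>i. ?p i *v x) ` {..<s})"
  \<comment> \<open>The conditions for \<open>t < s\<close> already make \<open>U\<close> invariant,
    because \<open>A^s\<close> vanishes on the class.\<close>
  define U where "U = {y \<in> ?V. \<forall>t<s. (?p t *v y) $ c = 0}"
  have inj: "inj_on (\<lambda>i. ?p i *v x) {..<s}"
  proof (rule inj_onI, rule ccontr)
    fix i j assume ij: "i \<in> {..<s}" "j \<in> {..<s}" "?p i *v x = ?p j *v x" "i \<noteq> j"
    let ?a = "\<lambda>k. (if k = i then 1 else 0) - (if k = j then 1 else 0) :: 'k"
    have "?comb ?a = (\<Sum>k<s. (if k = i then ?p i *v x else 0) - (if k = j then ?p j *v x else 0))"
      by (rule sum.cong) auto
    then have "?comb ?a = 0" using ij by (simp add: sum_subtractf)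
    then have "?a i = 0" by (rule key0[where a = ?a]) (use ij in simp)
    then show False using ij(4) by simp
  qed
  have comb: "y \<in> W \<Longrightarrow> \<exists>a. y = ?comb a" for y
    unfolding W_def by (auto simp: vec.span_finite sum.reindex[OF inj])
  have combW: "?comb a \<in> W" for a
    unfolding W_def by (intro vec.span_sum vec.span_scale vec.span_base) auto
  have ind: "vec.independent ((\<lambda>i. ?p i *v x) ` {..<s})"
  proof (rule vec.independent_if_scalars_zero)
    fix f y assume "(\<Sum>y\<in>(\<lambda>i. ?p i *v x) ` {..<s}. f y *s y) = 0" and y: "y \<in> (\<lambda>i. ?p i *v x) ` {..<s}"
    then have "?comb (\<lambda>i. f (?p i *v x)) = 0" by (simp add: sum.reindex[OF inj])
    then have "f (?p i *v x) = 0" if "i < s" for i by (rule key0[where a = "\<lambda>i. f (?p i *v x)"]) (rule that)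
    then show "f y = 0" using y by auto
  qed simp
  have dimW: "vec.dim W = s"
    unfolding W_def by (simp add: vec.dim_eq_card_independent[OF ind] card_image[OF inj])
  have subV: "vec.subspace ?V" by (rule subspace_class)
  have WV: "W \<subseteq> ?V" unfolding W_def using pV[OF x(1)] by (intro vec.span_minimal subV) auto
  have subU: "vec.subspace U"
    using subV unfolding U_def vec.subspace_def
    by (auto simp: matrix_vector_right_distrib mat_vec_scale)
  have UA: "A *v y \<in> U" if "y \<in> U" for y
  proof -
    have y: "y \<in> ?V" "\<And>t. t < s \<Longrightarrow> (?p t *v y) $ c = 0" using that by (auto simp: U_def)
    have "(?p t *v (A *v y)) $ c = 0" if "t < s" for t
    proof (cases "Suc t < s")
      case True
      then show ?thesis using y(2)[of "Suc t"] by (simp add: matrix_vector_mul_assoc mat_power_Suc2)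
    next
      case False
      then have "?p (Suc t) *v y = 0" using that by (intro big y(1)) simp
      then show ?thesis by (simp add: matrix_vector_mul_assoc mat_power_Suc2)
    qed
    then show ?thesis using class_space_invariant[OF Q A y(1)] by (simp add: U_def)
  qed
  have WA: "A *v y \<in> W" if y: "y \<in> W" for y
  proof -
    obtain a where "y = ?comb a" using comb[OF y] by blast
    then have "A *v y = (\<Sum>i<s. a i *s (?p (Suc i) *v x))" using pcomb[of 1 a] by simp
    moreover have "?p (Suc i) *v x \<in> W" if "i < s" for i
    proof (cases "Suc i < s")
      case True
      then show ?thesis unfolding W_def by (intro vec.span_base) auto
    next
      case False
      then have "?p (Suc i) *v x = 0" using that by (intro big x(1)) simp
      then show ?thesis by (simp add: W_def vec.span_zero)
    qed
    ultimately show ?thesis unfolding W_def by (auto intro!: vec.span_sum vec.span_scale)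
  qed
  have "y = 0" if y: "y \<in> W" "y \<in> U" for y
  proof -
    obtain a where a: "y = ?comb a" using comb[OF y(1)] by blast
    have "a i = 0" if "i < s" for i
    proof (rule key[where a = a, OF _ that])
      fix t assume "t < s"
      then show "(?p t *v ?comb a) $ c = 0" using y(2) unfolding U_def a by blast
    qed
    then show ?thesis unfolding a by simp
  qed
  then have WU: "W \<inter> U = {0}"
    using subU vec.subspace_0 vec.span_zero by (auto simp: W_def)
  \<comment> \<open>The functionals \<open>(A^t y)\<close> at coordinate \<open>c\<close> are
    matched from \<open>t = r\<close> downwards. Subtracting a multiple of \<open>A^k x\<close>
    corrects the one at \<open>t = r - k\<close> and leaves those with larger \<open>t\<close>
    unchanged, since there \<open>A^(t+k) x = 0\<close>.\<close>
  have approx: "\<exists>w\<in>W. \<forall>t. s - k \<le> t \<and> t < s \<longrightarrow> (?p t *v (y - w)) $ c = 0" if y: "y \<in> ?V" and k: "k \<le> s" for k y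
    using k
  proof (induction k)
    case 0
    show ?case by (rule bexI[of _ 0]) (auto simp: W_def vec.span_zero)
  next
    case (Suc k)
    then obtain w where w: "w \<in> W" "\<And>t. s - k \<le> t \<Longrightarrow> t < s \<Longrightarrow> (?p t *v (y - w)) $ c = 0" by auto
    let ?t = "s - Suc k"
    let ?d = "(?p ?t *v (y - w)) $ c / (?p r *v x) $ c"
    let ?w = "w + ?d *s (?p k *v x)"
    have tk: "?t + k = r" using Suc.prems r by simp
    have "(?p t *v (y - ?w)) $ c = 0" if t: "s - Suc k \<le> t" "t < s" for t
    proof -
      have "?p t *v (y - ?w) = ?p t *v (y - w) - ?d *s (?p (t + k) *v x)"
        by (simp add: matrix_vector_mult_diff_distrib matrix_vector_right_distrib mat_vec_scale
            matrix_vector_mul_assoc mat_power_add)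
      moreover have "(?p t *v (y - w)) $ c = ?d * (?p (t + k) *v x) $ c"
      proof (cases "t = ?t")
        case True
        then show ?thesis using c tk by simp
      next
        case False
        then have "s \<le> t + k" "s - k \<le> t" using t Suc.prems by linarith+
        then show ?thesis using w(2)[of t] t big[OF _ x(1), of "t + k"] by simp
      qed
      ultimately show ?thesis by simp
    qed
    moreover have "?w \<in> W" using w(1) Suc.prems unfolding W_def
      by (intro vec.span_add vec.span_scale vec.span_base[of "?p k *v x"]) auto
    ultimately show ?case by blast
  qed
  have sum: "{w + u |w u. w \<in> W \<and> u \<in> U} = ?V"
  proof (intro equalityI subsetI)
    fix y assume "y \<in> {w + u |w u. w \<in> W \<and> u \<in> U}"
    then show "y \<in> ?V" using WV vec.subspace_add[OF subV] by (auto simp: U_def)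
  next
    fix y assume y: "y \<in> ?V"
    obtain w where w: "w \<in> W" "\<forall>t<s. (?p t *v (y - w)) $ c = 0" using approx[OF y, of s] by auto
    have "y - w \<in> ?V" using y w(1) WV by (intro vec.subspace_diff[OF subV]) auto
    then have "y - w \<in> U" using w by (simp add: U_def)
    then show "y \<in> {w + u |w u. w \<in> W \<and> u \<in> U}" using w(1)
      by (intro CollectI exI[of _ w] exI[of _ "y - w"]) auto
  qed
  show thesis
  proof (cases "U = {0}")
    case True
    \<comment> \<open>The orbit of \<open>x\<close> is then a basis of the whole class space, so the
      nilpotency order equals the size of the class.\<close>
    then have "?V = W" unfolding sum[symmetric] by auto
    then have "csize Q b = s" using dimW dim_class[of Q b] by metis
    then show ?thesis using cyclic[of x] x s0 r by simp
  next
    case False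
    have "x \<in> W" unfolding W_def using r
      by (intro vec.span_base image_eqI[of _ _ 0]) auto
    moreover have "x \<noteq> 0" using x(2) by auto
    ultimately have "W \<noteq> {0}" by auto
    then show ?thesis
      using split[OF _ subU _ False WU sum WA UA] by (simp add: W_def)
  qed
qed

section \<open>Splitting a block along a pair of invariant complements\<close>

lemma span_columns_support:
  fixes f :: "'n::finite \<Rightarrow> 'k::field^'n"
  assumes "y \<in> vec.span (f ` T)"
  shows "\<exists>z. (\<forall>i. i \<notin> T \<longrightarrow> z $ i = 0) \<and> (\<chi> i j. f j $ i) *v z = y"
proof -
  let ?h = "(\<chi> i j. f j $ i) :: 'k^'n^'n"
  let ?S = "{y. \<exists>z. (\<forall>i. i \<notin> T \<longrightarrow> z $ i = 0) \<and> ?h *v z = y}"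
  have "vec.subspace ?S"
    unfolding vec.subspace_def
  proof (intro conjI ballI allI)
    show "0 \<in> ?S" by (intro CollectI exI[of _ 0]) simp
  next
    fix a b assume "a \<in> ?S" "b \<in> ?S"
    then obtain z z' where "\<forall>i. i \<notin> T \<longrightarrow> z $ i = 0" "?h *v z = a" "\<forall>i. i \<notin> T \<longrightarrow> z' $ i = 0" "?h *v z' = b"
      by blast
    then show "a + b \<in> ?S" by (intro CollectI exI[of _ "z + z'"]) (simp add: matrix_vector_right_distrib)
  next
    fix a c assume "a \<in> ?S"
    then obtain z where "\<forall>i. i \<notin> T \<longrightarrow> z $ i = 0" "?h *v z = a" by blast
    then show "c *s a \<in> ?S" by (intro CollectI exI[of _ "c *s z"]) (simp add: mat_vec_scale)
  qed
  moreover have "f ` T \<subseteq> ?S"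
  proof
    fix a assume "a \<in> f ` T"
    then obtain j where j: "j \<in> T" "a = f j" by blast
    have "?h *v axis j 1 = f j"
      by (simp add: vec_eq_iff matrix_vector_mult_def axis_def if_distrib cong: if_cong)
    then show "a \<in> ?S" using j by (intro CollectI exI[of _ "axis j 1"]) (auto simp: axis_def)
  qed
  ultimately show ?thesis using vec.span_minimal[of "f ` T" ?S] assms by blast
qed

text \<open>The columns of \<open>h\<close> form a basis adapted to \<open>W\<close> and
  \<open>U\<close> on the class of \<open>b\<close>, and the standard basis elsewhere. The elements
  of the class serve as labels: a subset \<open>S\<close> of size \<open>dim W\<close> labels the
  basis of \<open>W\<close>, the rest that of \<open>U\<close>.\<close>

lemma split_block:
  fixes A :: "'k::field^'n^'n::finite"
  assumes Q: "equivp Q" and A: "block Q A"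
    and W: "vec.subspace W" "W \<noteq> {0}" "\<And>y. y \<in> W \<Longrightarrow> A *v y \<in> W"
    and U: "vec.subspace U" "U \<noteq> {0}" "\<And>y. y \<in> U \<Longrightarrow> A *v y \<in> U"
    and WU: "W \<inter> U = {0}" "{w + u |w u. w \<in> W \<and> u \<in> U} = class_space Q b"
  obtains Q' h h' where "equivp Q'" "Q' < Q" "block Q h" "h ** h' = mat 1" "h' ** h = mat 1"
    "block Q' (h' ** A ** h)"
proof -
  let ?B = "{i. Q b i}"
  obtain BW where BW: "finite BW" "vec.span BW = W" "card BW = vec.dim W"
    using vec.basis_subspace_exists[OF W(1)] by metis
  obtain BU where BU: "finite BU" "vec.span BU = U" "card BU = vec.dim U"
    using vec.basis_subspace_exists[OF U(1)] by metis
  have dims: "card BW + card BU = card ?B"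
  proof -
    have "vec.dim (class_space Q b :: ('k^'n) set) = vec.dim W + vec.dim U"
      using vec.dim_sums_Int[OF W(1) U(1)] unfolding WU by simp
    then show ?thesis using dim_class[of Q b] unfolding BW BU csize_def by metis
  qed
  have pos: "card BW > 0" "card BU > 0"
  proof -
    have "BW \<noteq> {}" "BU \<noteq> {}" using W(2) U(2) BW(2) BU(2) vec.span_empty by metis+
    then show "card BW > 0" "card BU > 0" using BW(1) BU(1) by (simp_all add: card_gt_0_iff)
  qed
  obtain S where S: "S \<subseteq> ?B" "card S = card BW"
    using obtain_subset_with_card_n[of "card BW" ?B] dims by (metis le_add1)
  obtain f1 where f1: "bij_betw f1 S BW" using S(2) BW(1) finite_same_card_bij[of S BW] by auto
  have "card (?B - S) = card BU" using S dims by (simp add: card_Diff_subset)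
  then obtain f2 where f2: "bij_betw f2 (?B - S) BU" using BU(1) finite_same_card_bij[of "?B - S" BU] by auto
  define f where "f j = (if Q b j then if j \<in> S then f1 j else f2 j else axis j 1)" for j
  have fS: "f ` S = BW" using f1 S(1) by (auto simp: f_def bij_betw_def image_def)
  have fU: "f ` (?B - S) = BU" using f2 by (auto simp: f_def bij_betw_def image_def)
  define h :: "'k^'n^'n" where "h = (\<chi> i j. f j $ i)"
  have V0: "W \<subseteq> class_space Q b" "U \<subseteq> class_space Q b"
    unfolding WU(2)[symmetric] using vec.subspace_0[OF W(1)] vec.subspace_0[OF U(1)] by force+
  have fW: "f j \<in> W" if "j \<in> S" for j
    unfolding BW(2)[symmetric] fS[symmetric] using that by (intro vec.span_base imageI)
  have fU': "f j \<in> U" if "j \<in> ?B - S" for j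
    unfolding BU(2)[symmetric] fU[symmetric] using that by (intro vec.span_base imageI)
  have bh: "block Q h"
    unfolding block_def
  proof (intro allI impI)
    fix i j assume ij: "\<not> Q i j"
    show "h $ i $ j = 0"
    proof (cases "Q b j")
      case True
      then have "f j \<in> class_space Q b" using fW[of j] fU'[of j] V0 by auto
      moreover have "\<not> Q b i" using True ij equivp_class[OF Q, of b i] by auto
      ultimately show ?thesis by (simp add: h_def class_space_def)
    next
      case False
      then show ?thesis using ij equivp_reflp[OF Q] by (auto simp: h_def f_def axis_def)
    qed
  qed
  have span: "axis i 1 \<in> vec.span (range f)" for i
  proof (cases "Q b i")
    case True
    then have "axis i (1 :: 'k) \<in> class_space Q b" by (auto simp: class_space_def axis_def)
    then obtain w u where wu: "axis i 1 = w + u" "w \<in> W" "u \<in> U" unfolding WU(2)[symmetric] by blast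
    have "W \<subseteq> vec.span (range f)" "U \<subseteq> vec.span (range f)"
      unfolding BW(2)[symmetric] BU(2)[symmetric] fS[symmetric] fU[symmetric] by (intro vec.span_mono image_mono subset_UNIV)+
    with wu show ?thesis by (auto intro: vec.span_add)
  next
    case False
    then show ?thesis by (intro vec.span_base) (auto simp: f_def image_iff intro!: exI[of _ i])
  qed
  have "\<exists>z. h *v z = axis i 1" for i
    using span_columns_support[OF span] unfolding h_def by blast
  then obtain z where z: "\<And>i. h *v z i = axis i 1" by metis
  define h' :: "'k^'n^'n" where "h' = (\<chi> i j. z j $ i)"
  have "(h ** h') $ i $ j = (h *v z j) $ i" for i j
    by (simp add: matrix_matrix_mult_def matrix_vector_mult_def h'_def)
  then have hh': "h ** h' = mat 1" by (simp add: z vec_eq_iff axis_def mat_nth)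
  then have h'h: "h' ** h = mat 1" by (rule matrix_right_inverse_comm)
  \<comment> \<open>Since \<open>S\<close> lies inside the class of \<open>b\<close>, only that
    class is cut in two; the cut is proper because neither \<open>W\<close> nor \<open>U\<close> is
    zero.\<close>
  define Q' where "Q' i j \<longleftrightarrow> Q i j \<and> (i \<in> S \<longleftrightarrow> j \<in> S)" for i j
  have Q': "equivp Q'"
  proof (intro equivpI reflpI sympI transpI)
    fix x y z
    show "Q' x x" by (simp add: Q'_def equivp_reflp[OF Q])
    show "Q' x y \<Longrightarrow> Q' y x" using equivp_symp[OF Q, of x y] by (simp add: Q'_def)
    show "Q' x y \<Longrightarrow> Q' y z \<Longrightarrow> Q' x z" using equivp_transp[OF Q, of x y z] by (simp add: Q'_def)
  qed
  have tr: "Q i j" if "Q b i" "Q b j" for i j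
    using equivp_class[OF Q that(1)] that(2) by simp
  have "Q' \<le> Q" by (auto simp: Q'_def)
  moreover have "Q' \<noteq> Q"
  proof -
    have "S \<noteq> {}" using pos(1) S(2) by auto
    moreover have "?B - S \<noteq> {}"
    proof
      assume e: "?B - S = {}"
      have "BU = {}" unfolding fU[symmetric] e by simp
      then show False using pos(2) by simp
    qed
    ultimately obtain i j where ij: "i \<in> S" "j \<in> ?B - S" by blast
    then have "Q i j" using S(1) tr by auto
    moreover have "\<not> Q' i j" using ij by (auto simp: Q'_def)
    ultimately show ?thesis by metis
  qed
  ultimately have "Q' < Q" by simp
  moreover have "block Q' (h' ** A ** h)"
    unfolding block_def
  proof (intro allI impI)
    fix i j assume ij: "\<not> Q' i j"
    have col: "(h' ** A ** h) $ i $ j = (h' *v (A *v f j)) $ i"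
      unfolding matrix_mul_assoc[symmetric]
      by (simp add: matrix_matrix_mult_def matrix_vector_mult_def h_def)
    have "A *v f j \<in> vec.span (f ` {i. Q' i j})"
    proof -
      consider "j \<in> S" | "j \<in> ?B - S" | "\<not> Q b j" by blast
      then show ?thesis
      proof cases
        case 1
        then have "S \<subseteq> {i. Q' i j}"
          using S(1) tr by (auto simp: Q'_def)
        then have "W \<subseteq> vec.span (f ` {i. Q' i j})"
          unfolding BW(2)[symmetric] fS[symmetric] by (intro vec.span_mono image_mono)
        then show ?thesis using W(3) fW[OF 1] by blast
      next
        case 2
        then have "?B - S \<subseteq> {i. Q' i j}"
          using tr by (auto simp: Q'_def)
        then have "U \<subseteq> vec.span (f ` {i. Q' i j})"
          unfolding BU(2)[symmetric] fU[symmetric] by (intro vec.span_mono image_mono)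
        then show ?thesis using U(3) fU'[OF 2] by blast
      next
        case 3
        have eq: "A *v f j = (\<Sum>i\<in>UNIV. (A *v f j) $ i *s axis i 1)" by (simp add: basis_expansion)
        have "(A *v f j) $ i *s axis i 1 \<in> vec.span (f ` {i. Q' i j})" for i
        proof (cases "Q i j")
          case True
          then have "\<not> Q b i" using 3 equivp_transp[OF Q, of b i j] by blast
          moreover have "j \<notin> S" "i \<notin> S" using 3 \<open>\<not> Q b i\<close> S(1) by auto
          ultimately have "axis i 1 \<in> f ` {i. Q' i j}" using True by (auto simp: f_def Q'_def image_iff)
          then show ?thesis by (intro vec.span_scale vec.span_base)
        next
          case False
          have "(A *v f j) $ i = A $ i $ j"
            using 3 by (simp add: f_def matrix_vector_mult_def axis_def if_distrib cong: if_cong)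
          also have "\<dots> = 0" using A False by (simp add: block_def)
          finally show ?thesis by (simp add: vec.span_zero)
        qed
        then show ?thesis by (subst eq) (intro vec.span_sum)
      qed
    qed
    then obtain y where y: "\<forall>i. i \<notin> {i. Q' i j} \<longrightarrow> y $ i = 0" "h *v y = A *v f j"
      using span_columns_support unfolding h_def by blast
    have "h' *v (A *v f j) = y" unfolding y(2)[symmetric] by (simp add: matrix_vector_mul_assoc h'h)
    then show "(h' ** A ** h) $ i $ j = 0" using y(1) ij col by simp
  qed
  ultimately show thesis using that Q' bh hh' h'h by blast
qed

text \<open>On every class \<open>A\<close> is a single nilpotent Jordan block with cyclic vector
  \<open>v\<close>. The conditions look at the coordinates of one class at a time, because the
  classes share \<open>v\<close> but may differ in size.\<close>

definition cyclic_nil :: "('n::finite \<Rightarrow> 'n \<Rightarrow> bool) \<Rightarrow> 'k::field^'n^'n \<Rightarrow> 'k^'n \<Rightarrow> bool" where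
  "cyclic_nil Q A v \<longleftrightarrow> block Q A \<and> (\<forall>i. (mat_power A (csize Q i) *v v) $ i = 0)
    \<and> (\<forall>b. \<exists>i. Q b i \<and> (mat_power A (csize Q b - 1) *v v) $ i \<noteq> 0)"

lemma cyclic_nilI:
  fixes A :: "'k::field^'n^'n::finite"
  assumes Q: "equivp Q" and A: "block Q A"
    and x: "\<And>b. \<exists>x. x \<in> class_space Q b \<and> mat_power A (csize Q b - 1) *v x \<noteq> 0 \<and> mat_power A (csize Q b) *v x = 0"
  shows "\<exists>v. cyclic_nil Q A v"
proof -
  define y where "y b = (SOME x. x \<in> class_space Q b \<and> mat_power A (csize Q b - 1) *v x \<noteq> 0
    \<and> mat_power A (csize Q b) *v x = 0)" for b
  have X: "y b \<in> class_space Q b" "mat_power A (csize Q b - 1) *v y b \<noteq> 0" "mat_power A (csize Q b) *v y b = 0" for b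
    using someI_ex[OF x[of b]] unfolding y_def by auto
  \<comment> \<open>The predicate depends on \<open>b\<close> through its class only, so the choice
    is constant on classes and the chosen vectors can be glued into one.\<close>
  have Xc: "y i = y b" if "Q b i" for b i
    using equivp_class[OF Q that] unfolding y_def class_space_def csize_def by simp
  define v where "v = (\<chi> i. y i $ i)"
  have loc: "(mat_power A k *v v) $ i = (mat_power A k *v y b) $ i" if "Q b i" for b i k
    by (rule block_power_local[OF Q A _ that]) (simp add: v_def Xc)
  have "(mat_power A (csize Q i) *v v) $ i = 0" for i
    using loc[OF equivp_reflp[OF Q]] X(3) by simp
  moreover have "\<exists>i. Q b i \<and> (mat_power A (csize Q b - 1) *v v) $ i \<noteq> 0" for b
  proof -
    obtain i where i: "(mat_power A (csize Q b - 1) *v y b) $ i \<noteq> 0"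
      using X(2)[of b] by (auto simp: vec_eq_iff)
    have "Q b i" using class_space_invariant[OF Q block_power[OF Q A] X(1)[of b]] i
      unfolding class_space_def by blast
    then show ?thesis using loc i by auto
  qed
  ultimately show ?thesis using A by (auto simp: cyclic_nil_def)
qed

text \<open>The Jordan decomposition, expressed by a finer relation \<open>Q\<close>. A class
  without a cyclic vector is split in two, and the induction runs on the number of related pairs,
  which drops with every split.\<close>

lemma nilpotent_cyclic_decomposition:
  fixes A :: "'k::field^'n^'n::finite"
  assumes "equivp P" "block P A" "mat_power A K = 0"
  shows "\<exists>Q h h' v. equivp Q \<and> Q \<le> P \<and> block P h \<and> h ** h' = mat 1 \<and> h' ** h = mat 1 \<and> cyclic_nil Q (h' ** A ** h) v"
  using assms
proof (induction "card {(i, j). P i j}" arbitrary: P A rule: less_induct)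
  case less
  note P = less.prems(1) and A = less.prems(2) and nil = less.prems(3)
  show ?case
  proof (cases "\<forall>b. \<exists>x. x \<in> class_space P b \<and> mat_power A (csize P b - 1) *v x \<noteq> 0 \<and> mat_power A (csize P b) *v x = 0")
    case True
    then obtain v where "cyclic_nil P A v" using cyclic_nilI[OF P A] by blast
    then show ?thesis using P
      by (intro exI[of _ P] exI[of _ "mat 1"] exI[of _ v]) (simp add: block_mat)
  next
    case False
    then obtain b where b: "\<not> (\<exists>x. x \<in> class_space P b \<and> mat_power A (csize P b - 1) *v x \<noteq> 0 \<and> mat_power A (csize P b) *v x = 0)"
      by blast
    obtain Q h h' where Q: "equivp Q" "Q < P" and h: "block P h" "h ** h' = mat 1" "h' ** h = mat 1"
      and bl: "block Q (h' ** A ** h)"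
    proof (cases rule: nilpotent_cyclic_or_split[OF P A nil, of b])
      case (1 x)
      with b have False by blast
      then show thesis ..
    next
      case (2 W U)
      show thesis
        by (rule split_block[OF P A 2(1,3,7) 2(2,4,8) 2(5,6)]) (use that in blast)+
    qed
    have "Q \<le> P" "Q \<noteq> P" using Q(2) by auto
    then have "{(i, j). Q i j} \<subset> {(i, j). P i j}" by (fastforce simp: fun_eq_iff le_fun_def)
    then have lt: "card {(i, j). Q i j} < card {(i, j). P i j}" by (intro psubset_card_mono) auto
    have "A ** h = h ** (h' ** A ** h)" by (simp add: matrix_mul_assoc h)
    then have "mat_power A K ** h = h ** mat_power (h' ** A ** h) K" by (rule mat_power_intertwine)
    then have "h' ** (h ** mat_power (h' ** A ** h) K) = 0" by (simp add: nil matrix_mult_zero)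
    then have "mat_power (h' ** A ** h) K = 0" by (simp add: matrix_mul_assoc h)
    from less.hyps[OF lt Q(1) bl this] obtain Q2 g g' v where IH: "equivp Q2" "Q2 \<le> Q" "block Q g"
      "g ** g' = mat 1" "g' ** g = mat 1" "cyclic_nil Q2 (g' ** (h' ** A ** h) ** g) v" by blast
    have "Q2 \<le> P" using IH(2) Q(2) by (meson le_less_trans less_imp_le)
    moreover have "block P (h ** g)" using block_mult[OF P h(1)] block_mono[OF IH(3)] Q(2) by simp
    moreover have "(h ** g) ** (g' ** h') = h ** (g ** g') ** h'" "(g' ** h') ** (h ** g) = g' ** (h' ** h) ** g"
      "(g' ** h') ** A ** (h ** g) = g' ** (h' ** A ** h) ** g"
      by (simp_all add: matrix_mul_assoc)
    ultimately show ?thesis using IH h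
      by (intro exI[of _ Q2] exI[of _ "h ** g"] exI[of _ "g' ** h'"] exI[of _ v]) simp
  qed
qed

lemma cyclic_nil_vanish:
  assumes Q: "equivp Q" and c: "cyclic_nil Q A v" and k: "csize Q i \<le> k"
  shows "(mat_power A k *v v) $ i = 0"
proof -
  have A: "block Q A" using c by (simp add: cyclic_nil_def)
  obtain d where d: "k = d + csize Q i" using k by (metis add.commute le_Suc_ex)
  have "(mat_power A (csize Q i) *v v) $ j = 0" if "Q i j" for j
    using c csize_class[OF Q that] by (simp add: cyclic_nil_def)
  then have "(mat_power A d *v (mat_power A (csize Q i) *v v)) $ i = (mat_power A d *v 0) $ i"
    by (intro block_power_local[OF Q A, of i]) (auto simp: equivp_reflp[OF Q])
  then show ?thesis by (simp add: d mat_power_add matrix_vector_mul_assoc)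
qed

lemma csize_pos: "equivp Q \<Longrightarrow> csize Q b > 0"
  using equivp_reflp[of Q b] by (auto simp: csize_def card_gt_0_iff)

text \<open>In a linear relation among the columns of a class of size \<open>m\<close>, the term of
  least position \<open>pos Q j\<close> is isolated by \<open>A^(m - 1 - pos Q j)\<close>: all other
  terms reach exponent \<open>m\<close> and vanish. What remains is a nonzero multiple of
  \<open>A^(m-1) v\<close>, which is nonzero somewhere on the class.\<close>

lemma cyclic_nil_krylov:
  fixes A :: "'k::field^'n^'n::finite"
  assumes Q: "equivp Q" and c: "cyclic_nil Q A v"
  shows "invertible (krylov Q A v)" and "A ** krylov Q A v = krylov Q A v ** companion Q (\<lambda>_ _. 0)"
proof -
  have A: "block Q A" using c by (simp add: cyclic_nil_def)
  let ?K = "krylov Q A v"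
  show "A ** ?K = ?K ** companion Q (\<lambda>_ _. 0)"
    by (rule krylov_companion[OF Q A])
      (use cyclic_nil_vanish[OF Q c] csize_class[OF Q] in auto)
  have ker: "z = 0" if z: "?K *v z = 0" for z
  proof (rule ccontr)
    assume "z \<noteq> 0"
    then obtain b where b: "z $ b \<noteq> 0" by (auto simp: vec_eq_iff)
    define j where "j = arg_min (pos Q) (\<lambda>l. Q b l \<and> z $ l \<noteq> 0)"
    have j: "Q b j" "z $ j \<noteq> 0" "\<And>l. Q b l \<Longrightarrow> z $ l \<noteq> 0 \<Longrightarrow> pos Q j \<le> pos Q l"
      using arg_min_natI[of "\<lambda>l. Q b l \<and> z $ l \<noteq> 0" b "pos Q"] arg_min_nat_le[of "\<lambda>l. Q b l \<and> z $ l \<noteq> 0" _ "pos Q"] b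
      by (auto simp: j_def equivp_reflp[OF Q])
    define w where "w = (\<Sum>l\<in>{l. Q b l}. z $ l *s (mat_power A (pos Q l) *v v))"
    have w0: "w $ i = 0" if i: "Q b i" for i
    proof -
      have "(?K *v z) $ i = (\<Sum>l\<in>{l. Q b l}. ?K $ i $ l * z $ l)"
        unfolding matrix_vector_mult_def vec_lambda_beta
        using equivp_class[OF Q i] by (intro sum.mono_neutral_right) (auto simp: krylov_def)
      also have "\<dots> = w $ i"
        unfolding w_def sum_component using equivp_class[OF Q i] by (intro sum.cong) (auto simp: krylov_def)
      finally show ?thesis using z by simp
    qed
    let ?m = "csize Q b" let ?t = "?m - 1 - pos Q j"
    have pj: "pos Q j < ?m" by (rule pos_less[OF Q j(1)])
    have "(mat_power A (?m - 1) *v v) $ i = 0" if i: "Q b i" for i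
    proof -
      have "(mat_power A ?t *v w) $ i = (mat_power A ?t *v 0) $ i"
        using w0 by (intro block_power_local[OF Q A _ i]) simp
      moreover have "mat_power A ?t *v w = (\<Sum>l\<in>{l. Q b l}. z $ l *s (mat_power A (?t + pos Q l) *v v))"
        unfolding w_def by (simp add: mat_vec_sum mat_vec_scale matrix_vector_mul_assoc mat_power_add)
      moreover have "(\<Sum>l\<in>{l. Q b l}. z $ l *s (mat_power A (?t + pos Q l) *v v)) $ i =
          (\<Sum>l\<in>{l. Q b l}. if l = j then z $ j * (mat_power A (?m - 1) *v v) $ i else 0)"
        unfolding sum_component
      proof (rule sum.cong)
        fix l assume "l \<in> {l. Q b l}"
        then have l: "Q b l" by simp
        consider "l = j" | "z $ l = 0" "l \<noteq> j" | "z $ l \<noteq> 0" "l \<noteq> j" by blast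
        then show "(z $ l *s (mat_power A (?t + pos Q l) *v v)) $ i =
            (if l = j then z $ j * (mat_power A (?m - 1) *v v) $ i else 0)"
        proof cases
          case 3
          have "Q j l" using l equivp_class[OF Q j(1)] by simp
          then have "pos Q j < pos Q l" using j(3)[OF l 3(1)] pos_inj[OF Q] 3(2) by (metis le_neq_implies_less)
          then have "?m \<le> ?t + pos Q l" using pj by linarith
          then have "(mat_power A (?t + pos Q l) *v v) $ i = 0"
            using cyclic_nil_vanish[OF Q c] csize_class[OF Q i] by simp
          with 3 show ?thesis by simp
        qed (use pj in auto)
      qed simp
      ultimately have "z $ j * (mat_power A (?m - 1) *v v) $ i = 0" using j(1) by simp
      then show ?thesis using j(2) by simp
    qed
    then show False using c unfolding cyclic_nil_def by blast
  qed
  have "\<exists>K'. K' ** ?K = mat 1"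
    unfolding matrix_left_invertible_ker by (intro allI impI) (rule ker)
  then obtain K' where "K' ** ?K = mat 1" ..
  then show "invertible ?K" by (rule invertible_left)
qed

lemma power_minus_one:
  fixes A :: "'a::comm_ring_1^'n^'n::finite"
  shows "mat_power (mat 1 + A) q - mat 1 = A ** (\<Sum>i<q. mat_power (mat 1 + A) i)"
proof (induction q)
  case 0
  then show ?case by (simp add: matrix_mult_zero)
next
  case (Suc q)
  have "mat_power (mat 1 + A) (Suc q) - mat 1 = A ** mat_power (mat 1 + A) q + (mat_power (mat 1 + A) q - mat 1)"
    by (simp add: mat_power_Suc matrix_add_rdistrib)
  then show ?case by (simp add: Suc matrix_add_ldistrib)
qed

text \<open>\<open>(1 + A)^q - 1 = A S\<close> where \<open>S\<close> commutes with
  \<open>A\<close>. The vector \<open>A^(m-1) v\<close>, with \<open>m\<close> the size of the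
  class, is killed by \<open>A\<close> on that class, so \<open>1 + A\<close> fixes it there and
  \<open>S\<close> multiplies it by \<open>q\<close>. Hence \<open>(A S)^(m-1) v\<close> is
  \<open>q^(m-1)\<close> times it, and the same \<open>v\<close> stays cyclic.\<close>

lemma cyclic_nil_power:
  fixes A :: "'k::field^'n^'n::finite"
  assumes Q: "equivp Q" and c: "cyclic_nil Q A v" and q: "of_nat q \<noteq> (0 :: 'k)"
  shows "cyclic_nil Q (mat_power (mat 1 + A) q - mat 1) v"
proof -
  have A: "block Q A" using c by (simp add: cyclic_nil_def)
  let ?g = "mat 1 + A"
  define S where "S = (\<Sum>i<q. mat_power ?g i)"
  have g: "block Q ?g" by (intro block_add block_mat Q A)
  have S: "block Q S" unfolding S_def by (intro block_sum block_power Q g)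
  have B: "mat_power ?g q - mat 1 = A ** S" unfolding S_def by (rule power_minus_one)
  have "?g ** A = A ** ?g" by (simp add: matrix_add_rdistrib matrix_add_ldistrib)
  then have AS: "A ** S = S ** A"
    unfolding S_def using mat_power_intertwine[of ?g A ?g]
    by (induction q) (simp_all add: matrix_mult_zero matrix_add_rdistrib matrix_add_ldistrib)
  have pw: "mat_power (A ** S) k = mat_power S k ** mat_power A k" for k
  proof (induction k)
    case (Suc k)
    have "mat_power (A ** S) (Suc k) = (S ** A) ** (mat_power S k ** mat_power A k)"
      unfolding AS[symmetric] by (simp only: mat_power_Suc Suc)
    then have "mat_power (A ** S) (Suc k) = S ** (A ** mat_power S k) ** mat_power A k"
      by (simp only: matrix_mul_assoc)
    also have "A ** mat_power S k = mat_power S k ** A"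
      using mat_power_intertwine[OF AS[symmetric], of k] by simp
    finally show ?case by (simp add: mat_power_Suc matrix_mul_assoc)
  qed simp
  have bS: "block Q (A ** S)" by (rule block_mult[OF Q A S])
  have "(mat_power (A ** S) (csize Q i) *v v) $ i = 0" for i
  proof -
    have "(mat_power S (csize Q i) *v (mat_power A (csize Q i) *v v)) $ i = (mat_power S (csize Q i) *v 0) $ i"
      using cyclic_nil_vanish[OF Q c] csize_class[OF Q]
      by (intro block_power_local[OF Q S, of i]) (auto simp: equivp_reflp[OF Q])
    then show ?thesis by (simp add: pw matrix_vector_mul_assoc)
  qed
  moreover have "\<exists>i. Q b i \<and> (mat_power (A ** S) (csize Q b - 1) *v v) $ i \<noteq> 0" for b
  proof -
    let ?y = "mat_power A (csize Q b - 1) *v v"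
    have Ay: "(A *v ?y) $ i = (0 *v ?y) $ i" if "Q b i" for i
      using cyclic_nil_vanish[OF Q c, of i "csize Q b"] csize_class[OF Q that] csize_pos[OF Q, of b]
      by (simp add: mat_power_vec_Suc[symmetric])
    have gy: "(mat_power ?g k *v ?y) $ i = ?y $ i" if "Q b i" for k i
      using that
    proof (induction k arbitrary: i)
      case (Suc k)
      have "(mat_power ?g (Suc k) *v ?y) $ i = (?g *v ?y) $ i"
        unfolding mat_power_vec_Suc by (rule block_local[OF Q g Suc.IH Suc.prems])
      then show ?case using Ay[OF Suc.prems] by (simp add: matrix_vector_mult_add_rdistrib)
    qed simp
    have "S *v ?y = (\<Sum>i<q. mat_power ?g i *v ?y)"
      unfolding S_def by (induction q) (auto simp: matrix_vector_mult_add_rdistrib)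
    then have Sy: "(S *v ?y) $ i = (of_nat q *s ?y) $ i" if "Q b i" for i
      using gy[OF that] by (simp add: sum_component)
    have SSy: "(mat_power S k *v ?y) $ i = (of_nat q ^ k *s ?y) $ i" if "Q b i" for i k
      using that
    proof (induction k arbitrary: i)
      case (Suc k)
      have "(mat_power S (Suc k) *v ?y) $ i = (S *v (of_nat q ^ k *s ?y)) $ i"
        unfolding mat_power_vec_Suc by (rule block_local[OF Q S Suc.IH Suc.prems])
      then show ?case using Sy[OF Suc.prems] by (simp add: mat_vec_scale)
    qed simp
    obtain i where i: "Q b i" "?y $ i \<noteq> 0" using c unfolding cyclic_nil_def by blast
    have "(mat_power (A ** S) (csize Q b - 1) *v v) $ i = of_nat q ^ (csize Q b - 1) * ?y $ i"
      using SSy[OF i(1)] by (simp add: pw matrix_vector_mul_assoc[symmetric])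
    then show ?thesis using i q by (intro exI[of _ i]) simp
  qed
  ultimately show ?thesis unfolding cyclic_nil_def B using bS by blast
qed

text \<open>The Krylov matrices of \<open>A\<close> and of \<open>(1 + A)^q - 1\<close> at the same
  \<open>v\<close> both intertwine with the nilpotent companion matrix, so their quotient conjugates
  one into the other. It is block-diagonal for \<open>Q\<close>, hence stays in the smaller Levi
  subgroup.\<close>

lemma unipotent_power_conj:
  fixes A :: "'k::field^'n^'n::finite"
  assumes Q: "equivp Q" and c: "cyclic_nil Q A v" and q: "of_nat q \<noteq> (0 :: 'k)"
  obtains t where "block Q t" "invertible t" "t ** (mat 1 + A) = mat_power (mat 1 + A) q ** t"
proof -
  let ?B = "mat_power (mat 1 + A) q - mat 1"
  let ?K = "krylov Q A v" and ?L = "krylov Q ?B v" and ?N = "companion Q (\<lambda>_ _. 0) :: 'k^'n^'n"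
  note K = cyclic_nil_krylov[OF Q c] and L = cyclic_nil_krylov[OF Q cyclic_nil_power[OF Q c q]]
  obtain K' where K': "?K ** K' = mat 1" "K' ** ?K = mat 1" using K(1) by (auto simp: invertible_def)
  have bK': "block Q K'" by (rule block_inverse[OF Q block_krylov K'])
  let ?t = "?L ** K'"
  have "K' ** A ** ?K ** K' = K' ** ?K ** ?N ** K'"
    using K(2) by (simp add: matrix_mul_assoc[symmetric])
  then have "K' ** A = ?N ** K'"
    by (simp add: K' matrix_mul_assoc[symmetric])
  then have "?t ** A = ?L ** ?N ** K'" by (simp add: matrix_mul_assoc[symmetric])
  also have "\<dots> = ?B ** ?t" unfolding L(2)[symmetric] by (simp add: matrix_mul_assoc)
  finally have "?t ** (mat 1 + A) = mat_power (mat 1 + A) q ** ?t"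
    by (simp add: matrix_add_ldistrib matrix_diff_rdistrib)
  moreover have "invertible ?t"
    using invertible_mult[OF L(1)] K' by (auto simp: invertible_def)
  moreover have "block Q ?t" by (intro block_mult Q block_krylov bK')
  ultimately show thesis using that by blast
qed

text \<open>By the binomial theorem, passing from powers of \<open>A\<close> to powers of
  \<open>1 + A\<close> multiplies the Krylov matrix by a Pascal matrix, which is
  unitriangular.\<close>

lemma krylov_shift:
  fixes A :: "'a::comm_ring_1^'n^'n::finite"
  assumes Q: "equivp Q" and inv: "invertible (krylov Q A v)"
  shows "invertible (krylov Q (mat 1 + A) v)"
proof -
  define T :: "'a^'n^'n" where "T = (\<chi> i j. if Q i j then of_nat (pos Q j choose pos Q i) else 0)"
  \<comment> \<open>The bound \<open>m\<close> is free, the extra binomial coefficients being zero,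
    so that the size of the class serves for all columns.\<close>
  have binom: "mat_power (mat 1 + A) k *v v = (\<Sum>i<m. of_nat (k choose i) *s (mat_power A i *v v))" if "k < m" for k m
    using that
  proof (induction k)
    case 0
    have "(\<Sum>i<m. of_nat (0 choose i) *s (mat_power A i *v v)) = (\<Sum>i<m. if i = 0 then v else 0)"
      by (rule sum.cong) (auto simp: binomial_eq_0)
    then show ?case using 0 by simp
  next
    case (Suc k)
    then obtain n where n: "m = Suc n" "k < n" by (cases m) auto
    let ?v = "\<lambda>i. mat_power A i *v v"
    have "mat_power (mat 1 + A) (Suc k) *v v =
        (\<Sum>i<m. of_nat (k choose i) *s ?v i) + (\<Sum>i<m. of_nat (k choose i) *s ?v (Suc i))"
      using Suc by (simp add: mat_power_vec_Suc matrix_vector_mult_add_rdistrib mat_vec_sum mat_vec_scale sum.distrib)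
    also have "(\<Sum>i<m. of_nat (k choose i) *s ?v (Suc i)) = (\<Sum>i<n. of_nat (k choose i) *s ?v (Suc i))"
      using n by (simp add: binomial_eq_0)
    also have "(\<Sum>i<m. of_nat (k choose i) *s ?v i) = v + (\<Sum>i<n. of_nat (k choose Suc i) *s ?v (Suc i))"
      unfolding n(1) sum.lessThan_Suc_shift by simp
    also have "v + (\<Sum>i<n. of_nat (k choose Suc i) *s ?v (Suc i)) + (\<Sum>i<n. of_nat (k choose i) *s ?v (Suc i))
        = v + (\<Sum>i<n. of_nat (Suc k choose Suc i) *s ?v (Suc i))"
      by (simp add: sum.distrib[symmetric] vector_sadd_rdistrib add.commute)
    also have "\<dots> = (\<Sum>i<m. of_nat (Suc k choose i) *s ?v i)"
      unfolding n(1) sum.lessThan_Suc_shift by simp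
    finally show ?case .
  qed
  have "krylov Q (mat 1 + A) v = krylov Q A v ** T"
  proof -
    have "krylov Q (mat 1 + A) v $ i $ j = (krylov Q A v ** T) $ i $ j" for i j
    proof (cases "Q i j")
      case True
      have "(krylov Q A v ** T) $ i $ j = (\<Sum>l\<in>{l. Q i l}. krylov Q A v $ i $ l * T $ l $ j)"
        unfolding matrix_matrix_mult_def vec_lambda_beta
        by (intro sum.mono_neutral_right) (auto simp: krylov_def)
      also have "\<dots> = (\<Sum>l\<in>{l. Q i l}. of_nat (pos Q j choose pos Q l) * (mat_power A (pos Q l) *v v) $ i)"
      proof (rule sum.cong)
        fix l assume "l \<in> {l. Q i l}"
        moreover from this have "Q l j" using True equivp_class[OF Q] by (metis mem_Collect_eq)
        ultimately show "krylov Q A v $ i $ l * T $ l $ j = of_nat (pos Q j choose pos Q l) * (mat_power A (pos Q l) *v v) $ i"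
          by (simp add: krylov_def T_def mult.commute)
      qed simp
      also have "\<dots> = (\<Sum>k<csize Q i. of_nat (pos Q j choose k) * (mat_power A k *v v) $ i)"
        by (rule sum_class_pos[OF Q])
      also have "\<dots> = (mat_power (mat 1 + A) (pos Q j) *v v) $ i"
        by (simp add: binom[OF pos_less[OF Q True]] sum_component)
      finally show ?thesis using True by (simp add: krylov_def)
    next
      case False
      have "block Q T" by (simp add: block_def T_def)
      then have "block Q (krylov Q A v ** T)" by (intro block_mult Q block_krylov)
      then show ?thesis using False by (simp add: block_def krylov_def)
    qed
    then show ?thesis by (simp add: vec_eq_iff)
  qed
  moreover have "invertible T"
  proof (rule invertible_det_one)
    have "det T = (\<Prod>i\<in>UNIV. T $ i $ i)"
    proof (rule det_triangular[of _ "\<lambda>i. - int (pos Q i)"])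
      fix i j assume "T $ i $ j \<noteq> 0"
      then have "Q i j" "pos Q i \<le> pos Q j"
        by (auto simp: T_def split: if_splits) (metis binomial_eq_0 not_le of_nat_0)
      then show "i = j \<or> - int (pos Q j) < - int (pos Q i)" using pos_inj[OF Q, of i j] by auto
    qed
    then show "det T = 1" by (simp add: T_def equivp_reflp[OF Q])
  qed
  ultimately show ?thesis using invertible_mult[OF inv] by simp
qed

section \<open>Homomorphisms from the tame Weil group\<close>

context group
begin

lemma pow_cong:
  assumes s: "s \<in> carrier G" and n: "s [^] int n = \<one>" and ab: "[a = b] (mod int n)"
  shows "s [^] a = s [^] b"
proof -
  obtain k where b: "b = a + int n * k" using ab by (metis cong_iff_lin)
  have "s [^] b = s [^] a \<otimes> (s [^] int n) [^] k"
    unfolding b using s by (simp add: int_pow_mult int_pow_pow)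
  then show ?thesis using s n by simp
qed

text \<open>The exponent \<open>r\<close> is kept general to serve both \<open>t\<close>, with
  \<open>r = q\<close>, and the inverse of \<open>t\<close>, with \<open>r\<close> an inverse of
  \<open>q\<close> modulo the order of \<open>s\<close>.\<close>

lemma intertwine_pow:
  assumes s: "s \<in> carrier G" and t: "t \<in> carrier G"
    and st: "\<And>y :: int. t \<otimes> s [^] y = s [^] (r * y) \<otimes> t"
  shows "t [^] (m :: nat) \<otimes> s [^] (y :: int) = s [^] (r ^ m * y) \<otimes> t [^] m"
proof (induction m arbitrary: y)
  case 0
  then show ?case using s by simp
next
  case (Suc m)
  have "t [^] Suc m \<otimes> s [^] y = t [^] m \<otimes> (t \<otimes> s [^] y)" using s t by (simp add: m_assoc)
  also have "\<dots> = (t [^] m \<otimes> s [^] (r * y)) \<otimes> t" using s t by (simp add: st m_assoc)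
  also have "\<dots> = s [^] (r ^ m * (r * y)) \<otimes> t [^] Suc m" unfolding Suc using s t by (simp add: m_assoc)
  finally show ?case by (simp add: mult.assoc mult.left_commute)
qed

lemma tame_relation_pow:
  assumes s: "s \<in> carrier G" and t: "t \<in> carrier G" and ts: "t \<otimes> s = s [^] q \<otimes> t"
    and n: "s [^] n = \<one>" "n > 0" "coprime n q"
  shows "t [^] (a :: int) \<otimes> s [^] (y :: int) = s [^] (qpow q n a * y) \<otimes> t [^] a"
proof -
  let ?u = "modular_inverse (int n) (int q)"
  have n': "s [^] int n = \<one>" using n by (simp add: int_pow_int)
  have nat: "t \<otimes> s [^] (k :: nat) = s [^] (q * k) \<otimes> t" for k
  proof (induction k)
    case 0
    then show ?case using t by simp
  next
    case (Suc k)
    have "t \<otimes> s [^] Suc k = (t \<otimes> s [^] k) \<otimes> s" using s t by (simp add: m_assoc)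
    also have "\<dots> = s [^] (q * k) \<otimes> (s [^] q \<otimes> t)" unfolding Suc using s t by (simp add: m_assoc ts)
    also have "\<dots> = s [^] (q * k + q) \<otimes> t" using s t by (simp add: m_assoc[symmetric] nat_pow_mult)
    finally show ?case by (simp add: add.commute)
  qed
  have pos: "t \<otimes> s [^] (y :: int) = s [^] (int q * y) \<otimes> t" for y
  proof -
    let ?k = "nat (y mod int n)"
    have k: "int ?k = y mod int n" using n(2) by simp
    have "s [^] y = s [^] ?k"
    proof -
      have "s [^] y = s [^] int ?k" by (rule pow_cong[OF s n']) (simp only: k Cong.cong_def mod_mod_trivial)
      then show ?thesis by (simp only: int_pow_int)
    qed
    moreover have "s [^] (int q * y) = s [^] (int (q * ?k))"
      by (rule pow_cong[OF s n']) (simp only: k Cong.cong_def of_nat_mult mod_mult_right_eq)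
    ultimately show ?thesis using nat[of ?k] by (simp only: int_pow_int)
  qed
  \<comment> \<open>Conjugation by the inverse of \<open>t\<close> raises to the power
    \<open>?u\<close>, which inverts \<open>q\<close> modulo \<open>n\<close>; here \<open>n\<close>
    being prime to \<open>q\<close> enters.\<close>
  have neg: "inv t \<otimes> s [^] (y :: int) = s [^] (?u * y) \<otimes> inv t" for y
  proof -
    have "[?u * int q = 1] (mod int n)"
      using n by (intro cong_modular_inverse2) (simp add: coprime_commute)
    then have "[int q * (?u * y) = y] (mod int n)"
      using cong_mult[of "?u * int q" 1 "int n" y y] by (simp add: mult.assoc mult.left_commute)
    then have "t \<otimes> s [^] (?u * y) = s [^] y \<otimes> t"
      unfolding pos using pow_cong[OF s n'] by simp
    then have "inv t \<otimes> (t \<otimes> s [^] (?u * y)) \<otimes> inv t = inv t \<otimes> (s [^] y \<otimes> t) \<otimes> inv t" by simp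
    then show ?thesis using s t by (simp add: m_assoc inv_solve_left) (simp add: m_assoc[symmetric])
  qed
  show ?thesis
  proof (cases "0 \<le> a")
    case True
    then obtain m where a: "a = int m" using nonneg_int_cases by blast
    show ?thesis unfolding a int_pow_int using intertwine_pow[OF s t pos] by (simp add: qpow_def)
  next
    case False
    then obtain m where a: "a = - int m" "m > 0" by (metis neg_int_cases not_le)
    have "t [^] a = inv t [^] m" unfolding a using t by (simp add: int_pow_neg_int nat_pow_inv)
    then show ?thesis using intertwine_pow[OF s inv_closed[OF t] neg, of m] a by (simp add: qpow_def)
  qed
qed

end

text \<open>Since \<open>s^n = 1\<close> with \<open>n\<close> prime to \<open>p\<close>, a power
  \<open>s^x\<close> with \<open>x\<close> in inertia depends on the residue \<open>x n\<close>
  alone. So \<open>\<sigma>^x \<phi>^a\<close> can be sent to \<open>s^(x n) t^a\<close>, and this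
  is continuous because it factors through the discrete pair \<open>(x n, a)\<close>.\<close>

lemma tame_hom_exists:
  assumes H: "group H" and p: "prime p" and q: "q = p ^ d"
    and s: "s \<in> carrier H" and t: "t \<in> carrier H"
    and ts: "t \<otimes>\<^bsub>H\<^esub> s = s [^]\<^bsub>H\<^esub> q \<otimes>\<^bsub>H\<^esub> t"
    and n: "n \<in> levels p" "s [^]\<^bsub>H\<^esub> n = \<one>\<^bsub>H\<^esub>"
  obtains \<rho> where "\<rho> \<in> cont_homs p q H" "\<rho> (tame_sigma p) = s" "\<rho> tame_phi = t"
proof -
  interpret group H by (rule H)
  have n0: "n > 0" "coprime n q" using n(1) p q by (auto simp: levels_def)
  have n': "s [^]\<^bsub>H\<^esub> int n = \<one>\<^bsub>H\<^esub>" using n by (simp add: int_pow_int)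
  let ?f = "\<lambda>(k, a :: int). s [^]\<^bsub>H\<^esub> (k :: int) \<otimes>\<^bsub>H\<^esub> t [^]\<^bsub>H\<^esub> a"
  define \<rho> :: "tame \<Rightarrow> _" where "\<rho> v = ?f (fst v n, snd v)" for v
  have "\<rho> \<in> hom (tame_weil p q) H"
  proof (rule homI)
    fix v assume "v \<in> carrier (tame_weil p q)"
    show "\<rho> v \<in> carrier H" using s t by (simp add: \<rho>_def)
  next
    fix v w assume "v \<in> carrier (tame_weil p q)" "w \<in> carrier (tame_weil p q)"
    let ?x = "fst v n" and ?y = "fst w n" and ?a = "snd v" and ?b = "snd w"
    have "s [^]\<^bsub>H\<^esub> ((?x + qpow q n ?a * ?y) mod int n) = s [^]\<^bsub>H\<^esub> (?x + qpow q n ?a * ?y)"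
      by (rule pow_cong[OF s n']) (simp add: Cong.cong_def)
    then have "\<rho> (v \<otimes>\<^bsub>tame_weil p q\<^esub> w) =
        s [^]\<^bsub>H\<^esub> ?x \<otimes>\<^bsub>H\<^esub> (s [^]\<^bsub>H\<^esub> (qpow q n ?a * ?y) \<otimes>\<^bsub>H\<^esub> t [^]\<^bsub>H\<^esub> ?a) \<otimes>\<^bsub>H\<^esub> t [^]\<^bsub>H\<^esub> ?b"
      using s t n(1) by (simp add: \<rho>_def tame_weil_def tame_mult_def int_pow_mult m_assoc)
    also have "\<dots> = \<rho> v \<otimes>\<^bsub>H\<^esub> \<rho> w"
      unfolding tame_relation_pow[OF s t ts n(2) n0, symmetric]
      using s t by (simp add: \<rho>_def m_assoc)
    finally show "\<rho> (v \<otimes>\<^bsub>tame_weil p q\<^esub> w) = \<rho> v \<otimes>\<^bsub>H\<^esub> \<rho> w" .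
  qed
  moreover have "continuous_map (tame_topology p q) (discrete_topology (carrier H)) \<rho>"
  proof -
    let ?D = "discrete_topology UNIV :: int topology"
    let ?T = "prod_topology (product_topology (\<lambda>_ :: nat. ?D) UNIV) ?D"
    have 1: "continuous_map ?T ?D (\<lambda>v. fst v n)"
      using continuous_map_compose[OF continuous_map_fst continuous_map_product_projection[of n UNIV "\<lambda>_. ?D"]]
      by (simp add: o_def)
    have "continuous_map ?T (prod_topology ?D ?D) (\<lambda>v. (fst v n, snd v))"
      by (intro continuous_map_pairedI 1 continuous_map_snd)
    moreover have "continuous_map (prod_topology ?D ?D) (discrete_topology (carrier H)) ?f"
      using s t by (auto simp: prod_topology_discrete_topology[symmetric] continuous_map_def)
    ultimately have "continuous_map ?T (discrete_topology (carrier H)) (?f \<circ> (\<lambda>v. (fst v n, snd v)))"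
      by (rule continuous_map_compose)
    then have "continuous_map ?T (discrete_topology (carrier H)) \<rho>"
      by (simp add: \<rho>_def[abs_def] o_def)
    then show ?thesis unfolding tame_topology_def by (rule continuous_map_from_subtopology)
  qed
  ultimately have "\<rho> \<in> cont_homs p q H" by (simp add: cont_homs_def)
  moreover have "\<rho> (tame_sigma p) = s"
    using pow_cong[OF s n', of "1 mod int n" 1] n s by (simp add: \<rho>_def tame_sigma_def Cong.cong_def)
  moreover have "\<rho> tame_phi = t" using t by (simp add: \<rho>_def tame_phi_def)
  ultimately show thesis by (rule that)
qed

lemma levels_mult: "m \<in> levels p \<Longrightarrow> n \<in> levels p \<Longrightarrow> m * n \<in> levels p"
  by (auto simp: levels_def)

lemma levels_prod: "(\<And>i. i \<in> I \<Longrightarrow> f i \<in> levels p) \<Longrightarrow> prod f I \<in> levels p"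
  by (induction I rule: infinite_finite_induct) (auto intro: levels_mult, auto simp: levels_def)

text \<open>The kernel is open, so it contains all inertia elements with vanishing residue at some
  level \<open>n\<close>. The conclusions are given for all multiples of \<open>n\<close>, which
  lets two homomorphisms be compared at a common level.\<close>

lemma cont_hom_inertia:
  assumes H: "group H" and p: "prime p" and q: "q = p ^ d" and \<rho>: "\<rho> \<in> cont_homs p q H"
  obtains n where "n \<in> levels p"
    "\<And>m. m \<in> levels p \<Longrightarrow> n dvd m \<Longrightarrow> \<rho> (tame_sigma p) [^]\<^bsub>H\<^esub> m = \<one>\<^bsub>H\<^esub>"
    "\<And>m x. m \<in> levels p \<Longrightarrow> n dvd m \<Longrightarrow> x \<in> Zhat_prime_to p \<Longrightarrow>
       \<rho> (x, 0) = \<rho> (tame_sigma p) [^]\<^bsub>H\<^esub> nat (x m)"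
proof -
  let ?W = "tame_weil p q" and ?D = "discrete_topology UNIV :: int topology"
  let ?T = "prod_topology (product_topology (\<lambda>_ :: nat. ?D) UNIV) ?D"
  interpret H: group H by (rule H)
  interpret W: group ?W by (rule group_tame_weil[OF p q])
  interpret r: group_hom ?W H \<rho>
    using \<rho> by unfold_locales (auto simp: cont_homs_def)
  have pow: "\<rho> (v [^]\<^bsub>?W\<^esub> k) = \<rho> v [^]\<^bsub>H\<^esub> (k :: nat)" if "v \<in> carrier ?W" for v k
    using r.hom_nat_pow[OF that] .
  have one: "\<one>\<^bsub>?W\<^esub> = (\<lambda>_. 0, 0)" by (simp add: tame_weil_def)
  have cont: "continuous_map (tame_topology p q) (discrete_topology (carrier H)) \<rho>"
    using \<rho> by (simp add: cont_homs_def)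
  have top: "topspace (tame_topology p q) = carrier ?W"
    by (auto simp: tame_topology_def tame_weil_def)
  have "openin (tame_topology p q) {v \<in> carrier ?W. \<rho> v \<in> {\<one>\<^bsub>H\<^esub>}}"
    using openin_continuous_map_preimage[OF cont, of "{\<one>\<^bsub>H\<^esub>}"] unfolding top by simp
  then obtain T where T: "openin ?T T" "{v \<in> carrier ?W. \<rho> v \<in> {\<one>\<^bsub>H\<^esub>}} = T \<inter> carrier ?W"
    unfolding tame_topology_def openin_subtopology by blast
  have "(\<lambda>_. 0, 0) \<in> T" using T(2) W.one_closed r.hom_one unfolding one by blast
  then obtain A B where A: "openin (product_topology (\<lambda>_ :: nat. ?D) UNIV) A" "(\<lambda>_. 0) \<in> A" "0 \<in> B" "A \<times> B \<subseteq> T"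
    using T(1) unfolding openin_prod_topology_alt by blast
  obtain U where U: "finite {i. U i \<noteq> UNIV}" "(\<lambda>_. 0) \<in> PiE UNIV U" "PiE UNIV U \<subseteq> A"
    using A(1,2) unfolding openin_product_topology_alt by fastforce
  \<comment> \<open>A basic neighbourhood of the identity constrains finitely many residues. Those
    outside \<open>levels p\<close> vanish anyway, and a zero residue at the product of the others
    forces each of them to be zero.\<close>
  define n where "n = (\<Prod>i\<in>{i. U i \<noteq> UNIV} \<inter> levels p. i)"
  have n: "n \<in> levels p" unfolding n_def by (rule levels_prod) auto
  have ker: "\<rho> (x, 0) = \<one>\<^bsub>H\<^esub>" if x: "x \<in> Zhat_prime_to p" "x n = 0" for x
  proof -
    have "x i \<in> U i" for i
    proof (cases "U i = UNIV")
      case False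
      have "x i = 0"
      proof (cases "i \<in> levels p")
        case True
        then have "i dvd n" unfolding n_def using False U(1) by (intro dvd_prodI) auto
        then have "x n mod int i = x i" using x(1) n unfolding Zhat_prime_to_def by blast
        then show ?thesis using x(2) by simp
      next
        case False
        then show ?thesis using x(1) by (simp add: Zhat_prime_to_def)
      qed
      then show ?thesis using U(2) by (auto simp: PiE_def Pi_def)
    qed simp
    then have "(x, 0) \<in> T" using U(3) A(3,4) by (auto simp: PiE_def Pi_def subset_iff)
    then show ?thesis using T(2) x(1) by (auto simp: tame_weil_def)
  qed
  have shift: "(\<lambda>i. if i \<in> levels p then (x i - k) mod int i else 0) \<in> Zhat_prime_to p"
    if "x \<in> Zhat_prime_to p" for x k
  proof (rule Zhat_prime_toI)
    fix n m assume "n \<in> levels p" "m dvd n"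
    then have "x m = x n mod int m" using that by (auto simp: Zhat_prime_to_def)
    then show "(x n - k) mod int m = (x m - k) mod int m" by (simp add: mod_diff_left_eq)
  qed
  \<comment> \<open>Dividing by \<open>\<sigma>^k\<close> leaves an element with zero residue at
    \<open>n\<close>, which lies in the kernel. As \<open>k\<close> matters only modulo
    \<open>n\<close>, taking \<open>x = 0\<close> also gives the order of the generator.\<close>
  have gen: "\<rho> (x, 0) = \<rho> (tame_sigma p) [^]\<^bsub>H\<^esub> k"
    if x: "x \<in> Zhat_prime_to p" and k: "x n mod int n = int k mod int n" for x k
  proof -
    let ?y = "\<lambda>i. if i \<in> levels p then (x i - int k) mod int i else 0"
    have "x i mod int i = x i" if "i \<in> levels p" for i
      using x that by (auto simp: Zhat_prime_to_def)
    then have "(x, 0) = (?y, 0) \<otimes>\<^bsub>?W\<^esub> (tame_sigma p [^]\<^bsub>?W\<^esub> k)"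
      using x unfolding sigma_pow
      by (auto simp: tame_weil_def tame_mult_def qpow_def fun_eq_iff Zhat_prime_to_def mod_simps)
    moreover have "(?y, 0) \<in> carrier ?W" using shift[OF x] by (simp add: tame_weil_def)
    ultimately have "\<rho> (x, 0) = \<rho> (?y, 0) \<otimes>\<^bsub>H\<^esub> \<rho> (tame_sigma p) [^]\<^bsub>H\<^esub> k"
      using r.hom_mult[of "(?y, 0)" "tame_sigma p [^]\<^bsub>?W\<^esub> k"] sigma_in_carrier[of p q]
      by (simp only: pow W.nat_pow_closed)
    moreover have "?y n = 0" using k n by (simp add: mod_eq_dvd_iff)
    then have "\<rho> (?y, 0) = \<one>\<^bsub>H\<^esub>" by (rule ker[OF shift[OF x]])
    ultimately show ?thesis using r.hom_closed[OF sigma_in_carrier] by simp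
  qed
  show thesis
  proof (rule that[OF n])
    fix m assume m: "m \<in> levels p" "n dvd m"
    have "(\<lambda>_. 0) \<in> Zhat_prime_to p" using W.one_closed by (simp add: one) (simp add: tame_weil_def)
    then have "\<rho> (\<lambda>_. 0, 0) = \<rho> (tame_sigma p) [^]\<^bsub>H\<^esub> m" by (rule gen) (use m in auto)
    then show "\<rho> (tame_sigma p) [^]\<^bsub>H\<^esub> m = \<one>\<^bsub>H\<^esub>" using r.hom_one by (simp add: one)
  next
    fix m x assume m: "m \<in> levels p" "n dvd m" and x: "x \<in> Zhat_prime_to p"
    have "x m \<ge> 0" "x m mod int n = x n" "x n mod int n = x n"
      using x m n by (auto simp: Zhat_prime_to_def)
    then show "\<rho> (x, 0) = \<rho> (tame_sigma p) [^]\<^bsub>H\<^esub> nat (x m)" by (intro gen x) simp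
  qed
qed

text \<open>On inertia both homomorphisms are powers of their value at the generator, at the common
  level \<open>n * n'\<close>; on powers of \<open>tame_phi\<close> they agree by induction in both
  directions.\<close>

lemma cont_hom_unique:
  assumes H: "group H" and p: "prime p" and q: "q = p ^ d"
    and \<rho>: "\<rho> \<in> cont_homs p q H" "\<rho>' \<in> cont_homs p q H"
    and eq: "\<rho> (tame_sigma p) = \<rho>' (tame_sigma p)" "\<rho> tame_phi = \<rho>' tame_phi"
    and v: "v \<in> carrier (tame_weil p q)"
  shows "\<rho> v = \<rho>' v"
proof -
  let ?W = "tame_weil p q"
  interpret H: group H by (rule H)
  interpret W: group ?W by (rule group_tame_weil[OF p q])
  interpret r: group_hom ?W H \<rho> using \<rho> by unfold_locales (auto simp: cont_homs_def)
  interpret r': group_hom ?W H \<rho>' using \<rho> by unfold_locales (auto simp: cont_homs_def)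
  have z: "(\<lambda>_. 0) \<in> Zhat_prime_to p" by (auto simp: Zhat_prime_to_def levels_def)
  have fr: "((\<lambda>_. 0), a) \<in> carrier ?W" for a using z by (simp add: tame_weil_def)
  have add: "((\<lambda>_. 0), a + 1) = ((\<lambda>_. 0), a) \<otimes>\<^bsub>?W\<^esub> tame_phi" for a
    by (auto simp: tame_weil_def tame_mult_def tame_phi_def)
  have step: "\<rho> (\<lambda>_. 0, a + 1) = \<rho> (\<lambda>_. 0, a) \<otimes>\<^bsub>H\<^esub> \<rho> tame_phi"
    "\<rho>' (\<lambda>_. 0, a + 1) = \<rho>' (\<lambda>_. 0, a) \<otimes>\<^bsub>H\<^esub> \<rho>' tame_phi" for a
    unfolding add using fr phi_in_carrier by simp_all
  have phi: "\<rho> (\<lambda>_. 0, a) = \<rho>' (\<lambda>_. 0, a)" for a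
  proof (induction a rule: int_induct[of _ 0])
    case base
    have "\<rho> \<one>\<^bsub>?W\<^esub> = \<rho>' \<one>\<^bsub>?W\<^esub>" by simp
    then show ?case by (simp add: tame_weil_def)
  next
    case (step1 i)
    then show ?case by (simp add: step eq)
  next
    case (step2 i)
    have "\<rho> (\<lambda>_. 0, i - 1) \<otimes>\<^bsub>H\<^esub> \<rho> tame_phi = \<rho>' (\<lambda>_. 0, i - 1) \<otimes>\<^bsub>H\<^esub> \<rho> tame_phi"
      using step2 step[of "i - 1"] by (simp add: eq)
    then show ?case using fr phi_in_carrier by simp
  qed
  obtain n where n: "n \<in> levels p" "\<And>m x. m \<in> levels p \<Longrightarrow> n dvd m \<Longrightarrow> x \<in> Zhat_prime_to p \<Longrightarrow>
       \<rho> (x, 0) = \<rho> (tame_sigma p) [^]\<^bsub>H\<^esub> nat (x m)"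
    using cont_hom_inertia[OF H p q \<rho>(1)] by metis
  obtain n' where n': "n' \<in> levels p" "\<And>m x. m \<in> levels p \<Longrightarrow> n' dvd m \<Longrightarrow> x \<in> Zhat_prime_to p \<Longrightarrow>
       \<rho>' (x, 0) = \<rho>' (tame_sigma p) [^]\<^bsub>H\<^esub> nat (x m)"
    using cont_hom_inertia[OF H p q \<rho>(2)] by metis
  obtain x a where v': "v = (x, a)" "x \<in> Zhat_prime_to p" using v by (auto simp: tame_weil_def)
  have x0: "(x, 0) \<in> carrier ?W" using v' by (simp add: tame_weil_def)
  have "v = (x, 0) \<otimes>\<^bsub>?W\<^esub> (\<lambda>_. 0, a)"
    using v' by (auto simp: tame_weil_def tame_mult_def Zhat_prime_to_def fun_eq_iff)
  moreover have "\<rho> (x, 0) = \<rho>' (x, 0)"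
    using n(2)[OF levels_mult[OF n(1) n'(1)] _ v'(2)] n'(2)[OF levels_mult[OF n(1) n'(1)] _ v'(2)] eq by simp
  ultimately show ?thesis using phi[of a] x0 fr by simp
qed

lemma tame_hom_relation:
  assumes H: "group H" and \<rho>: "\<rho> \<in> cont_homs p q H" and W: "group (tame_weil p q)"
  shows "\<rho> tame_phi \<otimes>\<^bsub>H\<^esub> \<rho> (tame_sigma p) = \<rho> (tame_sigma p) [^]\<^bsub>H\<^esub> q \<otimes>\<^bsub>H\<^esub> \<rho> tame_phi"
    and "\<rho> tame_phi \<in> carrier H" and "\<rho> (tame_sigma p) \<in> carrier H"
proof -
  interpret H: group H by (rule H)
  interpret W: group "tame_weil p q" by (rule W)
  interpret r: group_hom "tame_weil p q" H \<rho> using \<rho> by unfold_locales (auto simp: cont_homs_def)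
  have "\<rho> (tame_phi \<otimes>\<^bsub>tame_weil p q\<^esub> tame_sigma p) =
      \<rho> ((tame_sigma p [^]\<^bsub>tame_weil p q\<^esub> q) \<otimes>\<^bsub>tame_weil p q\<^esub> tame_phi)"
    by (simp add: tame_relation)
  then show "\<rho> tame_phi \<otimes>\<^bsub>H\<^esub> \<rho> (tame_sigma p) = \<rho> (tame_sigma p) [^]\<^bsub>H\<^esub> q \<otimes>\<^bsub>H\<^esub> \<rho> tame_phi"
    using sigma_in_carrier[of p q] phi_in_carrier[of p q] by (simp add: r.hom_nat_pow)
  show "\<rho> tame_phi \<in> carrier H" "\<rho> (tame_sigma p) \<in> carrier H"
    using sigma_in_carrier phi_in_carrier by auto
qed

lemma cont_homs_compose:
  assumes \<rho>: "\<rho> \<in> cont_homs p q H" and f: "f \<in> hom H K"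
  shows "(\<lambda>x. f (\<rho> x)) \<in> cont_homs p q K"
proof -
  have "continuous_map (discrete_topology (carrier H)) (discrete_topology (carrier K)) f"
    using f by (auto simp: continuous_map_def hom_def)
  then have "continuous_map (tame_topology p q) (discrete_topology (carrier K)) (f \<circ> \<rho>)"
    using \<rho> unfolding cont_homs_def by (auto intro: continuous_map_compose)
  moreover have "f \<circ> \<rho> \<in> hom (tame_weil p q) K"
    using \<rho> f unfolding cont_homs_def by (auto intro: hom_compose)
  ultimately show ?thesis by (simp add: cont_homs_def o_def)
qed

section \<open>Lifting\<close>

lemma ring_map_diff: "ring_map f \<Longrightarrow> f (x - y) = f x - f y"
  using ring_map_minus[of f y] unfolding ring_map_def by (metis add_uminus_conv_diff)

lemma mat_rel_krylov:
  assumes R: "ring_rel R" and A: "mat_rel R A B" and v: "vec_rel R v w"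
  shows "mat_rel R (krylov P A v) (krylov P B w)"
  using vec_rel_mult[OF R mat_rel_power[OF R A] v] ring_rel_0[OF R]
  by (auto simp: mat_rel_def krylov_def vec_rel_def)

lemma map_matrix_hom:
  assumes f: "ring_map f"
  shows "map_matrix f (A ** B) = map_matrix f A ** map_matrix f B"
    and "map_matrix f (mat 1 :: 'a::comm_ring_1^'n^'n) = mat 1"
    and "map_matrix f (mat_power (A :: 'a::comm_ring_1^'n^'n::finite) k) = mat_power (map_matrix f A) k"
  using mat_rel_mult[OF ring_rel_graph[OF f], of A _ B] mat_rel_one[OF ring_rel_graph[OF f]]
    mat_rel_power[OF ring_rel_graph[OF f], of A]
  by (simp_all add: mat_rel_graph)

lemma map_matrix_companion: "ring_map f \<Longrightarrow> map_matrix f (companion P x) = companion P (\<lambda>i k. f (x i k))"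
  by (auto simp: vec_eq_iff map_matrix_nth companion_def ring_map_0 ring_map_minus, auto simp: ring_map_def)

lemma hom_map_matrix:
  fixes f :: "'a::comm_ring_1 \<Rightarrow> 'b::comm_ring_1" and P :: "'n::finite \<Rightarrow> 'n \<Rightarrow> bool"
  assumes f: "ring_map f"
  shows "map_matrix f \<in> hom (levi P) (levi P)"
proof (rule homI)
  fix g :: "'a^'n^'n" assume "g \<in> carrier (levi P)"
  then have g: "invertible g" "block P g" by (auto simp: carrier_levi)
  then obtain g' where "g ** g' = mat 1" by (auto simp: invertible_def)
  then have "map_matrix f g ** map_matrix f g' = mat 1" by (metis map_matrix_hom(1,2)[OF f])
  then show "map_matrix f g \<in> carrier (levi P)"
    using block_map[OF f g(2)] by (auto simp: carrier_levi intro: invertible_right)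
qed (simp add: mult_levi map_matrix_hom[OF f])

lemma coprime_of_nat_nonzero:
  assumes "coprime q l" "of_nat l = (0 :: 'k::field)"
  shows "of_nat q \<noteq> (0 :: 'k)"
proof
  assume q: "of_nat q = (0 :: 'k)"
  obtain x y where "int q * x + int l * y = 1"
    using assms(1) bezout_int[of "int q" "int l"] by (metis coprime_imp_gcd_eq_1 coprime_int_iff mult.commute)
  then have "of_int (int q * x + int l * y) = (1 :: 'k)" by simp
  with q assms(2) show False by simp
qed

text \<open>A homomorphism amounts to matrices \<open>\<Sigma>\<close> and \<open>\<Phi>\<close>
  with the tame relation, where some power of \<open>\<Sigma>\<close> with exponent prime to
  \<open>p\<close> is trivial. So two matrices have to be lifted, and agreement on the whole group
  follows from the generators.\<close>

lemma char_I_smooth: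
  fixes p l q d :: nat
    and red :: "'o::{idom,ring_char_0} \<Rightarrow> 'k::{field,finite}"
    and M :: "'n::finite \<Rightarrow> 'n \<Rightarrow> bool"
    and \<rho>bar :: "tame \<Rightarrow> 'k^'n^'n"
  assumes p: "prime p" and l: "prime l" and pl: "p \<noteq> l" and q: "q = p ^ d"
    and coeff: "coefficient_system l red"
    and M: "equivp M"
    and regular: "invertible (krylov M (\<rho>bar (tame_sigma p)) vbar)"
  shows "char_I_formally_smooth p q red M \<rho>bar TYPE('c::comm_ring_1) TYPE('b::comm_ring_1)"
  unfolding char_I_formally_smooth_def
proof (intro allI impI ballI)
  fix \<alpha> :: "'o \<Rightarrow> 'c" and \<pi> :: "'c \<Rightarrow> 'b" and \<rho>\<^sub>B and c :: "('n, 'o) torus_ring \<Rightarrow> 'c"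
  assume \<alpha>: "ring_map \<alpha>" and \<pi>: "ring_map \<pi>" "surj \<pi>" and ker: "nilpotent_ideal {x. \<pi> x = 0}"
    and \<rho>B: "\<rho>\<^sub>B \<in> X_completion p q red M \<rho>bar (\<pi> \<circ> \<alpha>)" and cS: "c \<in> S_completion q red M \<alpha>"
    and cls: "is_class_of M (\<pi> \<circ> c) (\<rho>\<^sub>B (tame_sigma p))"
  let ?W = "tame_weil p q"
  note W = group_tame_weil[OF p q]
  have red: "ring_map red" "surj red" "of_nat l = (0 :: 'k)" using coeff by (auto simp: coefficient_system_def)
  have \<pi>\<alpha>: "ring_map (\<pi> \<circ> \<alpha>)" using \<alpha> \<pi>(1) by (simp add: ring_map_def)
  have hom: "\<rho>\<^sub>B \<in> cont_homs p q (levi M)" using \<rho>B by (simp add: X_completion_def)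
  obtain NB where NB: "nilpotent_ideal NB" "\<And>a. red a = 0 \<Longrightarrow> \<pi> (\<alpha> a) \<in> NB"
    and cong: "\<And>x i j a. x \<in> carrier ?W \<Longrightarrow> red a = \<rho>bar x $ i $ j \<Longrightarrow> \<rho>\<^sub>B x $ i $ j - \<pi> (\<alpha> a) \<in> NB"
    using \<rho>B by (auto simp: X_completion_def)
  have IB: "is_ideal NB" using NB(1) by (simp add: nilpotent_ideal_def)
  have cpts: "c \<in> S_points q M \<alpha>" "c \<in> quotient_points M \<alpha>"
    using cS by (auto simp: S_completion_def S_points_def)
  define \<Sigma>B where "\<Sigma>B = \<rho>\<^sub>B (tame_sigma p)"
  define \<Phi>B where "\<Phi>B = \<rho>\<^sub>B tame_phi"
  have \<Sigma>B: "invertible \<Sigma>B" "block M \<Sigma>B" and \<Phi>B: "invertible \<Phi>B" "block M \<Phi>B"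
    and rel: "\<Phi>B ** \<Sigma>B = mat_power \<Sigma>B q ** \<Phi>B"
    using tame_hom_relation[OF group_levi[OF M] hom W]
    by (simp_all add: carrier_levi mult_levi pow_levi \<Sigma>B_def \<Phi>B_def)

  \<comment> \<open>The residual cyclic vector is lifted through the coefficient ring, so that
    \<open>v\<close> and its image \<open>?v\<close> both reduce to it.\<close>
  define v where "v = (\<chi> i. \<alpha> (inv_into UNIV red (vbar $ i)))"
  let ?v = "\<chi> i. \<pi> (v $ i)"
  define KB where "KB = krylov M \<Sigma>B ?v"
  have KB: "invertible KB" "block M KB"
  proof -
    let ?R = "reduces_to red (\<pi> \<circ> \<alpha>) NB"
    have R: "ring_rel ?R" by (rule ring_rel_reduces_to[OF red(1) \<pi>\<alpha> IB])
    have "mat_rel ?R \<Sigma>B (\<rho>bar (tame_sigma p))"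
      using cong[OF sigma_in_carrier] surj_f_inv_f[OF red(2)]
      unfolding mat_rel_def reduces_to_def \<Sigma>B_def o_def by metis
    moreover have "vec_rel ?R ?v vbar"
      unfolding vec_rel_def reduces_to_def
    proof
      fix i
      show "\<exists>a. red a = vbar $ i \<and> ?v $ i - (\<pi> \<circ> \<alpha>) a \<in> NB"
        using IB surj_f_inv_f[OF red(2)]
        by (intro exI[of _ "inv_into UNIV red (vbar $ i)"]) (simp add: v_def is_ideal_def)
    qed
    ultimately have "mat_rel ?R KB (krylov M (\<rho>bar (tame_sigma p)) vbar)"
      unfolding KB_def by (rule mat_rel_krylov[OF R])
    then show "invertible KB"
      using NB(2) by (intro invertible_reduces_to[OF red(1,2) \<pi>\<alpha> NB(1) _ _ regular]) auto
    show "block M KB" by (simp add: KB_def block_krylov)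
  qed

  define \<chi>' where "\<chi>' i = (\<lambda>m. c (Polynomial.coeff (generic_charpoly M i) m))" for i
  note Rc = ring_rel_quotient_point[OF cpts(2) \<alpha>]
  have c01: "c 0 = 0" "c 1 = 1" using ring_rel_0[OF Rc] ring_rel_1[OF Rc] by auto
  have \<chi>B: "\<pi> (\<chi>' i m) = cp M \<Sigma>B i m" for i m
    using cls by (simp add: is_class_of_def cp_def \<chi>'_def \<Sigma>B_def)
  \<comment> \<open>The lift of \<open>KB\<close> is arbitrary on the blocks and zero off them, so
    that conjugation by it preserves block-diagonality.\<close>
  define K :: "'c^'n^'n" where "K = (\<chi> i j. if M i j then inv_into UNIV \<pi> (KB $ i $ j) else 0)"
  have K: "map_matrix \<pi> K = KB" "block M K"
    using KB(2) by (auto simp: K_def block_def vec_eq_iff map_matrix_nth surj_f_inv_f[OF \<pi>(2)] ring_map_0[OF \<pi>(1)])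
  have iK: "invertible K" using invertible_lift[OF \<pi> ker] KB(1) K(1) by metis
  then obtain K' where K': "K ** K' = mat 1" "K' ** K = mat 1" by (auto simp: invertible_def)
  have bK': "block M K'" by (rule block_inverse[OF M K(2) K'])
  define \<Sigma> where "\<Sigma> = K ** companion M \<chi>' ** K'"
  have \<Sigma>K: "\<Sigma> ** K = K ** companion M \<chi>'" by (simp add: \<Sigma>_def matrix_mul_assoc[symmetric] K')
  have b\<Sigma>: "block M \<Sigma>" unfolding \<Sigma>_def by (intro block_mult M K(2) block_companion bK')
  have KBinv: "KB ** map_matrix \<pi> K' = mat 1"
    using arg_cong[OF K'(1), of "map_matrix \<pi>"] by (simp add: map_matrix_hom[OF \<pi>(1)] K(1))
  have "map_matrix \<pi> \<Sigma> = KB ** companion M (cp M \<Sigma>B) ** map_matrix \<pi> K'"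
    by (simp add: \<Sigma>_def map_matrix_hom[OF \<pi>(1)] K(1) map_matrix_companion[OF \<pi>(1)] \<chi>B)
  also have "KB ** companion M (cp M \<Sigma>B) = \<Sigma>B ** KB"
    unfolding KB_def by (rule krylov_charpoly[OF M \<Sigma>B(2), symmetric])
  finally have \<pi>\<Sigma>: "map_matrix \<pi> \<Sigma> = \<Sigma>B" by (simp add: matrix_mul_assoc[symmetric] KBinv)
  have i\<Sigma>: "invertible \<Sigma>" using invertible_lift[OF \<pi> ker] \<Sigma>B(1) \<pi>\<Sigma> by metis

  have cp\<Sigma>: "cp M \<Sigma> i m = \<chi>' i m" for i m
  proof -
    have "cp M \<Sigma> i m = cp M (companion M \<chi>') i m"
      unfolding cp_def using block_charpoly_conj[OF M b\<Sigma> block_companion K(2) \<Sigma>K iK] by simp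
    also have "\<dots> = \<chi>' i m"
    proof (cases "m < csize M i")
      case True
      have "\<chi>' j = \<chi>' i" if "M i j" for j
        using equivp_class[OF M that] by (simp add: \<chi>'_def generic_charpoly_def)
      then show ?thesis by (intro charpoly_companion[OF M _ True])
    next
      \<comment> \<open>A companion matrix prescribes only the coefficients below the size of the
        class; beyond, both polynomials are monic of that degree.\<close>
      case False
      have "Polynomial.coeff (generic_charpoly M i :: ('n, 'o) torus_ring poly) m = (if m = csize M i then 1 else 0)"
        using False monic_prod_linear[of "{j. M i j}" torus_coord]
        by (auto simp: generic_charpoly_def csize_def coeff_eq_0)
      then show ?thesis using False cp_top[of M] cp_above[of M i m] by (auto simp: \<chi>'_def c01)
    qed
    finally show ?thesis .
  qed
  then have class\<Sigma>: "is_class_of M c \<Sigma>" by (simp add: is_class_of_def cp_def \<chi>'_def)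
  have cp\<Sigma>q: "cp M (mat_power \<Sigma> q) = cp M \<Sigma>"
  proof (rule cp_power_class[OF M cpts(1) \<alpha> b\<Sigma> K(2) iK _ class\<Sigma>])
    have "cp M \<Sigma> = \<chi>'" using cp\<Sigma> by (simp add: fun_eq_iff)
    then show "\<Sigma> ** K = K ** companion M (cp M \<Sigma>)" using \<Sigma>K by simp
  qed

  define L where "L = krylov M \<Sigma> v"
  note graph = ring_rel_graph[OF \<pi>(1)]
  have \<pi>L: "map_matrix \<pi> L = KB"
    unfolding L_def KB_def mat_rel_graph[symmetric]
    by (rule mat_rel_krylov[OF graph]) (auto simp: mat_rel_graph \<pi>\<Sigma> vec_rel_def)
  have iL: "invertible L" using invertible_lift[OF \<pi> ker] KB(1) \<pi>L by metis
  then obtain L' where L': "L ** L' = mat 1" "L' ** L = mat 1" by (auto simp: invertible_def)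
  have bL: "block M L" by (simp add: L_def block_krylov)
  have bL': "block M L'" by (rule block_inverse[OF M bL L'])
  \<comment> \<open>The prescribed image of \<open>v\<close> under \<open>\<Phi>\<close>, an
    arbitrary lift of \<open>\<Phi>B\<close> applied to \<open>?v\<close>. Its orbit
    \<open>L2\<close> under the \<open>q\<close>-th power of \<open>\<Sigma>\<close> reduces to
    \<open>\<Phi>B ** KB\<close>, because \<open>\<Phi>B\<close> is an intertwiner.\<close>
  define w where "w = (\<chi> i. inv_into UNIV \<pi> ((\<Phi>B *v ?v) $ i))"
  define L2 where "L2 = krylov M (mat_power \<Sigma> q) w"
  have \<pi>L2: "map_matrix \<pi> L2 = \<Phi>B ** KB"
  proof -
    have "map_matrix \<pi> L2 = krylov M (mat_power \<Sigma>B q) (\<Phi>B *v ?v)"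
      unfolding L2_def mat_rel_graph[symmetric]
      by (rule mat_rel_krylov[OF graph])
        (auto simp: mat_rel_graph map_matrix_hom[OF \<pi>(1)] \<pi>\<Sigma> vec_rel_def w_def surj_f_inv_f[OF \<pi>(2)])
    then show ?thesis unfolding KB_def krylov_intertwine[OF M \<Phi>B(2) rel] .
  qed
  define \<Phi> where "\<Phi> = L2 ** L'"
  have b\<Phi>: "block M \<Phi>" unfolding \<Phi>_def L2_def by (intro block_mult M block_krylov bL')
  have "KB ** map_matrix \<pi> L' = mat 1"
    using arg_cong[OF L'(1), of "map_matrix \<pi>"] by (simp add: map_matrix_hom[OF \<pi>(1)] \<pi>L)
  then have \<pi>\<Phi>: "map_matrix \<pi> \<Phi> = \<Phi>B"
    by (simp add: \<Phi>_def map_matrix_hom[OF \<pi>(1)] \<pi>L2 matrix_mul_assoc[symmetric])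
  have i\<Phi>: "invertible \<Phi>" using invertible_lift[OF \<pi> ker] \<Phi>B(1) \<pi>\<Phi> by metis
  have LC: "\<Sigma> ** L = L ** companion M (cp M \<Sigma>)"
    unfolding L_def by (rule krylov_charpoly[OF M b\<Sigma>])
  have L2C: "mat_power \<Sigma> q ** L2 = L2 ** companion M (cp M \<Sigma>)"
    unfolding L2_def by (subst krylov_charpoly[OF M block_power[OF M b\<Sigma>]]) (simp add: cp\<Sigma>q)
  have "L' ** \<Sigma> = L' ** (\<Sigma> ** L) ** L'" by (simp add: matrix_mul_assoc[symmetric] L')
  also have "\<dots> = (L' ** L) ** companion M (cp M \<Sigma>) ** L'" unfolding LC by (simp only: matrix_mul_assoc)
  finally have L'\<Sigma>: "L' ** \<Sigma> = companion M (cp M \<Sigma>) ** L'" by (simp add: L')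
  have "\<Phi> ** \<Sigma> = L2 ** companion M (cp M \<Sigma>) ** L'"
    unfolding \<Phi>_def matrix_mul_assoc[symmetric] L'\<Sigma> ..
  also have "\<dots> = mat_power \<Sigma> q ** \<Phi>" unfolding \<Phi>_def L2C[symmetric] by (simp only: matrix_mul_assoc)
  finally have \<Phi>\<Sigma>: "\<Phi> ** \<Sigma> = mat_power \<Sigma> q ** \<Phi>" .

  define N where "N = {x. \<pi> x \<in> NB}"
  have N: "nilpotent_ideal N" unfolding N_def by (rule nilpotent_ideal_preimage[OF \<pi>(1) ker NB(1)])
  obtain e where I: "is_ideal N" and e: "\<forall>x :: nat \<Rightarrow> 'c. (\<forall>k<e. x k \<in> N) \<longrightarrow> (\<Prod>k<e. x k) = 0"
    using nilpotent_idealE[OF N] by metis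
  \<comment> \<open>The order of \<open>\<Sigma>\<close> is bounded in two stages: \<open>n\<close>
    makes its power trivial modulo the kernel of \<open>\<pi>\<close>, and a power of
    \<open>l\<close> then removes the rest, as \<open>l\<close> lies in the nilpotent ideal
    \<open>N\<close>. Both exponents are prime to \<open>p\<close>.\<close>
  obtain n where n: "n \<in> levels p" "mat_power \<Sigma>B n = mat 1"
    using cont_hom_inertia[OF group_levi[OF M] p q hom] by (metis \<Sigma>B_def dvd_refl one_levi pow_levi)
  have of_nat: "f (of_nat k) = of_nat k" if "ring_map f" for f :: "'o \<Rightarrow> 'z::comm_ring_1" and k
    using that ring_map_0[OF that] by (induction k) (auto simp: ring_map_def)
  have lN: "of_nat l \<in> N"
    using NB(2)[of "of_nat l"] of_nat[OF red(1), of l] of_nat[OF \<alpha>, of l] red(3) by (simp add: N_def)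
  have "mat_in N (mat_power \<Sigma> n - mat 1)"
  proof -
    have "map_matrix \<pi> (mat_power \<Sigma> n) = map_matrix \<pi> (mat 1)"
      by (simp add: map_matrix_hom[OF \<pi>(1)] \<pi>\<Sigma> n(2))
    then have "\<pi> (mat_power \<Sigma> n $ i $ j) = \<pi> (mat 1 $ i $ j)" for i j
      by (metis map_matrix_nth)
    then have "\<pi> (mat_power \<Sigma> n $ i $ j - mat 1 $ i $ j) = 0" for i j
      by (simp add: ring_map_diff[OF \<pi>(1)])
    then show ?thesis using IB by (simp add: mat_in_def N_def is_ideal_def)
  qed
  then have "mat_power \<Sigma> (n * l ^ e) = mat 1"
    unfolding mat_power_mult by (rule mat_in_unipotent_order[OF I e _ lN])
  moreover have "n * l ^ e \<in> levels p"
    using n(1) primes_coprime[OF l p] pl prime_gt_0_nat[OF l] by (auto simp: levels_def)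
  ultimately obtain \<rho> where \<rho>: "\<rho> \<in> cont_homs p q (levi M)" "\<rho> (tame_sigma p) = \<Sigma>" "\<rho> tame_phi = \<Phi>"
    using tame_hom_exists[OF group_levi[OF M] p q, of \<Sigma> \<Phi> "n * l ^ e"] i\<Sigma> b\<Sigma> i\<Phi> b\<Phi> \<Phi>\<Sigma>
    by (auto simp: carrier_levi mult_levi pow_levi one_levi)
  have lift: "map_matrix \<pi> (\<rho> x) = \<rho>\<^sub>B x" if "x \<in> carrier ?W" for x
    using cont_hom_unique[OF group_levi[OF M] p q cont_homs_compose[OF \<rho>(1) hom_map_matrix[OF \<pi>(1)]] hom _ _ that]
    by (simp add: \<rho> \<pi>\<Sigma> \<pi>\<Phi> \<Sigma>B_def \<Phi>B_def)
  have "\<rho> \<in> X_completion p q red M \<rho>bar \<alpha>"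
    unfolding X_completion_def
  proof (intro CollectI conjI exI[of _ N] allI ballI impI)
    fix x i j a assume x: "x \<in> carrier ?W" and a: "red a = \<rho>bar x $ i $ j"
    have "\<pi> (\<rho> x $ i $ j - \<alpha> a) = \<rho>\<^sub>B x $ i $ j - \<pi> (\<alpha> a)"
      by (simp add: ring_map_diff[OF \<pi>(1)] lift[OF x, symmetric] map_matrix_nth)
    then show "\<rho> x $ i $ j - \<alpha> a \<in> N" using cong[OF x a] by (simp add: N_def)
  qed (use \<rho>(1) N NB(2) in \<open>auto simp: N_def\<close>)
  then show "\<exists>\<rho>\<in>X_completion p q red M \<rho>bar \<alpha>.
      (\<forall>x\<in>carrier ?W. map_matrix \<pi> (\<rho> x) = \<rho>\<^sub>B x) \<and> is_class_of M c (\<rho> (tame_sigma p))"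
    using lift class\<Sigma> \<rho>(2) by (intro bexI[of _ \<rho>]) auto
qed

text \<open>Discreteness is applied to the relation \<open>Q\<close> of the Jordan decomposition,
  with the Frobenius image in the group of \<open>Q\<close> supplied by
  \<open>unipotent_power_conj\<close>; so \<open>Q\<close> cannot be properly finer than
  \<open>M\<close>. The cyclic vector of \<open>A\<close> is then carried back by \<open>h\<close>
  to the nilpotent part and by \<open>krylov_shift\<close> to the unipotent matrix.\<close>

lemma discrete_imp_regular:
  fixes \<rho> :: "tame \<Rightarrow> 'k::field^'n^'n::finite"
  assumes p: "prime p" and q: "q = p ^ d" and M: "equivp M"
    and \<rho>: "\<rho> \<in> cont_homs p q (levi M)" and disc: "inertially_discrete p q M \<rho>"
    and uni: "unipotent (\<rho> (tame_sigma p))" and qk: "of_nat q \<noteq> (0 :: 'k)"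
  obtains v where "invertible (krylov M (\<rho> (tame_sigma p)) v)"
proof -
  let ?u = "\<rho> (tame_sigma p)"
  let ?N = "?u - mat 1"
  note W = group_tame_weil[OF p q]
  have u: "invertible ?u" "block M ?u"
    using tame_hom_relation(3)[OF group_levi[OF M] \<rho> W] by (simp_all add: carrier_levi)
  obtain k where k: "mat_power ?N k = 0" using uni by (auto simp: unipotent_def)
  have bN: "block M ?N" by (intro block_diff u block_mat M)
  obtain Q h h' v where Q: "equivp Q" "Q \<le> M" and h: "block M h" "h ** h' = mat 1" "h' ** h = mat 1"
    and cyc: "cyclic_nil Q (h' ** ?N ** h) v"
    using nilpotent_cyclic_decomposition[OF M bN k] by blast
  define A where "A = h' ** ?N ** h"
  have cyc: "cyclic_nil Q A v" using cyc by (simp add: A_def)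
  have hA: "h ** A = ?N ** h" by (simp add: A_def matrix_mul_assoc h)
  let ?u' = "mat 1 + A"
  have uh: "?u ** h = h ** ?u'"
    by (simp add: matrix_add_ldistrib hA matrix_diff_rdistrib)
  have pw: "mat_power ?u' m = h' ** mat_power ?u m ** h" for m
  proof -
    have "h' ** mat_power ?u m ** h = h' ** (h ** mat_power ?u' m)"
      unfolding mat_power_intertwine[OF uh, symmetric] by (simp only: matrix_mul_assoc)
    then show ?thesis by (simp add: matrix_mul_assoc h)
  qed
  have "invertible h" "invertible h'" using h by (auto simp: invertible_def)
  then have "invertible ?u'" using pw[of 1] u(1) by (simp add: invertible_mult)
  then have u': "?u' \<in> carrier (levi Q)"
    using cyc by (simp add: carrier_levi block_add block_mat[OF Q(1)] cyclic_nil_def)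
  obtain t where t: "block Q t" "invertible t" "t ** ?u' = mat_power ?u' q ** t"
    using unipotent_power_conj[OF Q(1) cyc qk] .
  obtain n where n: "n \<in> levels p" "\<And>m. m \<in> levels p \<Longrightarrow> n dvd m \<Longrightarrow> mat_power ?u m = mat 1"
    "\<And>m x. m \<in> levels p \<Longrightarrow> n dvd m \<Longrightarrow> x \<in> Zhat_prime_to p \<Longrightarrow> \<rho> (x, 0) = mat_power ?u (nat (x m))"
    using cont_hom_inertia[OF group_levi[OF M] p q \<rho>] unfolding pow_levi one_levi by blast
  have "mat_power ?u' n = mat 1" using n(1,2) by (simp add: pw h)
  then obtain \<rho>' where \<rho>': "\<rho>' \<in> cont_homs p q (levi Q)" "\<rho>' (tame_sigma p) = ?u'"
    using tame_hom_exists[OF group_levi[OF Q(1)] p q u' _ _ n(1), of t] t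
    unfolding pow_levi one_levi mult_levi carrier_levi by blast
  obtain n' where n': "n' \<in> levels p"
    "\<And>m. m \<in> levels p \<Longrightarrow> n' dvd m \<Longrightarrow> \<rho>' (tame_sigma p) [^]\<^bsub>levi Q\<^esub> m = \<one>\<^bsub>levi Q\<^esub>"
    "\<And>m x. m \<in> levels p \<Longrightarrow> n' dvd m \<Longrightarrow> x \<in> Zhat_prime_to p \<Longrightarrow>
      \<rho>' (x, 0) = \<rho>' (tame_sigma p) [^]\<^bsub>levi Q\<^esub> nat (x m)"
    using cont_hom_inertia[OF group_levi[OF Q(1)] p q \<rho>'(1)] by blast
  \<comment> \<open>Extendability asks for agreement on all of inertia, so the two homomorphisms are
    compared as powers of their generators at a common level.\<close>
  have m: "n * n' \<in> levels p" by (rule levels_mult[OF n(1) n'(1)])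
  have "matrix_inv h' = (h ** h') ** matrix_inv h'" by (simp add: h)
  also have "\<dots> = h" by (simp add: matrix_mul_assoc[symmetric] matrix_inv(1)[OF \<open>invertible h'\<close>])
  finally have inv: "matrix_inv h' = h" .
  have "\<rho>' x = h' ** \<rho> x ** matrix_inv h'" if x: "x \<in> tame_inertia p" for x
  proof -
    obtain y where y: "x = (y, 0)" "y \<in> Zhat_prime_to p" using x by (auto simp: tame_inertia_def)
    then show ?thesis using n(3)[OF m _ y(2)] n'(3)[OF m _ y(2)] by (simp add: inv pw \<rho>'(2) pow_levi)
  qed
  then have ext: "extendable p q Q (\<lambda>x. h' ** \<rho> x ** matrix_inv h')"
    using \<rho>'(1) unfolding extendable_def by blast
  have "h' \<in> carrier (levi M)"
    using \<open>invertible h'\<close> block_inverse[OF M h] by (simp add: carrier_levi)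
  then have "\<not> Q < M" using disc Q(1) ext unfolding inertially_discrete_def by blast
  then have "Q = M" using Q(2) by (simp add: less_le)
  then have "invertible (krylov M A v)" using cyclic_nil_krylov(1)[OF Q(1) cyc] by simp
  then have "invertible (krylov M ?N (h *v v))"
    using invertible_mult[OF \<open>invertible h\<close>] krylov_intertwine[OF M h(1) hA, of v] by metis
  then have "invertible (krylov M (mat 1 + ?N) (h *v v))" by (rule krylov_shift[OF M])
  then show thesis using that by simp
qed

theorem theorem2p19:
  fixes p l q d f :: nat
    and red :: "'o::{idom,ring_char_0} \<Rightarrow> 'k::{field,finite}"
    and G M :: "'n::finite \<Rightarrow> 'n \<Rightarrow> bool"
    and \<rho>bar :: "tame \<Rightarrow> 'k^'n^'n"
  assumes "prime p" and "prime l" and "p \<noteq> l"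
    and "d \<ge> 1" and "q = p ^ d"
    and "coefficient_system l red"
    and "equivp G" and "equivp M" and "M \<le> G"
    and "f \<ge> 1"
    and "\<rho>bar \<in> cont_homs p q (levi G)"
    and "unipotent (\<rho>bar (tame_sigma p))"
    and "f_distinguished f p q G M \<rho>bar"
  shows "char_I_formally_smooth p q red M \<rho>bar TYPE('c::comm_ring_1) TYPE('b::comm_ring_1)"
proof -
  have "coprime q l"
    using primes_coprime[OF \<open>prime p\<close> \<open>prime l\<close> \<open>p \<noteq> l\<close>] \<open>q = p ^ d\<close> by simp
  moreover have "of_nat l = (0 :: 'k)"
    using \<open>coefficient_system l red\<close> by (simp add: coefficient_system_def)
  ultimately have "of_nat q \<noteq> (0 :: 'k)" by (rule coprime_of_nat_nonzero)
  moreover have "\<rho>bar \<in> cont_homs p q (levi M)" "inertially_discrete p q M \<rho>bar"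
    using \<open>f_distinguished f p q G M \<rho>bar\<close> by (simp_all add: f_distinguished_def)
  ultimately obtain v where "invertible (krylov M (\<rho>bar (tame_sigma p)) v)"
    using discrete_imp_regular assms by metis
  then show ?thesis
    using char_I_smooth assms by metis
qed

end
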